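(* Let $\mu$ be a non-negative Radon measure on $\mathbb{R}^d$. The operator $\Phi:\mathrm{D}_\infty(\mathrm{div}_\mu)\to\mathrm{Der}_b(\mathbb{R}^d,\mu)$ given by $$\Phi(v)(f):=v\cdot\nabla_\mu f\in L^\infty_\mu(\mathbb{R}^d),\qquad v\in\mathrm{D}_\infty(\mathrm{div}_\mu),\ f\in\mathrm{LIP}_c(\mathbb{R}^d),$$ is a bijection, is $\mathrm{LIP}_c(\mathbb{R}^d)$-linear, and satisfies $$|\Phi(v)|=|v|\quad\text{and}\quad\mathrm{div}(\Phi(v))=\mathrm{div}_\mu(v)\qquad\mu\text{-a.e., for every }v\in\mathrm{D}_\infty(\mathrm{div}_\mu).$$
   Context: $\mathrm{LIP}_c(\mathbb{R}^d)$ is the space of compactly supported real-valued Lipschitz functions on $\mathbb{R}^d$. $\mathrm{Lip}(f;E)$ is the Lipschitz constant of $f|_E$, and $\mathrm{lip}_a(f)(x):=\lim_{r\to0}\mathrm{Lip}(f;B_r(x))$. $L^0_\mu(\mathbb{R}^d)$ is the space of $\mu$-measurable functions modulo $\mu$-a.e. equality. Vector fields: $\mathrm{D}_\infty(\mathrm{div}_\mu)$ is the set of $v\in L^\infty_\mu(\mathbb{R}^d;\mathbb{R}^d)$ for which there exists a (unique) $\mathrm{div}_\mu(v)\in L^\infty_\mu(\mathbb{R}^d)$ with $\int\nabla f\cdot v\,d\mu=-\int f\,\mathrm{div}_\mu(v)\,d\mu$ for all $f\in C^\infty_c(\mathbb{R}^d)$. Tangential gradient: a bundle in $\mathbb{R}^d$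 is a map $V$ assigning to each $x$ a linear subspace $V(x)\subseteq\mathbb{R}^d$ with $x\mapsto\mathrm{dist}(y,V(x))$ Borel for every $y\in\mathbb{R}^d$. $T_\mu$ is the ($\mu$-a.e. unique) minimal bundle such that every $v\in\mathrm{D}_\infty(\mathrm{div}_\mu)$ satisfies $v(x)\in T_\mu(x)$ for $\mu$-a.e. $x$ (minimal: $T_\mu(x)\subseteq S(x)$ for $\mu$-a.e. $x$ for any other bundle $S$ with this property). $\Gamma^1_\mu(T_\mu)$ is the space of $v\in L^1_\mu(\mathbb{R}^d;\mathbb{R}^d)$ with $v(x)\in T_\mu(x)$ for $\mu$-a.e. $x$. For $f\in C^\infty_c(\mathbb{R}^d)$, $\nabla_\mu f(x):=\mathrm{pr}_{T_\mu(x)}(\nabla f(x))$ (orthogonal projection). $W^{1,1}(\mathbb{R}^d,\mu)$ is the completion of $C^\infty_c(\mathbb{R}^d)$ under $\|f\|_{L^1_\mu}+\|\nabla_\mu f\|_{L^1_\mu}$; since $\nabla_\mu$ is closable, it is identified with the set of $f\in L^1_\mu(\mathbb{R}^d)$ for which there are $f_n\in C^\infty_c(\mathbb{R}^d)$ and $w\in\Gamma^1_\mu(T_\mu)$ with $f_n\to f$ in $L^1_\mu$ and $\nabla_\mu f_n\to w$ in $L^1_\mu(\mathbb{R}^d;\mathbb{R}^d)$; such $w$ is unique and is denoted $\nabla_\mu f$. Every $f\in\mathrm{LIP}_c(\mathbb{R}^d)$ belongs to $W^{1,1}(\mathbb{R}^d,\mu)$, with $|\nabla_\mu f|\le\mathrm{lip}_a(f)$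 $\mu$-a.e. Derivations: a derivation is a linear map $\mathbf b:\mathrm{LIP}_c(\mathbb{R}^d)\to L^0_\mu(\mathbb{R}^d)$ with $\mathbf b(fg)=\mathbf b(f)g+f\mathbf b(g)$ for all $f,g$, and such that for some non-negative $G\in L^0_\mu(\mathbb{R}^d)$ one has $|\mathbf b(f)|\le G\,\mathrm{lip}_a(f)$ $\mu$-a.e. for all $f\in\mathrm{LIP}_c(\mathbb{R}^d)$; the least such $G$ ($\mu$-a.e.) is denoted $|\mathbf b|$. $\mathrm{Der}_b(\mathbb{R}^d,\mu)$ is the set of derivations with $|\mathbf b|\in L^\infty_\mu(\mathbb{R}^d)$ for which there exists a (unique) $\mathrm{div}(\mathbf b)\in L^\infty_\mu(\mathbb{R}^d)$ with $\int\mathbf b(f)\,d\mu=-\int f\,\mathrm{div}(\mathbf b)\,d\mu$ for all $f\in\mathrm{LIP}_c(\mathbb{R}^d)$. $\mathrm{LIP}_c(\mathbb{R}^d)$-linear means linear and such that $\Phi(hv)=h\,\Phi(v)$ for all $h\in\mathrm{LIP}_c(\mathbb{R}^d)$, where $(h\mathbf b)(f):=h\,\mathbf b(f)$. *)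

theory Defs
  imports "HOL-Analysis.Analysis"
begin

text \<open>
  Elements of \<open>L\<^sup>0\<close>, \<open>L\<^sup>1\<close> and \<open>L\<^sup>\<infinity>\<close> are represented by Borel functions, and equality in these
  spaces is equality almost everywhere. (Every function measurable for the completion agrees
  almost everywhere with a Borel one, so no class is lost.) Vector fields and derivations are
  handled in the same way; their quotients by a.e. equality are formed explicitly at the end.
  Objects that are only unique up to a.e. equality are picked by Hilbert choice.
\<close>

section \<open>Measures and function spaces\<close>

text \<open>
  On a Euclidean space every locally finite Borel measure is automatically inner and outer
  regular.
\<close>

definition radon_measure :: "'a::euclidean_space measure \<Rightarrow> bool" where
  "radon_measure \<mu> \<longleftrightarrow>
     sets \<mu> = sets borel \<and> (\<forall>K. compact K \<longrightarrow> emeasure \<mu> K < \<infinity>)"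

definition Linfty :: "'a::euclidean_space measure \<Rightarrow> ('a \<Rightarrow> 'b::euclidean_space) set" where
  "Linfty \<mu> = {f \<in> borel_measurable \<mu>. \<exists>C. AE x in \<mu>. norm (f x) \<le> C}"

text \<open>
  Integrability is part of the definition because the Bochner integral of a non-integrable
  function is \<open>0\<close>.
\<close>

definition L1_tendsto ::
  "'a::euclidean_space measure \<Rightarrow> (nat \<Rightarrow> 'a \<Rightarrow> 'b::euclidean_space) \<Rightarrow> ('a \<Rightarrow> 'b) \<Rightarrow> bool" where
  "L1_tendsto \<mu> F f \<longleftrightarrow>
     (\<forall>n. integrable \<mu> (F n)) \<and> integrable \<mu> f \<and>
     (\<lambda>n. \<integral>x. norm (F n x - f x) \<partial>\<mu>) \<longlonglongrightarrow> 0"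

definition compactly_supported :: "('a::euclidean_space \<Rightarrow> real) \<Rightarrow> bool" where
  "compactly_supported f \<longleftrightarrow> compact (closure (support_on UNIV f))"

definition LIPc :: "('a::euclidean_space \<Rightarrow> real) set" where
  "LIPc = {f. (\<exists>L. L-lipschitz_on UNIV f) \<and> compactly_supported f}"

definition Lip :: "('a::euclidean_space \<Rightarrow> real) \<Rightarrow> 'a set \<Rightarrow> real" where
  "Lip f E = Inf {L. L-lipschitz_on E f}"

definition lip_a :: "('a::euclidean_space \<Rightarrow> real) \<Rightarrow> 'a \<Rightarrow> real" where
  "lip_a f x = Lim (at_right 0) (\<lambda>r. Lip f (ball x r))"

fun Ck :: "nat \<Rightarrow> ('a::euclidean_space \<Rightarrow> real) \<Rightarrow> bool" where
  "Ck 0 f \<longleftrightarrow> continuous_on UNIV f"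
| "Ck (Suc k) f \<longleftrightarrow>
     (\<forall>x. f differentiable (at x)) \<and>
     (\<forall>i\<in>Basis. Ck k (\<lambda>x. frechet_derivative f (at x) i))"

definition Cinf_c :: "('a::euclidean_space \<Rightarrow> real) set" where
  "Cinf_c = {f. (\<forall>k. Ck k f) \<and> compactly_supported f}"

definition grad :: "('a::euclidean_space \<Rightarrow> real) \<Rightarrow> 'a \<Rightarrow> 'a" where
  "grad f x = (THE D. GDERIV f x :> D)"


section \<open>Vector fields with bounded divergence\<close>

definition has_div_mu ::
  "'a::euclidean_space measure \<Rightarrow> ('a \<Rightarrow> 'a) \<Rightarrow> ('a \<Rightarrow> real) \<Rightarrow> bool" where
  "has_div_mu \<mu> v g \<longleftrightarrow>
     g \<in> Linfty \<mu> \<and>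
     (\<forall>f\<in>Cinf_c. (\<integral>x. grad f x \<bullet> v x \<partial>\<mu>) = - (\<integral>x. f x * g x \<partial>\<mu>))"

definition D_infty :: "'a::euclidean_space measure \<Rightarrow> ('a \<Rightarrow> 'a) set" where
  "D_infty \<mu> = {v \<in> Linfty \<mu>. \<exists>g. has_div_mu \<mu> v g}"

definition div_mu :: "'a::euclidean_space measure \<Rightarrow> ('a \<Rightarrow> 'a) \<Rightarrow> 'a \<Rightarrow> real" where
  "div_mu \<mu> v = (SOME g. has_div_mu \<mu> v g)"


section \<open>The tangent bundle and the tangential gradient\<close>

definition is_bundle :: "('a::euclidean_space \<Rightarrow> 'a set) \<Rightarrow> bool" where
  "is_bundle V \<longleftrightarrow>
     (\<forall>x. subspace (V x)) \<and> (\<forall>y. (\<lambda>x. infdist y (V x)) \<in> borel_measurable borel)"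

definition contains_D_infty ::
  "'a::euclidean_space measure \<Rightarrow> ('a \<Rightarrow> 'a set) \<Rightarrow> bool" where
  "contains_D_infty \<mu> V \<longleftrightarrow> (\<forall>v\<in>D_infty \<mu>. AE x in \<mu>. v x \<in> V x)"

definition is_tangent_bundle ::
  "'a::euclidean_space measure \<Rightarrow> ('a \<Rightarrow> 'a set) \<Rightarrow> bool" where
  "is_tangent_bundle \<mu> T \<longleftrightarrow>
     is_bundle T \<and> contains_D_infty \<mu> T \<and>
     (\<forall>S. is_bundle S \<and> contains_D_infty \<mu> S \<longrightarrow> (AE x in \<mu>. T x \<subseteq> S x))"

definition tangent_bundle :: "'a::euclidean_space measure \<Rightarrow> 'a \<Rightarrow> 'a set" where
  "tangent_bundle \<mu> = (SOME T. is_tangent_bundle \<mu> T)"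

definition orth_proj :: "'a::euclidean_space set \<Rightarrow> 'a \<Rightarrow> 'a" where
  "orth_proj V y = (THE p. p \<in> V \<and> (\<forall>u\<in>V. orthogonal (y - p) u))"

definition Gamma1 :: "'a::euclidean_space measure \<Rightarrow> ('a \<Rightarrow> 'a set) \<Rightarrow> ('a \<Rightarrow> 'a) set" where
  "Gamma1 \<mu> V = {w. integrable \<mu> w \<and> (AE x in \<mu>. w x \<in> V x)}"

definition tgrad_smooth ::
  "'a::euclidean_space measure \<Rightarrow> ('a \<Rightarrow> real) \<Rightarrow> 'a \<Rightarrow> 'a" where
  "tgrad_smooth \<mu> f x = orth_proj (tangent_bundle \<mu> x) (grad f x)"

text \<open>
  The relation \<open>has_tgrad \<mu> f w\<close> says that \<open>f\<close> belongs to \<open>W\<^sup>1\<^sup>,\<^sup>1\<close> with tangential gradient \<open>w\<close>,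
  i.e. that \<open>(f, w)\<close> lies in the closure of the graph of the tangential gradient on test functions.
\<close>

definition has_tgrad ::
  "'a::euclidean_space measure \<Rightarrow> ('a \<Rightarrow> real) \<Rightarrow> ('a \<Rightarrow> 'a) \<Rightarrow> bool" where
  "has_tgrad \<mu> f w \<longleftrightarrow>
     w \<in> Gamma1 \<mu> (tangent_bundle \<mu>) \<and>
     (\<exists>F. (\<forall>n. F n \<in> Cinf_c) \<and> L1_tendsto \<mu> F f \<and>
          L1_tendsto \<mu> (\<lambda>n. tgrad_smooth \<mu> (F n)) w)"

definition tgrad :: "'a::euclidean_space measure \<Rightarrow> ('a \<Rightarrow> real) \<Rightarrow> 'a \<Rightarrow> 'a" where
  "tgrad \<mu> f = (SOME w. has_tgrad \<mu> f w)"


section \<open>Derivations with bounded divergence\<close>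

text \<open>
  A derivation is represented by an operator on all real functions; only its values on
  \<open>LIPc\<close>, and these only up to a.e. equality, are relevant.
\<close>

type_synonym 'a derivation = "('a \<Rightarrow> real) \<Rightarrow> 'a \<Rightarrow> real"

definition der_bound ::
  "'a::euclidean_space measure \<Rightarrow> 'a derivation \<Rightarrow> ('a \<Rightarrow> real) \<Rightarrow> bool" where
  "der_bound \<mu> b G \<longleftrightarrow>
     G \<in> borel_measurable \<mu> \<and> (AE x in \<mu>. 0 \<le> G x) \<and>
     (\<forall>f\<in>LIPc. AE x in \<mu>. \<bar>b f x\<bar> \<le> G x * lip_a f x)"

definition is_derivation :: "'a::euclidean_space measure \<Rightarrow> 'a derivation \<Rightarrow> bool" where
  "is_derivation \<mu> b \<longleftrightarrow>
     (\<forall>f\<in>LIPc. b f \<in> borel_measurable \<mu>) \<and>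
     (\<forall>f\<in>LIPc. \<forall>g\<in>LIPc. AE x in \<mu>. b (\<lambda>y. f y + g y) x = b f x + b g x) \<and>
     (\<forall>c. \<forall>f\<in>LIPc. AE x in \<mu>. b (\<lambda>y. c * f y) x = c * b f x) \<and>
     (\<forall>f\<in>LIPc. \<forall>g\<in>LIPc. AE x in \<mu>. b (\<lambda>y. f y * g y) x = b f x * g x + f x * b g x) \<and>
     (\<exists>G. der_bound \<mu> b G)"

definition is_der_norm ::
  "'a::euclidean_space measure \<Rightarrow> 'a derivation \<Rightarrow> ('a \<Rightarrow> real) \<Rightarrow> bool" where
  "is_der_norm \<mu> b G \<longleftrightarrow>
     der_bound \<mu> b G \<and> (\<forall>H. der_bound \<mu> b H \<longrightarrow> (AE x in \<mu>. G x \<le> H x))"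

definition der_norm :: "'a::euclidean_space measure \<Rightarrow> 'a derivation \<Rightarrow> 'a \<Rightarrow> real" where
  "der_norm \<mu> b = (SOME G. is_der_norm \<mu> b G)"

definition has_der_div ::
  "'a::euclidean_space measure \<Rightarrow> 'a derivation \<Rightarrow> ('a \<Rightarrow> real) \<Rightarrow> bool" where
  "has_der_div \<mu> b g \<longleftrightarrow>
     g \<in> Linfty \<mu> \<and>
     (\<forall>f\<in>LIPc. (\<integral>x. b f x \<partial>\<mu>) = - (\<integral>x. f x * g x \<partial>\<mu>))"

definition der_div :: "'a::euclidean_space measure \<Rightarrow> 'a derivation \<Rightarrow> 'a \<Rightarrow> real" where
  "der_div \<mu> b = (SOME g. has_der_div \<mu> b g)"

definition Der_b :: "'a::euclidean_space measure \<Rightarrow> 'a derivation set" where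
  "Der_b \<mu> = {b. is_derivation \<mu> b \<and> der_norm \<mu> b \<in> Linfty \<mu> \<and> (\<exists>g. has_der_div \<mu> b g)}"


section \<open>Almost everywhere equality and the operator\<close>

definition vf_eq :: "'a::euclidean_space measure \<Rightarrow> (('a \<Rightarrow> 'a) \<times> ('a \<Rightarrow> 'a)) set" where
  "vf_eq \<mu> = {(v, w). v \<in> D_infty \<mu> \<and> w \<in> D_infty \<mu> \<and> (AE x in \<mu>. v x = w x)}"

definition der_eq ::
  "'a::euclidean_space measure \<Rightarrow> ('a derivation \<times> 'a derivation) set" where
  "der_eq \<mu> = {(b, c). b \<in> Der_b \<mu> \<and> c \<in> Der_b \<mu> \<and>
                        (\<forall>f\<in>LIPc. AE x in \<mu>. b f x = c f x)}"

lemma equiv_vf_eq: "equiv (D_infty \<mu>) (vf_eq \<mu>)"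
proof (rule equivI)
  show "trans (vf_eq \<mu>)"
    unfolding trans_def vf_eq_def by (auto elim: AE_mp)
qed (auto simp: vf_eq_def refl_on_def sym_def eq_commute)

lemma equiv_der_eq: "equiv (Der_b \<mu>) (der_eq \<mu>)"
proof (rule equivI)
  show "trans (der_eq \<mu>)"
  proof (rule transI)
    fix a b c assume ab: "(a, b) \<in> der_eq \<mu>" and bc: "(b, c) \<in> der_eq \<mu>"
    have "AE x in \<mu>. a f x = c f x" if f: "f \<in> LIPc" for f
    proof -
      have "AE x in \<mu>. a f x = b f x" "AE x in \<mu>. b f x = c f x"
        using ab bc f by (auto simp: der_eq_def)
      then show ?thesis by eventually_elim simp
    qed
    then show "(a, c) \<in> der_eq \<mu>" using ab bc by (auto simp: der_eq_def)
  qed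
qed (auto simp: der_eq_def refl_on_def sym_def eq_commute)

definition Phi :: "'a::euclidean_space measure \<Rightarrow> ('a \<Rightarrow> 'a) \<Rightarrow> 'a derivation" where
  "Phi \<mu> v f = (\<lambda>x. v x \<bullet> tgrad \<mu> f x)"

text \<open>The map on classes modulo a.e. equality induced by an operator on representatives.\<close>

definition on_classes ::
  "'a::euclidean_space measure \<Rightarrow> (('a \<Rightarrow> 'a) \<Rightarrow> 'a derivation) \<Rightarrow>
    ('a \<Rightarrow> 'a) set \<Rightarrow> 'a derivation set" where
  "on_classes \<mu> P V = (\<Union>v\<in>V. der_eq \<mu> `` {P v})"

text \<open>
  The module structures are pointwise. The clauses include that the domain is
  closed under the operations; closure of the codomain is part of \<open>der_eq\<close>.
\<close>

definition LIPc_linear ::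
  "'a::euclidean_space measure \<Rightarrow> (('a \<Rightarrow> 'a) \<Rightarrow> 'a derivation) \<Rightarrow> bool" where
  "LIPc_linear \<mu> P \<longleftrightarrow>
     (\<forall>v\<in>D_infty \<mu>. \<forall>w\<in>D_infty \<mu>. (\<lambda>x. v x + w x) \<in> D_infty \<mu> \<and>
        (P (\<lambda>x. v x + w x), \<lambda>f x. P v f x + P w f x) \<in> der_eq \<mu>) \<and>
     (\<forall>c::real. \<forall>v\<in>D_infty \<mu>. (\<lambda>x. c *\<^sub>R v x) \<in> D_infty \<mu> \<and>
        (P (\<lambda>x. c *\<^sub>R v x), \<lambda>f x. c * P v f x) \<in> der_eq \<mu>) \<and>
     (\<forall>h\<in>LIPc. \<forall>v\<in>D_infty \<mu>. (\<lambda>x. h x *\<^sub>R v x) \<in> D_infty \<mu> \<and>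
        (P (\<lambda>x. h x *\<^sub>R v x), \<lambda>f x. h x * P v f x) \<in> der_eq \<mu>)"

end

theory Submission
  imports Defs
begin

text \<open>
  \<^emph>\<open>Lipschitz functions have a tangential gradient.\<close> Mollifications of \<open>f\<close> at scale \<open>1/n\<close> have
  gradient at \<open>x\<close> bounded by the Lipschitz constant of \<open>f\<close> on a ball of radius \<open>2/n\<close> around \<open>x\<close>. The
  functions with this bound form a convex set for each \<open>n\<close>, and near-minimisers of the \<open>L\<^sup>2\<close> norm of
  the tangential gradient over these decreasing sets are Cauchy by the parallelogram law. Their limit
  is the tangential gradient and is bounded by \<open>lip\<^sub>a f\<close>; working with the minimisers avoids weak
  compactness. Linearity and the Leibniz rule pass to the limit.

  \<^emph>\<open>Tangent bundle.\<close> It is the span of a sequence in \<open>D\<^sub>\<infinity>\<close> that minimises the distances of the basis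
  vectors. A vector tangent to it and orthogonal to the sequence vanishes, which gives closability of
  the tangential gradient by integration by parts.

  \<^emph>\<open>The isomorphism.\<close> Testing \<open>\<Phi>(v)\<close> on truncated linear functions recovers \<open>v\<close> and the norm
  \<open>|v|\<close>. Conversely a derivation \<open>b\<close> determines \<open>v\<close> by its values on truncated coordinates; the bound
  by \<open>lip\<^sub>a\<close>, applied to a smooth function minus a linear one with nearby gradient, shows
  \<open>b(F) = v \<bullet> \<nabla>F\<close>. On Lipschitz functions \<open>b\<close> and \<open>\<Phi>(v)\<close> agree because a derivation with bounded
  divergence is determined by its values on test functions.
\<close>

text \<open>The measure may be singular, so a Lipschitz function can fail to be differentiable
  \<mu>-almost everywhere, and the gradients of its mollifications need not converge on the set that
  carries \<mu>. The choice among competitors by energy is what forces convergence. The energy is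
  quadratic in order to have a parallelogram law, and a common compact support lets it control the
  L1 norm in which \<open>has_tgrad\<close> is defined. The limit depends a priori on all choices;
  closability removes this dependence.

  Each identity holds outside a null set that depends on the function tested, while the useful test
  function at \<open>x\<close> depends on \<open>x\<close>. Hence the recourse to countable
  families: spanning sequences of fields, basis vectors or a countable dense set of directions,
  integer truncation radii. Closedness then restores all directions.

  A bound by \<open>lip_a\<close> gives a derivation no continuity along uniformly convergent
  sequences, since \<open>lip_a\<close> of the differences need not become small. The divergence
  replaces it: by the Leibniz rule the derivation can be moved from a Lipschitz function onto the
  test function.\<close>

section \<open>Gradients and the classes \<open>Ck\<close>\<close>

lemma gderiv_grad: "GDERIV f x :> D \<Longrightarrow> grad f x = D"
  unfolding grad_def
proof (rule the_equality)
  fix E assume D: "GDERIV f x :> D" and E: "GDERIV f x :> E"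
  then have "(\<lambda>h. h \<bullet> D) = (\<lambda>h. h \<bullet> E)"
    unfolding gderiv_def by (rule has_derivative_unique)
  then have "\<forall>h. h \<bullet> E = h \<bullet> D"
    by (simp add: fun_eq_iff)
  then show "E = D"
    using vector_eq_ldot[of E D] by simp
qed

lemma differentiable_has_derivative_grad:
  fixes f :: "'a::euclidean_space \<Rightarrow> real"
  assumes "f differentiable at x"
  shows "(f has_derivative (\<lambda>h. h \<bullet> grad f x)) (at x)"
proof -
  obtain f' where f': "(f has_derivative f') (at x)"
    using assms by (auto simp: differentiable_def)
  interpret linear f' using has_derivative_linear[OF f'] .
  define D where "D = (\<Sum>i\<in>Basis. f' i *\<^sub>R i)"
  have eq: "f' = (\<lambda>h. h \<bullet> D)"
  proof
    fix h
    have "f' h = f' (\<Sum>i\<in>Basis. (h \<bullet> i) *\<^sub>R i)" by (simp add: euclidean_representation)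
    also have "\<dots> = h \<bullet> D"
      by (simp add: D_def sum scale inner_sum_right mult.commute)
    finally show "f' h = h \<bullet> D" .
  qed
  then have "GDERIV f x :> D"
    using f' by (simp add: gderiv_def)
  then show ?thesis using gderiv_grad[of f x D] by (simp add: gderiv_def)
qed

lemma has_derivative_grad_eq:
  fixes f :: "'a::euclidean_space \<Rightarrow> real"
  assumes "(f has_derivative (\<lambda>h. h \<bullet> D)) (at x)"
  shows "grad f x = D"
  using assms by (intro gderiv_grad) (simp add: gderiv_def)

lemma frechet_derivative_grad:
  fixes f :: "'a::euclidean_space \<Rightarrow> real"
  assumes "f differentiable at x"
  shows "frechet_derivative f (at x) = (\<lambda>h. h \<bullet> grad f x)"
  using frechet_derivative_at[OF differentiable_has_derivative_grad[OF assms]] by simp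

text \<open>Derivatives are handled as gradient vectors throughout, so the recursion of
  \<open>Ck\<close> is rewritten once in terms of the components of \<open>grad\<close>; the
  original equation then leaves the simpset.\<close>

lemma Ck_Suc_grad:
  "Ck (Suc k) f \<longleftrightarrow> (\<forall>x. f differentiable (at x)) \<and> (\<forall>i\<in>Basis. Ck k (\<lambda>x. i \<bullet> grad f x))"
  by (auto simp: frechet_derivative_grad)

lemma Ck_SucI:
  assumes "\<And>x. (f has_derivative (\<lambda>h. h \<bullet> D x)) (at x)" "\<And>i. i \<in> Basis \<Longrightarrow> Ck k (\<lambda>x. i \<bullet> D x)"
  shows "Ck (Suc k) f"
proof -
  have "grad f x = D x" for x by (rule has_derivative_grad_eq[OF assms(1)])
  then show ?thesis
    unfolding Ck_Suc_grad using assms by (auto simp: differentiable_def)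
qed

declare Ck.simps(2)[simp del]

lemma Ck_Suc_derivative: "Ck (Suc k) f \<Longrightarrow> (f has_derivative (\<lambda>h. h \<bullet> grad f x)) (at x)"
  by (simp add: Ck_Suc_grad differentiable_has_derivative_grad)

lemma Ck_continuous: "Ck k f \<Longrightarrow> continuous_on UNIV f"
  by (cases k)
    (auto simp: Ck_Suc_grad intro!: differentiable_imp_continuous_on simp: differentiable_on_def
      intro: differentiable_at_withinI)

lemma Ck_Suc_imp_Ck: "Ck (Suc k) f \<Longrightarrow> Ck k f"
proof (induction k arbitrary: f)
  case 0 then show ?case using Ck_continuous[OF 0] by simp
next
  case (Suc k)
  then show ?case by (metis Ck_Suc_grad)
qed

lemma Ck_const: "Ck k (\<lambda>x. c)"
proof (induction k arbitrary: c)
  case (Suc k)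
  show ?case by (rule Ck_SucI[where D = "\<lambda>_. 0"]) (auto intro!: Suc)
qed simp

lemma Ck_add: "Ck k f \<Longrightarrow> Ck k g \<Longrightarrow> Ck k (\<lambda>x. f x + g x)"
proof (induction k arbitrary: f g)
  case (Suc k)
  show ?case
  proof (rule Ck_SucI[where D = "\<lambda>x. grad f x + grad g x"])
    show "((\<lambda>x. f x + g x) has_derivative (\<lambda>h. h \<bullet> (grad f x + grad g x))) (at x)" for x
      using Ck_Suc_derivative[OF Suc.prems(1), of x] Ck_Suc_derivative[OF Suc.prems(2), of x]
      by (auto simp: inner_add_right intro!: derivative_eq_intros)
    show "Ck k (\<lambda>x. i \<bullet> (grad f x + grad g x))" if "i \<in> Basis" for i
      using Suc.prems that unfolding inner_add_right by (intro Suc.IH) (auto simp: Ck_Suc_grad)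
  qed
qed (auto intro: continuous_intros)

lemma Ck_mult: "Ck k f \<Longrightarrow> Ck k g \<Longrightarrow> Ck k (\<lambda>x. f x * g x)"
proof (induction k arbitrary: f g)
  case (Suc k)
  show ?case
  proof (rule Ck_SucI[where D = "\<lambda>x. f x *\<^sub>R grad g x + g x *\<^sub>R grad f x"])
    show "((\<lambda>x. f x * g x) has_derivative (\<lambda>h. h \<bullet> (f x *\<^sub>R grad g x + g x *\<^sub>R grad f x))) (at x)" for x
      using Ck_Suc_derivative[OF Suc.prems(1), of x] Ck_Suc_derivative[OF Suc.prems(2), of x]
      by (auto simp: algebra_simps intro!: derivative_eq_intros)
    show "Ck k (\<lambda>x. i \<bullet> (f x *\<^sub>R grad g x + g x *\<^sub>R grad f x))" if "i \<in> Basis" for i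
      using Suc.prems that Ck_Suc_imp_Ck[OF Suc.prems(1)] Ck_Suc_imp_Ck[OF Suc.prems(2)]
      unfolding inner_add_right inner_scaleR_right
      by (intro Ck_add Suc.IH) (auto simp: Ck_Suc_grad)
  qed
qed (auto intro: continuous_intros)

lemma Ck_cmult: "Ck k f \<Longrightarrow> Ck k (\<lambda>x. c * f x)"
  by (intro Ck_mult Ck_const)

lemma Ck_inner: "Ck k (\<lambda>x. x \<bullet> a)"
proof (cases k)
  case (Suc m)
  have "Ck (Suc m) (\<lambda>x. x \<bullet> a)"
    by (rule Ck_SucI[where D = "\<lambda>x. a"])
      (auto intro!: derivative_eq_intros Ck_const)
  then show ?thesis using Suc by simp
qed (auto intro: continuous_intros)

lemma Ck_inner_left: "Ck k (\<lambda>x. a \<bullet> x)"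
  using Ck_inner[of k a] by (simp add: inner_commute)

section \<open>A smooth function vanishing on a half-line\<close>

text \<open>The classical flat function exp(-1/t) is the case \<open>k = 0\<close>. The powers of
  1/t are included because the derivative of \<open>psi k\<close> is a combination of
  \<open>psi (k + 2)\<close> and \<open>psi (k + 1)\<close>, so the family is closed under
  differentiation.\<close>

definition psi :: "nat \<Rightarrow> real \<Rightarrow> real" where
  "psi k t = (if t > 0 then inverse t ^ k * exp (- inverse t) else 0)"

lemma psi_nonneg: "0 \<le> psi k t" by (auto simp: psi_def)
lemma psi_pos: "0 < t \<Longrightarrow> 0 < psi k t" by (auto simp: psi_def)

lemma psi_tendsto_0: "(psi k \<longlongrightarrow> 0) (at 0)"
proof (rule filterlim_split_at)
  have "eventually (\<lambda>t. psi k t = 0) (at_left 0)"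
    by (auto simp: psi_def eventually_at_left_field intro!: exI[of _ "-1"])
  then show "(psi k \<longlongrightarrow> 0) (at_left 0)" by (rule tendsto_eventually)
  have "((\<lambda>s. s ^ k / exp s) \<longlongrightarrow> (0::real)) at_top" by (rule tendsto_power_div_exp_0)
  then have "((\<lambda>t. inverse t ^ k / exp (inverse t)) \<longlongrightarrow> (0::real)) (at_right 0)"
    by (rule filterlim_compose[OF _ filterlim_inverse_at_top_right])
  moreover have "eventually (\<lambda>t. inverse t ^ k / exp (inverse t) = psi k t) (at_right 0)"
    using eventually_at_right_less[of "0::real"]
    by eventually_elim (simp add: psi_def exp_minus divide_inverse)
  ultimately show "(psi k \<longlongrightarrow> 0) (at_right 0)" by (rule Lim_transform_eventually)
qed

lemma psi_derivative:
  "(psi k has_real_derivative (psi (k + 2) t - real k * psi (k + 1) t)) (at t)"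
proof -
  consider "t > 0" | "t < 0" | "t = 0" by linarith
  then show ?thesis
  proof cases
    case 1
    have "((\<lambda>t. inverse t ^ k * exp (- inverse t)) has_real_derivative
      (real k * inverse t ^ (k - 1) * (- (inverse t * inverse t)) * exp (- inverse t)
        + inverse t ^ k * (exp (- inverse t) * (inverse t * inverse t)))) (at t)"
      using 1 by (auto intro!: derivative_eq_intros)
    moreover have "real k * s ^ (k - 1) * (- (s * s)) * c + s ^ k * (c * (s * s)) =
      s ^ (k + 2) * c - real k * (s ^ (k + 1) * c)" for s c :: real
      by (cases k) (simp_all add: algebra_simps)
    moreover have "psi (k + 2) t - real k * psi (k + 1) t = inverse t ^ (k + 2) * exp (- inverse t)
      - real k * (inverse t ^ (k + 1) * exp (- inverse t))"
      using 1 unfolding psi_def by simp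
    ultimately have "((\<lambda>t. inverse t ^ k * exp (- inverse t)) has_real_derivative
      (psi (k + 2) t - real k * psi (k + 1) t)) (at t)"
      by metis
    then show ?thesis
      by (rule has_field_derivative_transform_within_open[where S = "{0<..}"])
        (use 1 in \<open>auto simp: psi_def\<close>)
  next
    case 2
    have "((\<lambda>t. 0) has_real_derivative (psi (k + 2) t - real k * psi (k + 1) t)) (at t)"
      using 2 by (auto simp: psi_def)
    then show ?thesis
      by (rule has_field_derivative_transform_within_open[where S = "{..<0}"])
        (use 2 in \<open>auto simp: psi_def\<close>)
  next
    case 3
    \<comment> \<open>The difference quotient of \<open>psi k\<close> at 0 is
      \<open>psi (Suc k)\<close> itself, so the limit of the next member of the family settles
      differentiability at the only critical point.\<close>
    have "((\<lambda>h. (psi k (0 + h) - psi k 0) / h) \<longlongrightarrow> 0) (at 0)"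
    proof (rule Lim_transform_eventually[OF psi_tendsto_0[of "Suc k"]])
      show "\<forall>\<^sub>F h in at 0. psi (Suc k) h = (psi k (0 + h) - psi k 0) / h"
        by (simp add: psi_def divide_inverse)
    qed
    then show ?thesis using 3 by (simp add: psi_def DERIV_def)
  qed
qed

text \<open>Each derivative raises the index of \<open>psi\<close>, so the induction on
  \<open>k\<close> keeps \<open>m\<close> arbitrary. With \<open>c\<close> the square of a radius
  this is a bump supported in the ball of that radius; the squared norm is used because it is smooth
  at the origin.\<close>

lemma Ck_psi: "Ck k (\<lambda>x::'a::euclidean_space. psi m (c - x \<bullet> x))"
proof (induction k arbitrary: m)
  case 0
  have "continuous_on UNIV (psi m)"
    by (intro DERIV_continuous_on[where D = "\<lambda>t. psi (m + 2) t - real m * psi (m + 1) t"]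
        DERIV_subset[OF psi_derivative]) auto
  then show ?case
    by (auto intro!: continuous_intros continuous_on_compose2[of UNIV "psi m"])
next
  case (Suc k)
  let ?p = "\<lambda>x::'a. psi (m + 2) (c - x \<bullet> x) - real m * psi (m + 1) (c - x \<bullet> x)"
  show ?case
  proof (rule Ck_SucI[where D = "\<lambda>x. (-2 * ?p x) *\<^sub>R x"])
    show "((\<lambda>x. psi m (c - x \<bullet> x)) has_derivative (\<lambda>h. h \<bullet> ((-2 * ?p x) *\<^sub>R x))) (at x)" for x :: 'a
    proof -
      have "((\<lambda>x. c - x \<bullet> x) has_derivative (\<lambda>h. - (2 * (h \<bullet> x)))) (at x)"
        by (auto intro!: derivative_eq_intros simp: inner_commute)
      from has_derivative_compose[OF this psi_derivative[unfolded has_field_derivative_def]]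
      show ?thesis
        by (simp add: algebra_simps)
    qed
    have 1: "Ck k ?p"
      using Ck_add[OF Suc.IH[of "m + 2"] Ck_cmult[OF Suc.IH[of "m + 1"], of "- real m"]] by simp
    have "Ck k (\<lambda>x. (-2 * ?p x) * (i \<bullet> x))" for i
      by (intro Ck_mult Ck_cmult[OF 1] Ck_inner_left)
    then show "Ck k (\<lambda>x. i \<bullet> ((-2 * ?p x) *\<^sub>R x))" for i
      by (simp only: inner_scaleR_right)
  qed
qed

section \<open>Compact support, convolution and mollification\<close>

lemma compactly_supportedI:
  assumes "\<And>x. r < norm x \<Longrightarrow> f x = 0"
  shows "compactly_supported f"
proof -
  have "support_on UNIV f \<subseteq> cball 0 r"
    using assms by (force simp: support_on_def)
  then show ?thesis
    unfolding compactly_supported_def by (meson bounded_cball bounded_subset compact_closure)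
qed

lemma compactly_supportedE:
  assumes "compactly_supported f"
  obtains r where "r > 0" "\<And>x. r < norm x \<Longrightarrow> f x = 0"
proof -
  have "bounded (support_on UNIV f)"
    using assms unfolding compactly_supported_def by (metis compact_closure)
  then obtain r where "r > 0" "\<forall>x\<in>support_on UNIV f. norm x \<le> r"
    unfolding bounded_pos by auto
  then show thesis by (intro that[of r]) (force simp: support_on_def)+
qed

lemma compactly_supported_iff: "compactly_supported f \<longleftrightarrow> (\<exists>r. \<forall>x. r < norm x \<longrightarrow> f x = 0)"
  by (metis compactly_supportedI compactly_supportedE)

lemma continuous_on_grad:
  fixes f :: "'a::euclidean_space \<Rightarrow> real"
  assumes "Ck (Suc k) f"
  shows "continuous_on UNIV (grad f)"
proof -
  have "continuous_on UNIV (\<lambda>x. \<Sum>i\<in>Basis. (i \<bullet> grad f x) *\<^sub>R i)"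
    using assms unfolding Ck_Suc_grad
    by (intro continuous_on_sum continuous_on_scaleR continuous_on_const) (blast intro: Ck_continuous)
  then show ?thesis
    by (simp only: inner_commute[of _ "grad f _"] euclidean_representation)
qed

text \<open>All derivatives fall on the kernel, so continuity of \<open>f\<close> is enough. The
  induction generalises over the kernel because differentiating replaces it by its partial
  derivatives. Integration over a box makes differentiation under the integral available through
  \<open>leibniz_rule\<close>.\<close>

lemma Ck_convolution:
  fixes f :: "'a::euclidean_space \<Rightarrow> real"
  assumes f: "continuous_on UNIV f"
  shows "(\<And>m. Ck m \<rho>) \<Longrightarrow> Ck k (\<lambda>x. integral (cbox a b) (\<lambda>y. f y * \<rho> (x - y)))"
proof (induction k arbitrary: \<rho>)
  case 0
  have \<rho>: "continuous_on UNIV \<rho>" using 0[of 0] by simp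
  have "continuous_on (UNIV \<times> cbox a b) (\<lambda>(x, t). f t * \<rho> (x - t))"
    unfolding split_beta
    by (intro continuous_intros continuous_on_compose2[OF f] continuous_on_compose2[OF \<rho>]) auto
  then show ?case by (simp add: integral_continuous_on_param)
next
  case (Suc k)
  have \<rho>: "continuous_on UNIV \<rho>" using Suc.prems[of 0] by simp
  have g\<rho>: "continuous_on UNIV (grad \<rho>)"
    using continuous_on_grad[OF Suc.prems] .
  \<comment> \<open>\<open>leibniz_rule\<close> wants the derivative as a function with values in
    the bounded linear maps; \<open>D\<close> is the same integral taken in the vector space, and
    \<open>blinfun_apply_integral\<close> identifies the two.\<close>
  define fx where "fx = (\<lambda>x t. blinfun_inner_left (f t *\<^sub>R grad \<rho> (x - t)))"
  define D where "D = (\<lambda>x. integral (cbox a b) (\<lambda>t. f t *\<^sub>R grad \<rho> (x - t)))"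
  have cont2: "continuous_on (UNIV \<times> cbox a b) (\<lambda>(x, t). f t *\<^sub>R grad \<rho> (x - t))"
    unfolding split_beta
    by (intro continuous_intros continuous_on_compose2[OF f] continuous_on_compose2[OF g\<rho>]) auto
  have contfx: "continuous_on (UNIV \<times> cbox a b) (\<lambda>(x, t). fx x t)"
    using cont2 unfolding split_beta fx_def
    by (rule bounded_linear.continuous_on[OF bounded_linear_blinfun_inner_left])
  have int: "(\<lambda>t. f t *\<^sub>R grad \<rho> (x - t)) integrable_on cbox a b" for x
    by (intro integrable_continuous continuous_intros continuous_on_compose2[OF f]
        continuous_on_compose2[OF g\<rho>]) auto
  have intfx: "fx x integrable_on cbox a b" for x
    unfolding fx_def
    by (intro integrable_continuous bounded_linear.continuous_on[OF bounded_linear_blinfun_inner_left]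
        continuous_intros continuous_on_compose2[OF f] continuous_on_compose2[OF g\<rho>]) auto
  have inner_int: "h \<bullet> D x = integral (cbox a b) (\<lambda>t. f t * (h \<bullet> grad \<rho> (x - t)))" for h x
    using integral_linear[OF int[of x] bounded_linear_inner_right[of h]] by (simp add: D_def o_def)
  have deriv: "((\<lambda>x. integral (cbox a b) (\<lambda>y. f y * \<rho> (x - y))) has_derivative (\<lambda>h. h \<bullet> D x)) (at x)" for x
  proof -
    have "((\<lambda>x. integral (cbox a b) (\<lambda>y. f y * \<rho> (x - y))) has_derivative
        integral (cbox a b) (fx x)) (at x within UNIV)"
    proof (rule leibniz_rule[where fx = fx])
      show "((\<lambda>x. f t * \<rho> (x - t)) has_derivative blinfun_apply (fx x t)) (at x within UNIV)" for x t
      proof -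
        have "((\<lambda>x. x - t) has_derivative (\<lambda>h. h)) (at x)"
          by (auto intro!: derivative_eq_intros)
        from has_derivative_compose[OF this Ck_Suc_derivative[OF Suc.prems]]
        have "((\<lambda>x. \<rho> (x - t)) has_derivative (\<lambda>h. h \<bullet> grad \<rho> (x - t))) (at x)" .
        from has_derivative_mult_right[OF this, of "f t"] show ?thesis
          by (simp add: fx_def blinfun_inner_left.rep_eq)
      qed
      show "(\<lambda>t. f t * \<rho> (x - t)) integrable_on cbox a b" for x
        by (intro integrable_continuous continuous_intros continuous_on_compose2[OF f]
            continuous_on_compose2[OF \<rho>]) auto
    qed (use contfx in auto)
    moreover have "blinfun_apply (integral (cbox a b) (fx x)) = (\<lambda>h. h \<bullet> D x)"
      unfolding inner_int
      by (rule ext, subst blinfun_apply_integral[OF intfx]) (simp add: fx_def blinfun_inner_left.rep_eq)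
    ultimately show ?thesis by simp
  qed
  show ?case
  proof (rule Ck_SucI[OF deriv])
    fix i :: 'a assume i: "i \<in> Basis"
    show "Ck k (\<lambda>x. i \<bullet> D x)"
      unfolding inner_int
    proof (rule Suc.IH)
      show "Ck m (\<lambda>x. i \<bullet> grad \<rho> x)" for m
        using Suc.prems[of "Suc m"] i by (simp add: Ck_Suc_grad)
    qed
  qed
qed

text \<open>The bump \<open>psi 0\<close> of \<open>e\<^sup>2 - x \<bullet> x\<close>, divided by
  its integral. The integral is positive because the bump is strictly positive on a ball, which has
  positive Lebesgue measure.\<close>

lemma smoothing_kernel_exists:
  fixes e :: real
  assumes "e > 0"
  obtains \<rho> :: "'a::euclidean_space \<Rightarrow> real"
  where "\<And>k. Ck k \<rho>" "\<And>x. 0 \<le> \<rho> x" "\<And>x. e \<le> norm x \<Longrightarrow> \<rho> x = 0"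
    "integrable lborel \<rho>" "(\<integral>x. \<rho> x \<partial>lborel) = 1"
proof -
  define p where "p = (\<lambda>x::'a. psi 0 (e\<^sup>2 - x \<bullet> x))"
  have Ck: "Ck k p" for k unfolding p_def by (rule Ck_psi)
  have cont: "continuous_on UNIV p" using Ck[of 0] by simp
  have nn: "0 \<le> p x" for x by (simp add: p_def psi_nonneg)
  have pos: "0 < p x" if "norm x < e" for x
    unfolding p_def using that by (intro psi_pos) (simp add: dot_square_norm power_strict_mono)
  have zero: "p x = 0" if "e \<le> norm x" for x
  proof -
    have "e\<^sup>2 \<le> (norm x)\<^sup>2" using that assms by (intro power_mono) auto
    then show ?thesis by (simp add: p_def psi_def dot_square_norm)
  qed
  have eq: "indicator (cball 0 e) x *\<^sub>R p x = p x" for x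
    using zero[of x] by (auto simp: indicator_def)
  have int: "integrable lborel p"
    using borel_integrable_compact[OF compact_cball continuous_on_subset[OF cont], of 0 e] by (simp add: eq del: real_scaleR_def)
  have "0 < (\<integral>x. p x \<partial>lborel)"
  proof (rule ccontr)
    assume "\<not> 0 < (\<integral>x. p x \<partial>lborel)"
    then have "(\<integral>x. p x \<partial>lborel) = 0"
      using Bochner_Integration.integral_nonneg[of lborel p] nn by fastforce
    then have "AE x in lborel. p x = 0"
      using integral_nonneg_eq_0_iff_AE[OF int] nn by simp
    moreover have "x \<notin> ball 0 e" if "p x = 0" for x
      using pos[of x] that by auto
    ultimately have "AE x in lborel. x \<notin> ball (0::'a) e"
      by (auto elim: eventually_mono)
    then have "emeasure lborel (ball (0::'a) e) = 0"
      by (subst (asm) AE_iff_measurable[of "ball 0 e"]) auto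
    moreover have "emeasure lborel (ball (0::'a) e) \<noteq> 0"
      using content_ball_pos[OF assms, of "0::'a"]
      by (auto simp: measure_def)
    ultimately show False by simp
  qed
  then show thesis
    by (intro that[of "\<lambda>x. inverse (\<integral>x. p x \<partial>lborel) * p x"] Ck_cmult Ck)
      (use nn zero int in auto)
qed

lemma lborel_integral_reflect:
  fixes g :: "'a::euclidean_space \<Rightarrow> real"
  assumes "g \<in> borel_measurable borel"
  shows "(\<integral>y. g (x - y) \<partial>lborel) = (\<integral>y. g y \<partial>lborel)"
proof -
  have "lborel = distr lborel borel (\<lambda>y::'a. x - y)"
    using lborel_affine[of "-1" x] by (simp add: density_1)
  then have "(\<integral>y. g y \<partial>lborel) = (\<integral>y. g y \<partial>distr lborel borel (\<lambda>y::'a. x - y))" by simp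
  also have "\<dots> = (\<integral>y. g (x - y) \<partial>lborel)"
    using assms by (intro integral_distr) auto
  finally show ?thesis by simp
qed

text \<open>The mollification is an average of translates of \<open>f\<close> by vectors shorter
  than \<open>e\<close>, with weights of total mass one. The two estimates express exactly this, so
  no later argument has to mention the kernel or an integral against it.\<close>

lemma mollification:
  fixes f :: "'a::euclidean_space \<Rightarrow> real"
  assumes f: "continuous_on UNIV f" and cs: "compactly_supported f" and "e > 0"
  obtains F where "F \<in> Cinf_c"
    "\<And>x a b. (\<And>y. dist x y < e \<Longrightarrow> a \<le> f y \<and> f y \<le> b) \<Longrightarrow> a \<le> F x \<and> F x \<le> b"
    "\<And>x y M. (\<And>z. norm z < e \<Longrightarrow> \<bar>f (x - z) - f (y - z)\<bar> \<le> M) \<Longrightarrow> \<bar>F x - F y\<bar> \<le> M"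
proof -
  obtain \<rho> :: "'a \<Rightarrow> real" where Ck: "\<And>k. Ck k \<rho>" and nn: "\<And>x. 0 \<le> \<rho> x"
    and zero: "\<And>x. e \<le> norm x \<Longrightarrow> \<rho> x = 0"
    and int: "integrable lborel \<rho>" and one: "(\<integral>x. \<rho> x \<partial>lborel) = 1"
    using smoothing_kernel_exists[OF \<open>e > 0\<close>] by metis
  obtain r where "r > 0" and r: "\<And>x. r < norm x \<Longrightarrow> f x = 0"
    using cs by (rule compactly_supportedE) blast
  \<comment> \<open>The box contains the support of \<open>f\<close>; integrating over it therefore
    gives the full convolution while keeping the form required by
    \<open>Ck_convolution\<close>.\<close>
  obtain a where a: "cball 0 r \<subseteq> cbox (-a) (a::'a)"
    using bounded_subset_cbox_symmetric[OF bounded_cball] by blast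
  have fz: "f x = 0" if "x \<notin> cbox (-a) a" for x
    using that a r[of x] by (cases "norm x \<le> r") auto
  have c\<rho>: "continuous_on UNIV \<rho>" using Ck[of 0] by simp
  have [measurable]: "f \<in> borel_measurable borel" "\<rho> \<in> borel_measurable borel"
    using f c\<rho> by (auto intro: borel_measurable_continuous_onI)
  define F where "F = (\<lambda>x. integral (cbox (-a) a) (\<lambda>y. f y * \<rho> (x - y)))"
  have F: "F x = (\<integral>z. f (x - z) * \<rho> z \<partial>lborel)" for x
  proof -
    have cont: "continuous_on (cbox (-a) a) (\<lambda>y. f y * \<rho> (x - y))"
      by (intro continuous_intros continuous_on_compose2[OF f] continuous_on_compose2[OF c\<rho>]) auto
    have si: "set_integrable lborel (cbox (-a) a) (\<lambda>y. f y * \<rho> (x - y))"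
      unfolding set_integrable_def using borel_integrable_compact[OF compact_cbox cont] by simp
    have "F x = (LINT y:cbox (-a) a|lborel. f y * \<rho> (x - y))"
      unfolding F_def using set_borel_integral_eq_integral(2)[OF si] by simp
    also have "\<dots> = (\<integral>y. f y * \<rho> (x - y) \<partial>lborel)"
      unfolding set_lebesgue_integral_def
      by (intro Bochner_Integration.integral_cong) (auto simp: indicator_def fz)
    also have "\<dots> = (\<integral>z. f (x - z) * \<rho> (x - (x - z)) \<partial>lborel)"
      by (rule lborel_integral_reflect[symmetric]) measurable
    finally show ?thesis by simp
  qed
  have intF: "integrable lborel (\<lambda>z. f (x - z) * \<rho> z)" for x
  proof -
    have "continuous_on (cball 0 e) (\<lambda>z. f (x - z) * \<rho> z)"
      by (intro continuous_intros continuous_on_compose2[OF f] continuous_on_compose2[OF c\<rho>]) auto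
    from borel_integrable_compact[OF compact_cball this]
    show ?thesis
      by (rule Bochner_Integration.integrable_cong[THEN iffD1, rotated 2])
        (use zero in \<open>auto simp: indicator_def\<close>)
  qed
  have bounds: "a \<le> F x \<and> F x \<le> b" if ab: "\<And>y. dist x y < e \<Longrightarrow> a \<le> f y \<and> f y \<le> b" for x :: 'a and a b
  proof -
    have *: "a * \<rho> z \<le> f (x - z) * \<rho> z \<and> f (x - z) * \<rho> z \<le> b * \<rho> z" for z
    proof (cases "norm z < e")
      case True
      then have "a \<le> f (x - z) \<and> f (x - z) \<le> b" by (intro ab) (simp add: dist_norm)
      then show ?thesis using nn[of z] by (simp add: mult_right_mono)
    qed (use zero[of z] in auto)
    have "(\<integral>z. a * \<rho> z \<partial>lborel) \<le> F x" "F x \<le> (\<integral>z. b * \<rho> z \<partial>lborel)"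
      unfolding F by (rule integral_mono; use * int intF in simp)+
    then show ?thesis by (simp add: one)
  qed
  have diff: "\<bar>F x - F y\<bar> \<le> M" if M: "\<And>z. norm z < e \<Longrightarrow> \<bar>f (x - z) - f (y - z)\<bar> \<le> M" for x y M
  proof -
    have "F x - F y = (\<integral>z. f (x - z) * \<rho> z - f (y - z) * \<rho> z \<partial>lborel)"
      unfolding F using intF by simp
    moreover have "\<bar>(\<integral>z. f (x - z) * \<rho> z - f (y - z) * \<rho> z \<partial>lborel)\<bar> \<le> (\<integral>z. M * \<rho> z \<partial>lborel)"
    proof (rule integral_abs_bound[THEN order_trans], rule integral_mono)
      fix z
      show "\<bar>f (x - z) * \<rho> z - f (y - z) * \<rho> z\<bar> \<le> M * \<rho> z"
      proof (cases "norm z < e")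
        case True
        then show ?thesis using M[OF True] nn[of z]
          by (simp add: left_diff_distrib[symmetric] abs_mult mult_right_mono)
      qed (use zero[of z] in auto)
    qed (use intF int in auto)
    ultimately show ?thesis by (simp add: one)
  qed
  have "Ck k F" for k unfolding F_def by (rule Ck_convolution[OF f Ck])
  moreover have "compactly_supported F"
  proof (rule compactly_supportedI)
    fix x :: 'a assume x: "r + e < norm x"
    have "0 \<le> F x \<and> F x \<le> 0"
    proof (rule bounds)
      fix y assume "dist x y < e"
      then have "r < norm y" using x norm_triangle_ineq2[of x y] by (simp add: dist_norm)
      then show "0 \<le> f y \<and> f y \<le> 0" using r by simp
    qed
    then show "F x = 0" by simp
  qed
  ultimately have "F \<in> Cinf_c" by (simp add: Cinf_c_def)
  then show thesis using bounds diff that by blast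
qed

section \<open>Test functions and compactly supported Lipschitz functions\<close>

lemma Cinf_c_Ck: "F \<in> Cinf_c \<Longrightarrow> Ck k F"
  by (simp add: Cinf_c_def)

lemma Cinf_c_derivative: "F \<in> Cinf_c \<Longrightarrow> (F has_derivative (\<lambda>h. h \<bullet> grad F x)) (at x)"
  by (rule Ck_Suc_derivative[OF Cinf_c_Ck])

lemma Cinf_c_continuous: "F \<in> Cinf_c \<Longrightarrow> continuous_on UNIV F"
  by (rule Ck_continuous[OF Cinf_c_Ck])

lemma Cinf_c_continuous_grad: "F \<in> Cinf_c \<Longrightarrow> continuous_on UNIV (grad F)"
  by (rule continuous_on_grad[OF Cinf_c_Ck])

lemma compactly_supported_mult: "compactly_supported f \<Longrightarrow> compactly_supported (\<lambda>x. f x * g x)"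
  unfolding compactly_supported_iff by auto

lemma compactly_supported_add:
  "compactly_supported f \<Longrightarrow> compactly_supported g \<Longrightarrow> compactly_supported (\<lambda>x. f x + g x)"
  unfolding compactly_supported_iff
proof (elim exE)
  fix r s assume "\<forall>x. r < norm x \<longrightarrow> f x = 0" "\<forall>x. s < norm x \<longrightarrow> g x = 0"
  then show "\<exists>r. \<forall>x. r < norm x \<longrightarrow> f x + g x = 0"
    by (intro exI[of _ "max r s"]) simp
qed

lemma Cinf_c_mult_Ck: "F \<in> Cinf_c \<Longrightarrow> (\<And>k. Ck k g) \<Longrightarrow> (\<lambda>x. F x * g x) \<in> Cinf_c"
  by (simp add: Cinf_c_def Ck_mult compactly_supported_mult)

lemma Cinf_c_mult: "F \<in> Cinf_c \<Longrightarrow> G \<in> Cinf_c \<Longrightarrow> (\<lambda>x. F x * G x) \<in> Cinf_c"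
  by (simp add: Cinf_c_Ck Cinf_c_mult_Ck)

lemma Cinf_c_add: "F \<in> Cinf_c \<Longrightarrow> G \<in> Cinf_c \<Longrightarrow> (\<lambda>x. F x + G x) \<in> Cinf_c"
  by (simp add: Cinf_c_def Ck_add compactly_supported_add)

lemma Cinf_c_cmult: "F \<in> Cinf_c \<Longrightarrow> (\<lambda>x. c * F x) \<in> Cinf_c"
  using Cinf_c_mult_Ck[of F "\<lambda>_. c"] by (simp add: Ck_const mult.commute)

lemma Cinf_c_diff: "F \<in> Cinf_c \<Longrightarrow> G \<in> Cinf_c \<Longrightarrow> (\<lambda>x. F x - G x) \<in> Cinf_c"
  using Cinf_c_add[OF _ Cinf_c_cmult[of G "-1"], of F] by simp

lemma grad_add:
  assumes "F \<in> Cinf_c" "G \<in> Cinf_c"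
  shows "grad (\<lambda>x. F x + G x) x = grad F x + grad G x"
  using Cinf_c_derivative[OF assms(1), of x] Cinf_c_derivative[OF assms(2), of x]
  by (intro has_derivative_grad_eq) (auto simp: inner_add_right intro!: derivative_eq_intros)

lemma grad_cmult:
  assumes "F \<in> Cinf_c"
  shows "grad (\<lambda>x. c * F x) x = c *\<^sub>R grad F x"
  using Cinf_c_derivative[OF assms(1), of x]
  by (intro has_derivative_grad_eq) (auto intro!: derivative_eq_intros)

lemma grad_diff:
  assumes "F \<in> Cinf_c" "G \<in> Cinf_c"
  shows "grad (\<lambda>x. F x - G x) x = grad F x - grad G x"
  using Cinf_c_derivative[OF assms(1), of x] Cinf_c_derivative[OF assms(2), of x]
  by (intro has_derivative_grad_eq) (auto simp: inner_diff_right intro!: derivative_eq_intros)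

lemma grad_mult:
  assumes "F \<in> Cinf_c" "G \<in> Cinf_c"
  shows "grad (\<lambda>x. F x * G x) x = F x *\<^sub>R grad G x + G x *\<^sub>R grad F x"
  using Cinf_c_derivative[OF assms(1), of x] Cinf_c_derivative[OF assms(2), of x]
  by (intro has_derivative_grad_eq) (auto simp: algebra_simps intro!: derivative_eq_intros)

lemma grad_eq_0_outside:
  fixes f :: "'a::euclidean_space \<Rightarrow> real"
  assumes "\<And>x. r < norm x \<Longrightarrow> f x = 0" "r < norm x"
  shows "grad f x = 0"
proof (rule has_derivative_grad_eq)
  have op: "open {x::'a. r < norm x}" by (intro open_Collect_less continuous_intros)
  have "((\<lambda>x. 0) has_derivative (\<lambda>h. h \<bullet> 0)) (at x)" by simp
  then show "(f has_derivative (\<lambda>h. h \<bullet> 0)) (at x)"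
    by (rule has_derivative_transform_within_open[OF _ op]) (use assms in auto)
qed

lemma bounded_of_compact_support:
  fixes f :: "'a::euclidean_space \<Rightarrow> 'b::real_normed_vector"
  assumes "continuous_on UNIV f" "\<And>x. r < norm x \<Longrightarrow> f x = 0"
  obtains C where "C > 0" "\<And>x. norm (f x) \<le> C"
proof -
  have "bounded (f ` cball 0 r)"
    by (intro compact_imp_bounded compact_continuous_image continuous_on_subset[OF assms(1)]) auto
  then obtain C where "C > 0" and C: "\<And>x. x \<in> cball 0 r \<Longrightarrow> norm (f x) \<le> C"
    by (auto simp: bounded_pos)
  have "norm (f x) \<le> C" for x
  proof (cases "norm x \<le> r")
    case True
    then show ?thesis by (intro C) auto
  next
    case False
    then show ?thesis using assms(2)[of x] \<open>C > 0\<close> by simp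
  qed
  with \<open>C > 0\<close> show thesis by (rule that)
qed

lemma Cinf_cE:
  assumes "F \<in> Cinf_c"
  obtains C r where "C > 0" "r > 0" "\<And>x. norm (F x) \<le> C" "\<And>x. norm (grad F x) \<le> C"
    "\<And>x. r < norm x \<Longrightarrow> F x = 0" "\<And>x. r < norm x \<Longrightarrow> grad F x = 0"
proof -
  obtain r where r: "r > 0" "\<And>x. r < norm x \<Longrightarrow> F x = 0"
    using assms by (auto simp: Cinf_c_def elim: compactly_supportedE)
  then have g: "\<And>x. r < norm x \<Longrightarrow> grad F x = 0"
    using grad_eq_0_outside by blast
  obtain C where "C > 0" "\<And>x. norm (F x) \<le> C"
    by (rule bounded_of_compact_support[OF Cinf_c_continuous[OF assms] r(2)]) auto
  moreover obtain C' where "C' > 0" "\<And>x. norm (grad F x) \<le> C'"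
    by (rule bounded_of_compact_support[OF Cinf_c_continuous_grad[OF assms] g]) auto
  ultimately show thesis
    using r g by (intro that[of "max C C'" r]) (auto simp: le_max_iff_disj)
qed

lemma lipschitz_on_of_grad_bound:
  assumes F: "F \<in> Cinf_c" and "convex S" "0 \<le> M" "\<And>x. x \<in> S \<Longrightarrow> norm (grad F x) \<le> M"
  shows "M-lipschitz_on S F"
proof (rule bounded_derivative_imp_lipschitz[OF _ \<open>convex S\<close> _ \<open>0 \<le> M\<close>])
  show "(F has_derivative (\<lambda>h. h \<bullet> grad F x)) (at x within S)" for x
    by (rule has_derivative_at_withinI[OF Cinf_c_derivative[OF F]])
  fix x assume "x \<in> S"
  show "onorm (\<lambda>h. h \<bullet> grad F x) \<le> M"
  proof (rule onorm_bound[OF \<open>0 \<le> M\<close>])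
    show "norm (h \<bullet> grad F x) \<le> M * norm h" for h
      using Cauchy_Schwarz_ineq2[of h "grad F x"] assms(4)[OF \<open>x \<in> S\<close>]
        mult_right_mono[of "norm (grad F x)" M "norm h"]
      by (simp add: mult.commute)
  qed
qed

text \<open>In the direction of the gradient itself the directional derivative equals the norm of
  the gradient, and every difference quotient in a unit direction within the ball is at most
  \<open>M\<close>.\<close>

lemma grad_bound_of_lipschitz_on:
  assumes F: "F \<in> Cinf_c" and M: "M-lipschitz_on (ball x r) F" and "r > 0"
  shows "norm (grad F x) \<le> M"
proof (cases "grad F x = 0")
  case False
  define u where "u = grad F x /\<^sub>R norm (grad F x)"
  have u: "norm u = 1" using False by (simp add: u_def)
  have "((\<lambda>t. x + t *\<^sub>R u) has_derivative (\<lambda>t. t *\<^sub>R u)) (at (0::real))"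
    by (auto intro!: derivative_eq_intros)
  from has_derivative_compose[OF this, of F "\<lambda>h. h \<bullet> grad F x"] Cinf_c_derivative[OF F, of x]
  have "((\<lambda>t. F (x + t *\<^sub>R u)) has_derivative (\<lambda>t. t * (u \<bullet> grad F x))) (at 0)"
    by simp
  then have "((\<lambda>t. F (x + t *\<^sub>R u)) has_real_derivative (u \<bullet> grad F x)) (at 0)"
    by (simp add: has_field_derivative_def mult.commute mult_commute_abs)
  then have "((\<lambda>t. (F (x + t *\<^sub>R u) - F x) / t) \<longlongrightarrow> u \<bullet> grad F x) (at 0)"
    by (simp add: DERIV_def)
  moreover have "u \<bullet> grad F x = norm (grad F x)"
    using False by (simp add: u_def dot_square_norm power2_eq_square)
  ultimately have "((\<lambda>t. (F (x + t *\<^sub>R u) - F x) / t) \<longlongrightarrow> norm (grad F x)) (at 0)" by simp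
  moreover have "\<forall>\<^sub>F t in at 0. (F (x + t *\<^sub>R u) - F x) / t \<le> M"
    unfolding eventually_at
  proof (intro exI conjI ballI impI)
    show "r > 0" by fact
    fix t :: real assume t: "t \<noteq> 0 \<and> dist t 0 < r"
    have "dist (F (x + t *\<^sub>R u)) (F x) \<le> M * dist (x + t *\<^sub>R u) x"
      using t u \<open>r > 0\<close> by (intro lipschitz_onD[OF M]) (auto simp: dist_norm)
    then have "\<bar>F (x + t *\<^sub>R u) - F x\<bar> \<le> M * \<bar>t\<bar>"
      using u by (simp add: dist_norm)
    then have "\<bar>(F (x + t *\<^sub>R u) - F x) / t\<bar> \<le> M"
      using t by (simp add: abs_divide pos_divide_le_eq)
    then show "(F (x + t *\<^sub>R u) - F x) / t \<le> M" by linarith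
  qed
  ultimately show ?thesis by (intro tendsto_upperbound) auto
qed (use lipschitz_on_nonneg[OF M] in auto)

lemma Cinf_c_subset_LIPc: "Cinf_c \<subseteq> LIPc"
proof
  fix F :: "'a \<Rightarrow> real" assume F: "F \<in> Cinf_c"
  obtain C where "C > 0" "\<And>x. norm (grad F x) \<le> C" by (rule Cinf_cE[OF F]) blast
  then have "C-lipschitz_on UNIV F" by (intro lipschitz_on_of_grad_bound[OF F]) auto
  then show "F \<in> LIPc" using F by (auto simp: LIPc_def Cinf_c_def)
qed

lemma Cinf_c_LIPc: "F \<in> Cinf_c \<Longrightarrow> F \<in> LIPc"
  using Cinf_c_subset_LIPc by auto

lemma LIPcE:
  assumes "f \<in> LIPc"
  obtains L C r where "L-lipschitz_on UNIV f" "C > 0" "r > 0" "\<And>x. norm (f x) \<le> C"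
    "\<And>x. r < norm x \<Longrightarrow> f x = 0" "continuous_on UNIV f"
proof -
  obtain r where r: "r > 0" "\<And>x. r < norm x \<Longrightarrow> f x = 0"
    using assms by (auto simp: LIPc_def elim: compactly_supportedE)
  obtain L where L: "L-lipschitz_on UNIV f" using assms by (auto simp: LIPc_def)
  obtain C where "C > 0" "\<And>x. norm (f x) \<le> C"
    by (rule bounded_of_compact_support[OF lipschitz_on_continuous_on[OF L] r(2)]) auto
  then show thesis
    by (rule that[OF L _ r(1) _ r(2) lipschitz_on_continuous_on[OF L]])
qed

lemma LIPc_continuous: "f \<in> LIPc \<Longrightarrow> continuous_on UNIV f"
  by (rule LIPcE)

lemma LIPc_add: "f \<in> LIPc \<Longrightarrow> g \<in> LIPc \<Longrightarrow> (\<lambda>x. f x + g x) \<in> LIPc"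
  unfolding LIPc_def by (auto intro: lipschitz_on_add compactly_supported_add)

lemma LIPc_cmult: "f \<in> LIPc \<Longrightarrow> (\<lambda>x. c * f x) \<in> LIPc"
  unfolding LIPc_def
  by (auto intro: lipschitz_on_cmult_real compactly_supported_mult[of f "\<lambda>_. c", simplified mult.commute])

lemma LIPc_mult:
  assumes f: "f \<in> LIPc" and g: "g \<in> LIPc"
  shows "(\<lambda>x. f x * g x) \<in> LIPc"
proof -
  obtain L C where L: "L-lipschitz_on UNIV f" and C: "\<And>x. norm (f x) \<le> C" by (rule LIPcE[OF f]) blast
  obtain M D where M: "M-lipschitz_on UNIV g" and D: "\<And>x. norm (g x) \<le> D" by (rule LIPcE[OF g]) blast
  have "0 \<le> C" "0 \<le> D" using order_trans[OF norm_ge_zero C] order_trans[OF norm_ge_zero D] by auto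
  have "(C * M + D * L)-lipschitz_on UNIV (\<lambda>x. f x * g x)"
  proof (rule lipschitz_onI)
    show "0 \<le> C * M + D * L"
      using \<open>0 \<le> C\<close> \<open>0 \<le> D\<close> lipschitz_on_nonneg[OF L] lipschitz_on_nonneg[OF M] by simp
    fix x y
    have "f x * g x - f y * g y = f x * (g x - g y) + g y * (f x - f y)" by (simp add: algebra_simps)
    then have "\<bar>f x * g x - f y * g y\<bar> \<le> \<bar>f x\<bar> * \<bar>g x - g y\<bar> + \<bar>g y\<bar> * \<bar>f x - f y\<bar>"
      using abs_triangle_ineq[of "f x * (g x - g y)" "g y * (f x - f y)"] by (simp only: abs_mult)
    also have "\<dots> \<le> C * (M * dist x y) + D * (L * dist x y)"
      using C[of x] D[of y] lipschitz_onD[OF L, of x y] lipschitz_onD[OF M, of x y] \<open>0 \<le> C\<close> \<open>0 \<le> D\<close>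
      by (intro add_mono mult_mono) (auto simp: dist_real_def)
    finally show "dist (f x * g x) (f y * g y) \<le> (C * M + D * L) * dist x y"
      by (simp add: dist_real_def algebra_simps)
  qed
  then show ?thesis using f by (auto simp: LIPc_def intro: compactly_supported_mult)
qed

text \<open>Translating by less than \<open>e\<close> carries the ball of radius \<open>r\<close>
  into the ball of radius \<open>r + e\<close>, so a Lipschitz bound of \<open>f\<close> on the
  larger ball passes to \<open>F\<close> on the smaller one. Some \<open>r > 0\<close> must remain
  because the gradient at \<open>x\<close> is read off from a neighbourhood of
  \<open>x\<close>.\<close>

lemma LIPc_mollification:
  assumes f: "f \<in> LIPc" and "e > 0"
  obtains F where "F \<in> Cinf_c"
    "\<And>x a b. (\<And>y. dist x y < e \<Longrightarrow> a \<le> f y \<and> f y \<le> b) \<Longrightarrow> a \<le> F x \<and> F x \<le> b"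
    "\<And>x r M. 0 < r \<Longrightarrow> M-lipschitz_on (ball x (r + e)) f \<Longrightarrow> norm (grad F x) \<le> M"
proof -
  have "compactly_supported f" using f by (simp add: LIPc_def)
  then obtain F where F: "F \<in> Cinf_c"
    "\<And>x a b. (\<And>y. dist x y < e \<Longrightarrow> a \<le> f y \<and> f y \<le> b) \<Longrightarrow> a \<le> F x \<and> F x \<le> b"
    "\<And>x y M. (\<And>z. norm z < e \<Longrightarrow> \<bar>f (x - z) - f (y - z)\<bar> \<le> M) \<Longrightarrow> \<bar>F x - F y\<bar> \<le> M"
    by (rule mollification[OF LIPc_continuous[OF f] _ \<open>e > 0\<close>]) blast
  have "norm (grad F x) \<le> M" if "0 < r" and M: "M-lipschitz_on (ball x (r + e)) f" for x r M
  proof (rule grad_bound_of_lipschitz_on[OF F(1) lipschitz_onI \<open>0 < r\<close>])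
    show "0 \<le> M" using M by (rule lipschitz_on_nonneg)
    fix y z assume yz: "y \<in> ball x r" "z \<in> ball x r"
    have "\<bar>F y - F z\<bar> \<le> M * dist y z"
    proof (rule F(3))
      fix w :: 'a assume w: "norm w < e"
      have "p - w \<in> ball x (r + e)" if "p \<in> ball x r" for p
        using that w norm_triangle_ineq[of "x - p" w] by (auto simp: dist_norm algebra_simps)
      then show "\<bar>f (y - w) - f (z - w)\<bar> \<le> M * dist y z"
        using lipschitz_onD[OF M, of "y - w" "z - w"] yz by (simp add: dist_norm)
    qed
    then show "dist (F y) (F z) \<le> M * dist y z" by (simp add: dist_real_def)
  qed
  with F(1,2) show thesis by (rule that)
qed

text \<open>The piecewise linear function of the distance to \<open>K\<close> is 1 up to distance
  \<open>d\<close> and 0 from \<open>2 * d\<close> on. Mollifying at scale \<open>d\<close>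
  preserves the value 1 on \<open>K\<close> and leaves zero beyond \<open>3 * d\<close>, which
  explains the factor 3.\<close>

lemma smooth_cutoff:
  fixes K :: "'a::euclidean_space set"
  assumes K: "compact K" "K \<noteq> {}" and "d > 0"
  obtains h where "h \<in> Cinf_c" "\<And>x. 0 \<le> h x \<and> h x \<le> 1" "\<And>x. x \<in> K \<Longrightarrow> h x = 1"
    "\<And>x. 3 * d \<le> infdist x K \<Longrightarrow> h x = 0"
proof -
  define f where "f = (\<lambda>x. max 0 (min 1 (2 - infdist x K / d)))"
  obtain r where r: "\<forall>x\<in>K. norm x \<le> r"
    using compact_imp_bounded[OF K(1)] unfolding bounded_iff by blast
  have infd: "\<bar>infdist x K - infdist y K\<bar> \<le> dist x y" for x y
    using infdist_triangle[of x K y] infdist_triangle[of y K x, unfolded dist_commute[of y x]] by linarith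
  have f0: "f x = 0" if "2 * d \<le> infdist x K" for x
    using that \<open>d > 0\<close> by (simp add: f_def field_simps)
  have "(1 / d)-lipschitz_on UNIV f"
  proof (rule lipschitz_onI)
    fix x y
    have "\<bar>max 0 (min 1 (2 - s)) - max 0 (min 1 (2 - t))\<bar> \<le> \<bar>s - t\<bar>" for s t :: real
      by linarith
    then have "dist (f x) (f y) \<le> \<bar>infdist x K / d - infdist y K / d\<bar>"
      unfolding f_def dist_real_def .
    also have "\<dots> \<le> dist x y / d"
      using infd[of x y] \<open>d > 0\<close> by (simp add: diff_divide_distrib[symmetric] abs_divide divide_right_mono)
    finally show "dist (f x) (f y) \<le> 1 / d * dist x y" by simp
  qed (use \<open>d > 0\<close> in simp)
  moreover have "compactly_supported f"
  proof (rule compactly_supportedI, rule f0)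
    fix x :: 'a assume x: "r + 2 * d < norm x"
    have "2 * d \<le> dist x y" if "y \<in> K" for y
      using r[rule_format, OF that] x norm_triangle_ineq2[of x y] by (simp add: dist_norm)
    then show "2 * d \<le> infdist x K"
      using K(2) by (auto simp: infdist_def intro!: cINF_greatest)
  qed
  ultimately have "f \<in> LIPc" by (auto simp: LIPc_def)
  then obtain F where F: "F \<in> Cinf_c"
    "\<And>x a b. (\<And>y. dist x y < d \<Longrightarrow> a \<le> f y \<and> f y \<le> b) \<Longrightarrow> a \<le> F x \<and> F x \<le> b"
    by (rule LIPc_mollification[OF _ \<open>d > 0\<close>]) blast
  show thesis
  proof (rule that[OF F(1)])
    show "0 \<le> F x \<and> F x \<le> 1" for x by (rule F(2)) (auto simp: f_def)
    show "F x = 1" if "x \<in> K" for x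
    proof -
      have "1 \<le> F x \<and> F x \<le> 1"
      proof (rule F(2))
        fix y assume "dist x y < d"
        moreover have "infdist x K = 0" using that by simp
        ultimately have "infdist y K < d" using infd[of x y] by simp
        then show "1 \<le> f y \<and> f y \<le> 1" using \<open>d > 0\<close> by (auto simp: f_def field_simps)
      qed
      then show ?thesis by simp
    qed
    show "F x = 0" if "3 * d \<le> infdist x K" for x
    proof -
      have "0 \<le> F x \<and> F x \<le> 0"
      proof (rule F(2))
        fix y assume "dist x y < d"
        then have "2 * d \<le> infdist y K" using infd[of x y] that by simp
        then show "0 \<le> f y \<and> f y \<le> 0" by (simp add: f0)
      qed
      then show ?thesis by simp
    qed
  qed
qed

section \<open>The asymptotic Lipschitz constant\<close>

lemma Lip_le: "L-lipschitz_on E f \<Longrightarrow> Lip f E \<le> L"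
  unfolding Lip_def by (rule cInf_lower) (auto intro!: bdd_belowI[of _ 0] lipschitz_on_nonneg)

lemma Lip_nonneg: "L-lipschitz_on E f \<Longrightarrow> 0 \<le> Lip f E"
  unfolding Lip_def by (rule cInf_greatest) (auto intro: lipschitz_on_nonneg)

text \<open>The infimum is attained: the quotient at any fixed pair of distinct points is a lower
  bound for all admissible constants, hence for their infimum.\<close>

lemma lipschitz_on_Lip:
  assumes "L-lipschitz_on E f"
  shows "(Lip f E)-lipschitz_on E f"
proof (rule lipschitz_onI)
  show "0 \<le> Lip f E" by (rule Lip_nonneg[OF assms])
  fix x y assume xy: "x \<in> E" "y \<in> E"
  show "dist (f x) (f y) \<le> Lip f E * dist x y"
  proof (cases "x = y")
    case False
    have "dist (f x) (f y) / dist x y \<le> Lip f E"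
      unfolding Lip_def
    proof (rule cInf_greatest)
      fix M assume "M \<in> {L. L-lipschitz_on E f}"
      then show "dist (f x) (f y) / dist x y \<le> M"
        using False xy lipschitz_onD[of M E f x y] by (simp add: pos_divide_le_eq)
    qed (use assms in auto)
    then show ?thesis using False by (simp add: pos_divide_le_eq)
  qed simp
qed

lemma Lip_mono: "L-lipschitz_on E f \<Longrightarrow> D \<subseteq> E \<Longrightarrow> Lip f D \<le> Lip f E"
  by (rule Lip_le[OF lipschitz_on_subset[OF lipschitz_on_Lip]])

lemma LIPc_lipschitz_on: "f \<in> LIPc \<Longrightarrow> \<exists>L. L-lipschitz_on E f"
  by (auto simp: LIPc_def intro: lipschitz_on_subset)

text \<open>The Lipschitz constant on a ball grows with the radius, so the limit at 0 exists and is
  the infimum. This reduces upper bounds on \<open>lip_a\<close> to a single radius and lower bounds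
  to all radii.\<close>

lemma lip_a_eq_INF:
  assumes f: "f \<in> LIPc"
  shows "lip_a f x = (INF r\<in>{0<..}. Lip f (ball x r))"
  unfolding lip_a_def
proof (rule tendsto_Lim)
  let ?l = "INF r\<in>{0<..}. Lip f (ball x r)"
  have nn: "0 \<le> Lip f E" for E using LIPc_lipschitz_on[OF f] Lip_nonneg by blast
  have bdd: "bdd_below ((\<lambda>r. Lip f (ball x r)) ` {0<..})"
    by (rule bdd_belowI[of _ 0]) (auto simp: nn)
  have mono: "Lip f (ball x s) \<le> Lip f (ball x r)" if "s \<le> r" for s r
    using LIPc_lipschitz_on[OF f, of "ball x r"] Lip_mono[OF _ subset_ball[OF that]] by blast
  show "((\<lambda>r. Lip f (ball x r)) \<longlongrightarrow> ?l) (at_right 0)"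
  proof (rule order_tendstoI)
    fix a assume "a < ?l"
    then have "a < Lip f (ball x r)" if "r > 0" for r
      using cINF_lower[OF bdd, of r] that by auto
    then show "\<forall>\<^sub>F r in at_right 0. a < Lip f (ball x r)"
      by (auto simp: eventually_at_filter)
  next
    fix a assume "?l < a"
    then obtain r where r: "r > 0" "Lip f (ball x r) < a"
      using cINF_less_iff[OF _ bdd] by auto
    then have "\<forall>\<^sub>F s in at_right 0. s < r"
      by (auto simp: eventually_at_right_field)
    then show "\<forall>\<^sub>F r in at_right 0. Lip f (ball x r) < a"
      by eventually_elim (rule le_less_trans[OF mono r(2)], simp)
  qed
qed simp

lemma LIPc_Lip_nonneg: "f \<in> LIPc \<Longrightarrow> 0 \<le> Lip f E"
  using LIPc_lipschitz_on[of f E] Lip_nonneg[of _ E f] by auto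

lemma lip_a_le_Lip:
  assumes f: "f \<in> LIPc" and "0 < r"
  shows "lip_a f x \<le> Lip f (ball x r)"
  unfolding lip_a_eq_INF[OF f]
  by (rule cINF_lower[OF bdd_belowI[of _ 0]]) (use LIPc_Lip_nonneg[OF f] \<open>0 < r\<close> in auto)

lemma lip_a_le: "f \<in> LIPc \<Longrightarrow> 0 < r \<Longrightarrow> L-lipschitz_on (ball x r) f \<Longrightarrow> lip_a f x \<le> L"
  by (rule order_trans[OF lip_a_le_Lip Lip_le])

lemma lip_a_ge: "f \<in> LIPc \<Longrightarrow> (\<And>r. 0 < r \<Longrightarrow> c \<le> Lip f (ball x r)) \<Longrightarrow> c \<le> lip_a f x"
  unfolding lip_a_eq_INF by (rule cINF_greatest) auto

lemma lip_a_nonneg: "f \<in> LIPc \<Longrightarrow> 0 \<le> lip_a f x"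
  by (rule lip_a_ge) (auto intro: LIPc_Lip_nonneg)

text \<open>Near \<open>x\<close> the gradient differs from \<open>grad F x\<close> by less than any
  given \<open>e\<close>, and balls are convex. With this lemma the \<open>lip_a\<close> bound of a
  derivation becomes, on test functions, a bound by the gradient at the point.\<close>

lemma lip_a_le_norm_grad:
  assumes F: "F \<in> Cinf_c"
  shows "lip_a F x \<le> norm (grad F x)"
proof (rule field_le_epsilon)
  fix e :: real assume "e > 0"
  have "continuous (at x) (grad F)"
    using Cinf_c_continuous_grad[OF F] by (simp add: continuous_on_eq_continuous_at)
  then obtain d where "d > 0" and d: "\<And>y. dist y x < d \<Longrightarrow> dist (grad F y) (grad F x) < e"
    using \<open>e > 0\<close> unfolding continuous_at_eps_delta by blast
  have "(norm (grad F x) + e)-lipschitz_on (ball x d) F"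
  proof (rule lipschitz_on_of_grad_bound[OF F])
    fix y assume "y \<in> ball x d"
    then have "norm (grad F y - grad F x) < e" using d[of y] by (simp add: dist_commute flip: dist_norm)
    then show "norm (grad F y) \<le> norm (grad F x) + e"
      using norm_triangle_sub[of "grad F y" "grad F x"] by linarith
  qed (use \<open>e > 0\<close> in auto)
  then show "lip_a F x \<le> norm (grad F x) + e"
    by (rule lip_a_le[OF Cinf_c_LIPc[OF F] \<open>d > 0\<close>])
qed

section \<open>Radon measures: test functions separate, and families have a.e. least
  elements\<close>

locale radon =
  fixes \<mu> :: "'a::euclidean_space measure"
  assumes radon: "radon_measure \<mu>"
begin

lemma sets_\<mu> [measurable_cong]: "sets \<mu> = sets borel"
  using radon by (simp add: radon_measure_def)

lemma space_\<mu> [simp]: "space \<mu> = UNIV"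
  using sets_eq_imp_space_eq[OF sets_\<mu>] by simp

lemma borel_measurable_\<mu>: "f \<in> borel_measurable \<mu> \<longleftrightarrow> f \<in> borel_measurable borel"
  using measurable_cong_sets[OF sets_\<mu> refl] by blast

lemma emeasure_compact_finite: "compact K \<Longrightarrow> emeasure \<mu> K < \<infinity>"
  using radon by (simp add: radon_measure_def)

sublocale sigma_finite_measure \<mu>
proof
  show "\<exists>A. countable A \<and> A \<subseteq> sets \<mu> \<and> \<Union> A = space \<mu> \<and> (\<forall>a\<in>A. emeasure \<mu> a \<noteq> \<infinity>)"
  proof (intro exI conjI)
    let ?A = "range (\<lambda>n::nat. cball (0::'a) (real n))"
    show "countable ?A" "?A \<subseteq> sets \<mu>" by (auto simp: sets_\<mu>)
    show "\<Union> ?A = space \<mu>" using real_arch_simple by auto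
    show "\<forall>a\<in>?A. emeasure \<mu> a \<noteq> \<infinity>"
      using emeasure_compact_finite[OF compact_cball] by (auto simp: less_top[symmetric])
  qed
qed

lemma integrable_bounded_support:
  fixes h :: "'a \<Rightarrow> 'b::euclidean_space"
  assumes [measurable]: "h \<in> borel_measurable \<mu>"
    and C: "AE x in \<mu>. norm (h x) \<le> C" and r: "\<And>x. r < norm x \<Longrightarrow> h x = 0"
  shows "integrable \<mu> h"
proof (rule Bochner_Integration.integrable_bound)
  show "integrable \<mu> (\<lambda>x. indicator (cball 0 r) x * C)"
    using emeasure_compact_finite[OF compact_cball, of 0 r]
    by (intro integrable_mult_left integrable_real_indicator) (auto simp: sets_\<mu>)
  show "AE x in \<mu>. norm (h x) \<le> norm (indicator (cball 0 r) x * C)"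
    using C
  proof eventually_elim
    case (elim x)
    then show ?case using r[of x] by (cases "norm x \<le> r") auto
  qed
qed measurable

lemma continuous_measurable: "continuous_on UNIV f \<Longrightarrow> f \<in> borel_measurable \<mu>"
  by (simp add: borel_measurable_\<mu> borel_measurable_continuous_onI)

lemma Cinf_c_measurable: "F \<in> Cinf_c \<Longrightarrow> F \<in> borel_measurable \<mu>"
  by (rule continuous_measurable[OF Cinf_c_continuous])

lemma grad_measurable: "F \<in> Cinf_c \<Longrightarrow> grad F \<in> borel_measurable \<mu>"
  by (rule continuous_measurable[OF Cinf_c_continuous_grad])

lemma LIPc_measurable: "f \<in> LIPc \<Longrightarrow> f \<in> borel_measurable \<mu>"
  by (rule continuous_measurable[OF LIPc_continuous])

text \<open>Cutoffs equal to 1 on \<open>K\<close> and vanishing at distance 3/(n+1) converge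
  pointwise to the indicator, because a point outside the closed set \<open>K\<close> has positive
  distance to it; \<open>g\<close> dominates.\<close>

lemma integral_compact_eq_0:
  fixes g :: "'a \<Rightarrow> real"
  assumes g: "integrable \<mu> g" and test: "\<And>F. F \<in> Cinf_c \<Longrightarrow> (\<integral>x. F x * g x \<partial>\<mu>) = 0"
    and K: "compact K"
  shows "(\<integral>x. indicator K x * g x \<partial>\<mu>) = 0"
proof (cases "K = {}")
  case False
  have "\<exists>h. h \<in> Cinf_c \<and> (\<forall>x. 0 \<le> h x \<and> h x \<le> 1) \<and> (\<forall>x\<in>K. h x = 1) \<and>
    (\<forall>x. 3 * inverse (real (Suc n)) \<le> infdist x K \<longrightarrow> h x = 0)" for n
  proof -
    have "0 < inverse (real (Suc n))" by simp
    from smooth_cutoff[OF K False this] show ?thesis by metis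
  qed
  then obtain h where h: "\<And>n. h n \<in> Cinf_c" "\<And>n x. 0 \<le> h n x \<and> h n x \<le> 1"
    "\<And>n x. x \<in> K \<Longrightarrow> h n x = 1"
    "\<And>n x. 3 * inverse (real (Suc n)) \<le> infdist x K \<Longrightarrow> h n x = 0"
    by metis
  have [measurable]: "h n \<in> borel_measurable \<mu>" for n by (rule Cinf_c_measurable[OF h(1)])
  have [measurable]: "g \<in> borel_measurable \<mu>" using g by auto
  have [measurable]: "K \<in> sets \<mu>" using K by (simp add: sets_\<mu> borel_compact)
  have lim: "(\<lambda>n. h n x) \<longlonglongrightarrow> indicator K x" for x
  proof (cases "x \<in> K")
    case False
    then have pos: "0 < infdist x K"
      using infdist_pos_not_in_closed[OF compact_imp_closed[OF K] \<open>K \<noteq> {}\<close>] by simp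
    have "(\<lambda>n. 3 * inverse (real (Suc n))) \<longlonglongrightarrow> 3 * 0"
      by (intro tendsto_mult tendsto_const LIMSEQ_inverse_real_of_nat)
    then have "\<forall>\<^sub>F n in sequentially. 3 * inverse (real (Suc n)) < infdist x K"
      by (rule order_tendstoD(2)) (simp add: pos)
    then have "\<forall>\<^sub>F n in sequentially. h n x = indicator K x"
      by eventually_elim (use h(4) False in simp)
    then show ?thesis by (rule tendsto_eventually)
  qed (simp add: h(3))
  have "(\<lambda>n. \<integral>x. h n x * g x \<partial>\<mu>) \<longlonglongrightarrow> (\<integral>x. indicator K x * g x \<partial>\<mu>)"
  proof (rule integral_dominated_convergence)
    show "integrable \<mu> (\<lambda>x. \<bar>g x\<bar>)" using g by simp
    show "AE x in \<mu>. (\<lambda>n. h n x * g x) \<longlonglongrightarrow> indicator K x * g x"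
      by (intro always_eventually allI tendsto_mult lim tendsto_const)
    show "AE x in \<mu>. norm (h n x * g x) \<le> \<bar>g x\<bar>" for n
    proof (intro always_eventually allI)
      show "norm (h n x * g x) \<le> \<bar>g x\<bar>" for x
        using h(2)[of n x] by (simp add: abs_mult mult_left_le_one_le)
    qed
  qed measurable
  then show ?thesis using test[OF h(1)] by (simp add: LIMSEQ_const_iff)
qed simp

text \<open>Indicators of compact sets are limits of test functions; Dynkin's lemma does the rest.\<close>

lemma test_functions_separate:
  fixes g :: "'a \<Rightarrow> real"
  assumes g: "integrable \<mu> g" and test: "\<And>F. F \<in> Cinf_c \<Longrightarrow> (\<integral>x. F x * g x \<partial>\<mu>) = 0"
  shows "AE x in \<mu>. g x = 0"
proof -
  have [measurable]: "g \<in> borel_measurable \<mu>" using g by auto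
  have int: "set_integrable \<mu> A g" if "A \<in> sets borel" for A
    unfolding set_integrable_def using that g by (intro integrable_mult_indicator) (auto simp: sets_\<mu>)
  have closed: "(LINT x:C|\<mu>. g x) = 0" if C: "closed C" for C
  proof -
    have [measurable]: "C \<inter> cball 0 r \<in> sets \<mu>" "C \<in> sets \<mu>" for r
      using C by (auto simp: sets_\<mu>)
    have lim: "(\<lambda>n. indicator (C \<inter> cball 0 (real n)) x) \<longlonglongrightarrow> (indicator C x :: real)" for x
    proof (rule tendsto_eventually)
      obtain N where N: "norm x \<le> real N" using real_arch_simple by blast
      show "\<forall>\<^sub>F n in sequentially. indicator (C \<inter> cball 0 (real n)) x = (indicator C x :: real)"
        using eventually_ge_at_top[of N] by eventually_elim (use N in \<open>auto simp: indicator_def\<close>)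
    qed
    have "(\<lambda>n. \<integral>x. indicator (C \<inter> cball 0 (real n)) x * g x \<partial>\<mu>) \<longlonglongrightarrow> (\<integral>x. indicator C x * g x \<partial>\<mu>)"
    proof (rule integral_dominated_convergence)
      show "integrable \<mu> (\<lambda>x. \<bar>g x\<bar>)" using g by simp
      show "AE x in \<mu>. (\<lambda>n. indicator (C \<inter> cball 0 (real n)) x * g x) \<longlonglongrightarrow> indicator C x * g x"
        by (intro always_eventually allI tendsto_mult lim tendsto_const)
      show "AE x in \<mu>. norm (indicator (C \<inter> cball 0 (real n)) x * g x) \<le> \<bar>g x\<bar>" for n
        by (intro always_eventually allI) (simp add: indicator_def)
    qed measurable
    moreover have "(\<integral>x. indicator (C \<inter> cball 0 (real n)) x * g x \<partial>\<mu>) = 0" for n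
      using closed_Int_compact[OF C compact_cball]
      by (intro integral_compact_eq_0[OF g test]) auto
    ultimately show ?thesis by (simp add: LIMSEQ_const_iff set_lebesgue_integral_def)
  qed
  have borel: "(LINT x:A|\<mu>. g x) = 0" if "A \<in> sets borel" for A
  proof -
    have "Int_stable (Collect (closed :: 'a set \<Rightarrow> bool))" "Collect closed \<subseteq> Pow (UNIV :: 'a set)"
      by (auto simp: Int_stable_def)
    moreover have "A \<in> sigma_sets UNIV (Collect closed)"
      using that by (simp add: borel_eq_closed)
    ultimately show ?thesis
    proof (induction rule: sigma_sets_induct_disjoint)
      case (compl A)
      have "A \<in> sets borel" using compl(1) by (simp add: borel_eq_closed)
      then have "(LINT x:UNIV|\<mu>. g x) = (LINT x:A|\<mu>. g x) + (LINT x:UNIV - A|\<mu>. g x)"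
        using set_integral_Un[of A "UNIV - A" \<mu> g] int[of A] int[of "UNIV - A"] by simp
      then show ?case using closed[of UNIV] compl by simp
    next
      case (union A)
      have A: "A i \<in> sets borel" for i using union(2) by (auto simp: borel_eq_closed)
      have "(LINT x:(\<Union>i. A i)|\<mu>. g x) = (\<Sum>i. LINT x:A i|\<mu>. g x)"
        using union(1) A
        by (intro lebesgue_integral_countable_add int) (auto simp: disjoint_family_on_def sets_\<mu>)
      then show ?case using union by simp
    qed (use closed in simp_all)
  qed
  have pm: "AE x in \<mu>. \<not> 0 < h x" if h: "h = g \<or> h = (\<lambda>x. - g x)" for h
  proof -
    have hint: "integrable \<mu> h" using h g by auto
    then have [measurable]: "h \<in> borel_measurable \<mu>" by auto
    let ?A = "{x. 0 < h x}"
    have "{x \<in> space \<mu>. 0 < h x} \<in> sets \<mu>" by measurable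
    then have A: "?A \<in> sets borel" by (simp add: sets_\<mu>)
    have "(\<integral>x. indicator ?A x * h x \<partial>\<mu>) = 0"
      using h borel[OF A] by (auto simp: set_lebesgue_integral_def)
    moreover have "integrable \<mu> (\<lambda>x. indicator ?A x * h x)"
      using integrable_mult_indicator[OF _ hint, of ?A] A by (simp add: sets_\<mu>)
    ultimately have "AE x in \<mu>. indicator ?A x * h x = 0"
      by (subst (asm) integral_nonneg_eq_0_iff_AE) (auto simp: indicator_def)
    then show ?thesis by eventually_elim (auto simp: indicator_def split: if_splits)
  qed
  have "AE x in \<mu>. \<not> 0 < g x" "AE x in \<mu>. \<not> 0 < - g x" using pm[of g] pm[of "\<lambda>x. - g x"] by simp_all
  then show ?thesis by eventually_elim auto
qed

lemma cutoff_ball: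
  obtains h :: "'a \<Rightarrow> real" where "h \<in> Cinf_c" "\<And>x. 0 \<le> h x" "\<And>x. h x \<le> 1"
    "\<And>x. x \<in> cball 0 r \<Longrightarrow> h x = 1"
proof -
  \<comment> \<open>\<open>smooth_cutoff\<close> wants a nonempty set, and the ball is empty for
    negative \<open>r\<close>; inserting the origin covers this case.\<close>
  have "compact (insert 0 (cball (0::'a) r))" "insert 0 (cball (0::'a) r) \<noteq> {}" by auto
  then show thesis
  proof (rule smooth_cutoff[OF _ _ zero_less_one])
    fix h :: "'a \<Rightarrow> real"
    assume h: "h \<in> Cinf_c" "\<And>x. 0 \<le> h x \<and> h x \<le> 1"
      "\<And>x. x \<in> insert 0 (cball 0 r) \<Longrightarrow> h x = 1"
    show thesis by (rule that[of h]) (use h in auto)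
  qed
qed

text \<open>Bounded functions need not be integrable when the measure is infinite. Multiplying by a
  cutoff \<open>h\<close> makes \<open>g\<close> integrable, and \<open>h\<close> times a test
  function is again a test function.\<close>

lemma test_functions_separate_local:
  fixes g :: "'a \<Rightarrow> real"
  assumes [measurable]: "g \<in> borel_measurable \<mu>"
    and int: "\<And>r. integrable \<mu> (\<lambda>x. indicator (cball 0 r) x * g x)"
    and test: "\<And>F. F \<in> Cinf_c \<Longrightarrow> (\<integral>x. F x * g x \<partial>\<mu>) = 0"
  shows "AE x in \<mu>. g x = 0"
proof -
  have "AE x in \<mu>. x \<in> cball 0 (real n) \<longrightarrow> g x = 0" for n
  proof -
    obtain h :: "'a \<Rightarrow> real" where h: "h \<in> Cinf_c" "\<And>x. 0 \<le> h x" "\<And>x. h x \<le> 1"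
      "\<And>x. x \<in> cball 0 (real n) \<Longrightarrow> h x = 1"
      by (rule cutoff_ball[of "real n"]) blast
    obtain r where r: "\<And>x. r < norm x \<Longrightarrow> h x = 0" by (rule Cinf_cE[OF h(1)]) blast
    have [measurable]: "h \<in> borel_measurable \<mu>" by (rule Cinf_c_measurable[OF h(1)])
    have "AE x in \<mu>. h x * g x = 0"
    proof (rule test_functions_separate)
      show "integrable \<mu> (\<lambda>x. h x * g x)"
      proof (rule Bochner_Integration.integrable_bound[OF int[of r]])
        show "AE x in \<mu>. norm (h x * g x) \<le> norm (indicator (cball 0 r) x * g x)"
        proof (intro always_eventually allI)
          show "norm (h x * g x) \<le> norm (indicator (cball 0 r) x * g x)" for x
            using r[of x] h(2,3)[of x]
            by (cases "norm x \<le> r") (auto simp: abs_mult mult_left_le_one_le)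
        qed
      qed measurable
      show "(\<integral>x. F x * (h x * g x) \<partial>\<mu>) = 0" if "F \<in> Cinf_c" for F
        using test[OF Cinf_c_mult[OF that h(1)]] by (simp add: mult.assoc)
    qed
    then show ?thesis by eventually_elim (use h(4) in force)
  qed
  then have "AE x in \<mu>. \<forall>n. x \<in> cball 0 (real n) \<longrightarrow> g x = 0"
    unfolding AE_all_countable by blast
  then show ?thesis
  proof eventually_elim
    case (elim x)
    obtain N where "norm x \<le> real N" using real_arch_simple by blast
    then show ?case using elim by auto
  qed
qed

lemma LinftyE:
  assumes "g \<in> Linfty \<mu>"
  obtains C where "C > 0" "AE x in \<mu>. norm (g x) \<le> C"
proof -
  obtain C where C: "AE x in \<mu>. norm (g x) \<le> C" using assms by (auto simp: Linfty_def)
  then have "AE x in \<mu>. norm (g x) \<le> max C 1" by eventually_elim simp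
  then show thesis by (intro that[of "max C 1"]) auto
qed

lemma Linfty_measurable: "g \<in> Linfty \<mu> \<Longrightarrow> g \<in> borel_measurable \<mu>"
  by (simp add: Linfty_def)

lemma Linfty_local_integrable:
  assumes g: "g \<in> Linfty \<mu>"
  shows "integrable \<mu> (\<lambda>x. indicator (cball 0 r) x * (g x :: real))"
proof -
  have [measurable]: "g \<in> borel_measurable \<mu>" by (rule Linfty_measurable[OF g])
  obtain C where "C > 0" "AE x in \<mu>. norm (g x) \<le> C" by (rule LinftyE[OF g]) blast
  from this(2) have "AE x in \<mu>. norm (indicator (cball 0 r) x * g x) \<le> C"
    by eventually_elim (use \<open>C > 0\<close> in \<open>auto simp: indicator_def\<close>)
  then show ?thesis
    by (rule integrable_bounded_support[where r = r, rotated]) (auto simp: indicator_def)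
qed

lemma Linfty_integrable_mult:
  assumes g: "g \<in> Linfty \<mu>" and f: "f \<in> LIPc"
  shows "integrable \<mu> (\<lambda>x. f x *\<^sub>R g x)"
proof -
  have [measurable]: "g \<in> borel_measurable \<mu>" "f \<in> borel_measurable \<mu>"
    by (rule Linfty_measurable[OF g], rule LIPc_measurable[OF f])
  obtain C where C: "C > 0" "AE x in \<mu>. norm (g x) \<le> C" by (rule LinftyE[OF g]) blast
  obtain D r where D: "\<And>x. norm (f x) \<le> D" and r: "\<And>x. r < norm x \<Longrightarrow> f x = 0"
    by (rule LIPcE[OF f]) blast
  from C(2) have "AE x in \<mu>. norm (f x *\<^sub>R g x) \<le> D * C"
  proof eventually_elim
    case (elim x)
    show ?case
      unfolding norm_scaleR using D[of x] elim by (intro mult_mono) auto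
  qed
  then show ?thesis
    by (rule integrable_bounded_support[where r = r, rotated]) (auto simp: r)
qed

text \<open>This gives the uniqueness of the divergence of a derivation, and it is also how two
  derivations are shown to agree on a Lipschitz function.\<close>

lemma Linfty_test_unique:
  assumes g: "g \<in> Linfty \<mu>" and h: "h \<in> Linfty \<mu>"
    and eq: "\<And>F. F \<in> Cinf_c \<Longrightarrow> (\<integral>x. F x * g x \<partial>\<mu>) = (\<integral>x. F x * h x \<partial>\<mu>)"
  shows "AE x in \<mu>. g x = (h x :: real)"
proof -
  have [measurable]: "g \<in> borel_measurable \<mu>" "h \<in> borel_measurable \<mu>"
    by (rule Linfty_measurable[OF g], rule Linfty_measurable[OF h])
  have "AE x in \<mu>. g x - h x = 0"
  proof (rule test_functions_separate_local)
    show "integrable \<mu> (\<lambda>x. indicator (cball 0 r) x * (g x - h x))" for r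
      using Bochner_Integration.integrable_diff[OF Linfty_local_integrable[OF g, of r] Linfty_local_integrable[OF h, of r]]
      by (simp add: right_diff_distrib)
    show "(\<integral>x. F x * (g x - h x) \<partial>\<mu>) = 0" if F: "F \<in> Cinf_c" for F
      using eq[OF F] Linfty_integrable_mult[OF g Cinf_c_LIPc[OF F]]
        Linfty_integrable_mult[OF h Cinf_c_LIPc[OF F]]
      by (simp add: right_diff_distrib)
  qed measurable
  then show ?thesis by eventually_elim simp
qed

text \<open>The least element minimises \<open>\<integral> q arctan f\<close> for a positive integrable weight \<open>q\<close>.\<close>

lemma ae_least_element:
  fixes \<F> :: "('a \<Rightarrow> real) set"
  assumes ne: "\<F> \<noteq> {}" and meas: "\<And>f. f \<in> \<F> \<Longrightarrow> f \<in> borel_measurable \<mu>"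
    and seq: "\<And>f. (\<And>n::nat. f n \<in> \<F>) \<Longrightarrow> \<exists>g\<in>\<F>. \<forall>n. AE x in \<mu>. g x \<le> f n x"
  shows "\<exists>g\<in>\<F>. \<forall>f\<in>\<F>. AE x in \<mu>. g x \<le> f x"
proof -
  obtain q where q: "q \<in> borel_measurable \<mu>" "\<And>x. (q x :: real) > 0" "integrable \<mu> q"
    by (rule obtain_positive_integrable_function) (rule that)
  define J where "J = (\<lambda>f. \<integral>x. q x * arctan (f x) \<partial>\<mu>)"
  have arctan_le: "\<bar>arctan t\<bar> \<le> pi / 2" for t 
    using arctan_bounded[of t] unfolding abs_le_iff by linarith
  have int: "integrable \<mu> (\<lambda>x. q x * arctan (f x))" if "f \<in> \<F>" for f
  proof (rule Bochner_Integration.integrable_bound)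
    show "integrable \<mu> (\<lambda>x. q x * (pi / 2))" using q(3) by simp
    have [measurable]: "f \<in> borel_measurable \<mu>" "q \<in> borel_measurable \<mu>" using meas[OF that] q(1) by auto
    show "(\<lambda>x. q x * arctan (f x)) \<in> borel_measurable \<mu>"
      by (intro borel_measurable_times borel_measurable_continuous_on[of arctan] continuous_intros) auto
    show "AE x in \<mu>. norm (q x * arctan (f x)) \<le> norm (q x * (pi / 2))"
    proof (intro always_eventually allI)
      show "norm (q x * arctan (f x)) \<le> norm (q x * (pi / 2))" for x
        unfolding norm_mult using arctan_le[of "f x"] by (intro mult_left_mono) auto
    qed
  qed
  have J_mono: "J f \<le> J g" if "f \<in> \<F>" "g \<in> \<F>" "AE x in \<mu>. f x \<le> g x" for f g
    unfolding J_def
  proof (rule integral_mono_AE[OF int[OF that(1)] int[OF that(2)]])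
    show "AE x in \<mu>. q x * arctan (f x) \<le> q x * arctan (g x)"
      using that(3) by eventually_elim (simp add: q(2) less_imp_le mult_left_mono arctan_le_iff)
  qed
  have bdd: "bdd_below (J ` \<F>)"
  proof (rule bdd_belowI)
    fix y assume "y \<in> J ` \<F>"
    then obtain f where f: "f \<in> \<F>" "y = J f" by auto
    have "(\<integral>x. q x * (- (pi / 2)) \<partial>\<mu>) \<le> J f"
      unfolding J_def
    proof (rule integral_mono[OF _ int[OF f(1)]])
      show "q x * (- (pi / 2)) \<le> q x * arctan (f x)" for x
        using arctan_le[of "f x"] q(2)[of x] by (intro mult_left_mono) (auto simp: abs_le_iff)
    qed (use q(3) in simp)
    then show "(\<integral>x. q x * (- (pi / 2)) \<partial>\<mu>) \<le> y" using f by simp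
  qed
  let ?I = "INF f\<in>\<F>. J f"
  have "\<exists>f\<in>\<F>. J f < ?I + inverse (real (Suc n))" for n
    using cINF_less_iff[OF ne bdd, of "?I + inverse (real (Suc n))"] by simp
  then obtain f where f: "\<And>n. f n \<in> \<F>" "\<And>n. J (f n) < ?I + inverse (real (Suc n))" by metis
  obtain g where g: "g \<in> \<F>" "\<And>n. AE x in \<mu>. g x \<le> f n x" using seq[of f] f(1) by blast
  have "J g \<le> ?I + inverse (real (Suc n))" for n
    using J_mono[OF g(1) f(1) g(2), of n] f(2)[of n] by linarith
  then have "J g \<le> ?I + 0"
    by (intro LIMSEQ_le_const[OF tendsto_add[OF tendsto_const LIMSEQ_inverse_real_of_nat]]) auto
  then have Jg: "J g \<le> J h" if "h \<in> \<F>" for h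
    using cINF_lower[OF bdd that] by simp
  show ?thesis
  proof (intro bexI[OF _ g(1)] ballI)
    fix f assume f: "f \<in> \<F>"
    \<comment> \<open>The sequence g, f, f, ... yields a member \<open>h\<close> below both. As
      \<open>g\<close> minimises \<open>J\<close> and \<open>h\<close> lies below \<open>g\<close>,
      the two have equal weighted integrals and coincide almost everywhere, so \<open>g\<close> is
      below \<open>f\<close> as well.\<close>
    have "\<exists>h\<in>\<F>. \<forall>n::nat. AE x in \<mu>. h x \<le> (if n = 0 then g else f) x"
      by (rule seq) (use f g(1) in auto)
    then obtain h where h: "h \<in> \<F>" "\<And>n::nat. AE x in \<mu>. h x \<le> (if n = 0 then g else f) x"
      by blast
    have hg: "AE x in \<mu>. h x \<le> g x" and hf: "AE x in \<mu>. h x \<le> f x" using h(2)[of 0] h(2)[of 1] by auto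
    have "J g - J h = (\<integral>x. q x * arctan (g x) - q x * arctan (h x) \<partial>\<mu>)"
      unfolding J_def using int[OF g(1)] int[OF h(1)] by simp
    then have 0: "(\<integral>x. q x * arctan (g x) - q x * arctan (h x) \<partial>\<mu>) = 0"
      using Jg[OF h(1)] J_mono[OF h(1) g(1) hg] by linarith
    have nonneg: "AE x in \<mu>. 0 \<le> q x * arctan (g x) - q x * arctan (h x)"
      using hg by eventually_elim (simp add: q(2) less_imp_le mult_left_mono arctan_le_iff)
    have "integrable \<mu> (\<lambda>x. q x * arctan (g x) - q x * arctan (h x))"
      using int[OF g(1)] int[OF h(1)] by simp
    from integral_nonneg_eq_0_iff_AE[OF this nonneg] 0
    have "AE x in \<mu>. q x * arctan (g x) - q x * arctan (h x) = 0" by simp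
    with hf show "AE x in \<mu>. g x \<le> f x"
    proof eventually_elim
      case (elim x)
      then have "arctan (g x) = arctan (h x)" using q(2)[of x] by simp
      then show ?case using elim(1) by (simp add: arctan_eq_iff)
    qed
  qed
qed

end

section \<open>Orthogonal projections, Gram-Schmidt and measurable bundles\<close>

lemma orth_proj_eq:
  assumes V: "subspace V" and p: "p \<in> V" and orth: "\<And>u. u \<in> V \<Longrightarrow> (y - p) \<bullet> u = 0"
  shows "orth_proj V y = p"
  unfolding orth_proj_def
proof (rule the_equality)
  show "p \<in> V \<and> (\<forall>u\<in>V. orthogonal (y - p) u)" using p orth by (simp add: orthogonal_def)
  fix q assume q: "q \<in> V \<and> (\<forall>u\<in>V. orthogonal (y - q) u)"
  have d: "q - p \<in> V" using V p q by (simp add: subspace_diff)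
  have "(q - p) \<bullet> (q - p) = (y - p) \<bullet> (q - p) - (y - q) \<bullet> (q - p)"
    by (simp add: inner_diff_left)
  also have "\<dots> = 0" using orth[OF d] q d by (simp add: orthogonal_def)
  finally show "q = p" by simp
qed

lemma orth_proj:
  assumes V: "subspace V"
  shows orth_proj_in: "orth_proj V y \<in> V"
    and orth_proj_orth: "u \<in> V \<Longrightarrow> (y - orth_proj V y) \<bullet> u = 0"
proof -
  obtain p z where p: "p \<in> span V" and z: "\<And>w. w \<in> span V \<Longrightarrow> orthogonal z w" and y: "y = p + z"
    by (rule orthogonal_subspace_decomp_exists[of V y]) blast
  have sp: "span V = V" using V by (simp add: span_eq_iff)
  have "orth_proj V y = p"
    by (rule orth_proj_eq[OF V]) (use p z y sp in \<open>auto simp: orthogonal_def\<close>)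
  then show "orth_proj V y \<in> V" "u \<in> V \<Longrightarrow> (y - orth_proj V y) \<bullet> u = 0"
    using p z y sp by (auto simp: orthogonal_def)
qed

lemma inner_orth_proj: "subspace V \<Longrightarrow> u \<in> V \<Longrightarrow> u \<bullet> orth_proj V y = u \<bullet> y"
  using orth_proj_orth[of V u y] by (simp add: inner_diff_left inner_commute[of u])

lemma linear_orth_proj:
  assumes V: "subspace V"
  shows "linear (orth_proj V)"
proof (rule linearI)
  show "orth_proj V (x + y) = orth_proj V x + orth_proj V y" for x y
  proof (rule orth_proj_eq[OF V])
    show "orth_proj V x + orth_proj V y \<in> V" using V by (intro subspace_add orth_proj_in)
    show "(x + y - (orth_proj V x + orth_proj V y)) \<bullet> u = 0" if u: "u \<in> V" for u
      unfolding add_diff_add inner_add_left using orth_proj_orth[OF V u] by simp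
  qed
  show "orth_proj V (c *\<^sub>R x) = c *\<^sub>R orth_proj V x" for c x
  proof (rule orth_proj_eq[OF V])
    show "c *\<^sub>R orth_proj V x \<in> V" using V by (intro subspace_scale orth_proj_in)
    show "(c *\<^sub>R x - c *\<^sub>R orth_proj V x) \<bullet> u = 0" if u: "u \<in> V" for u
      unfolding scaleR_diff_right[symmetric] inner_scaleR_left using orth_proj_orth[OF V u] by simp
  qed
qed

lemma norm_orth_proj_pythagoras:
  assumes V: "subspace V"
  shows "(norm y)\<^sup>2 = (norm (orth_proj V y))\<^sup>2 + (norm (y - orth_proj V y))\<^sup>2"
proof -
  have "orthogonal (orth_proj V y) (y - orth_proj V y)"
    unfolding orthogonal_def inner_commute[of "orth_proj V y"]
    by (rule orth_proj_orth[OF V orth_proj_in[OF V]])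
  from norm_add_Pythagorean[OF this] show ?thesis by simp
qed

lemma norm_orth_proj_le:
  assumes V: "subspace V"
  shows "norm (orth_proj V y) \<le> norm y"
proof (rule power2_le_imp_le)
  show "(norm (orth_proj V y))\<^sup>2 \<le> (norm y)\<^sup>2"
    unfolding norm_orth_proj_pythagoras[OF V, of y] by simp
qed simp

lemma orth_proj_id: "subspace V \<Longrightarrow> y \<in> V \<Longrightarrow> orth_proj V y = y"
  by (rule orth_proj_eq) auto

text \<open>Pythagoras makes the projection the nearest point. This is the bridge between
  \<open>is_bundle\<close>, which speaks of distances, and \<open>tgrad_smooth\<close>, which speaks
  of projections.\<close>

lemma infdist_subspace:
  assumes V: "subspace V"
  shows "infdist y V = norm (y - orth_proj V y)"
proof (rule antisym)
  show "infdist y V \<le> norm (y - orth_proj V y)"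
    using infdist_le[OF orth_proj_in[OF V], of y y] by (simp add: dist_norm)
  have ne: "V \<noteq> {}" using subspace_0[OF V] by auto
  show "norm (y - orth_proj V y) \<le> infdist y V"
    unfolding infdist_notempty[OF ne]
  proof (rule cINF_greatest[OF ne])
    fix u assume u: "u \<in> V"
    have d: "orth_proj V y - u \<in> V" using V u by (simp add: orth_proj_in subspace_diff)
    have "(norm (y - u))\<^sup>2 = (norm ((y - orth_proj V y) + (orth_proj V y - u)))\<^sup>2" by simp
    also have "\<dots> = (norm (y - orth_proj V y))\<^sup>2 + (norm (orth_proj V y - u))\<^sup>2"
      using norm_add_Pythagorean orth_proj_orth[OF V d, of y] unfolding orthogonal_def by blast
    finally have "(norm (y - orth_proj V y))\<^sup>2 \<le> (norm (y - u))\<^sup>2" by simp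
    then show "norm (y - orth_proj V y) \<le> dist y u" by (simp add: dist_norm)
  qed
qed

text \<open>By Pythagoras the squared distances of \<open>e\<close> to the two spaces differ by the
  squared distance of its two projections. Equal distances thus force equal projections on the
  basis, hence everywhere by linearity. So the sum of the distances of the basis vectors drops
  strictly when a subspace grows strictly.\<close>

lemma subspace_subset_of_infdist_le:
  assumes V: "subspace V" and V': "subspace V'" and sub: "V \<subseteq> V'"
    and le: "\<And>e. e \<in> Basis \<Longrightarrow> infdist e V \<le> infdist e V'"
  shows "V' \<subseteq> V"
proof -
  have eq: "orth_proj V' e = orth_proj V e" if e: "e \<in> Basis" for e
  proof -
    let ?p = "orth_proj V e" and ?q = "orth_proj V' e"
    have d: "?q - ?p \<in> V'" using sub orth_proj_in[OF V, of e] V' by (auto simp: orth_proj_in subspace_diff)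
    have "(norm (e - ?p))\<^sup>2 = (norm ((e - ?q) + (?q - ?p)))\<^sup>2" by simp
    also have "\<dots> = (norm (e - ?q))\<^sup>2 + (norm (?q - ?p))\<^sup>2"
      using norm_add_Pythagorean orth_proj_orth[OF V' d, of e] unfolding orthogonal_def by blast
    moreover have "(norm (e - ?p))\<^sup>2 \<le> (norm (e - ?q))\<^sup>2"
      using le[OF e] by (simp add: infdist_subspace V V')
    ultimately have "(norm (?q - ?p))\<^sup>2 \<le> 0" by linarith
    then show ?thesis by simp
  qed
  show ?thesis
  proof
    fix v assume v: "v \<in> V'"
    have rep: "orth_proj W v = (\<Sum>e\<in>Basis. (v \<bullet> e) *\<^sub>R orth_proj W e)" if W: "subspace W" for W
    proof -
      have "orth_proj W (\<Sum>e\<in>Basis. (v \<bullet> e) *\<^sub>R e) = (\<Sum>e\<in>Basis. (v \<bullet> e) *\<^sub>R orth_proj W e)"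
        by (simp add: linear_sum[OF linear_orth_proj[OF W]] linear_scale[OF linear_orth_proj[OF W]])
      then show ?thesis by (simp only: euclidean_representation)
    qed
    have "v = orth_proj V' v" using orth_proj_id[OF V' v] by simp
    also have "\<dots> = orth_proj V v"
      unfolding rep[OF V] rep[OF V'] using eq by (intro sum.cong) auto
    finally show "v \<in> V" using orth_proj_in[OF V, of v] by simp
  qed
qed

text \<open>Polarisation writes the components of a projection through squared norms of projections,
  and each of these is a squared norm minus a squared distance, which is Borel by the definition of
  a bundle.\<close>

lemma orth_proj_measurable:
  assumes T: "is_bundle T" and [measurable]: "g \<in> borel_measurable borel"
  shows "(\<lambda>x. orth_proj (T x) (g x)) \<in> borel_measurable borel"
proof -
  have sub: "subspace (T x)" for x using T by (simp add: is_bundle_def)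
  have [measurable]: "(\<lambda>x. infdist y (T x)) \<in> borel_measurable borel" for y
    using T by (simp add: is_bundle_def)
  have inner: "orth_proj (T x) y \<bullet> e =
      (((norm (y + e))\<^sup>2 - (infdist (y + e) (T x))\<^sup>2) - ((norm (y - e))\<^sup>2 - (infdist (y - e) (T x))\<^sup>2)) / 4"
    for x y e
  proof -
    have n: "(norm (orth_proj (T x) z))\<^sup>2 = (norm z)\<^sup>2 - (infdist z (T x))\<^sup>2" for z
      using norm_orth_proj_pythagoras[OF sub[of x], of z] by (simp add: infdist_subspace[OF sub])
    have "orth_proj (T x) y \<bullet> e = orth_proj (T x) y \<bullet> orth_proj (T x) e"
      by (simp add: inner_orth_proj[OF sub orth_proj_in[OF sub]])
    also have "\<dots> = ((norm (orth_proj (T x) y + orth_proj (T x) e))\<^sup>2 -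
        (norm (orth_proj (T x) y - orth_proj (T x) e))\<^sup>2) / 4"
      by (simp add: power2_norm_eq_inner inner_add_left inner_add_right inner_diff_left inner_diff_right inner_commute)
    finally show ?thesis
      by (simp add: linear_add[OF linear_orth_proj[OF sub], symmetric]
          linear_diff[OF linear_orth_proj[OF sub], symmetric] n)
  qed
  have [measurable]: "(\<lambda>x. orth_proj (T x) y \<bullet> e) \<in> borel_measurable borel" for y e
    unfolding inner by measurable
  \<comment> \<open>Measurability is known so far for a fixed vector \<open>y\<close> only;
    expanding \<open>g x\<close> in the basis leaves finitely many projections of fixed
    vectors.\<close>
  have eq: "orth_proj (T x) (g x) = (\<Sum>e\<in>Basis. (\<Sum>i\<in>Basis. (g x \<bullet> i) * (orth_proj (T x) i \<bullet> e)) *\<^sub>R e)" for x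
  proof -
    have "orth_proj (T x) (g x) = orth_proj (T x) (\<Sum>i\<in>Basis. (g x \<bullet> i) *\<^sub>R i)"
      by (simp only: euclidean_representation)
    also have "\<dots> = (\<Sum>i\<in>Basis. (g x \<bullet> i) *\<^sub>R orth_proj (T x) i)"
      by (simp add: linear_sum[OF linear_orth_proj[OF sub]] linear_scale[OF linear_orth_proj[OF sub]])
    finally have *: "orth_proj (T x) (g x) = (\<Sum>i\<in>Basis. (g x \<bullet> i) *\<^sub>R orth_proj (T x) i)" .
    have "orth_proj (T x) (g x) = (\<Sum>e\<in>Basis. (orth_proj (T x) (g x) \<bullet> e) *\<^sub>R e)"
      by (simp only: euclidean_representation)
    then show ?thesis
      unfolding * inner_sum_left inner_scaleR_left .
  qed
  show ?thesis unfolding eq by measurable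
qed

text \<open>Gram--Schmidt without normalisation; division by zero is \<open>0\<close>, so dependent vectors are skipped.\<close>

primrec gram_schmidt :: "(nat \<Rightarrow> 'a::euclidean_space) \<Rightarrow> nat \<Rightarrow> 'a \<Rightarrow> 'a" where
  "gram_schmidt v 0 y = 0"
| "gram_schmidt v (Suc k) y =
     (let u = v k - gram_schmidt v k (v k) in gram_schmidt v k y + ((y \<bullet> u) / (u \<bullet> u)) *\<^sub>R u)"

lemma gram_schmidt_projection:
  "gram_schmidt v k y \<in> span (v ` {..<k}) \<and> (\<forall>u\<in>span (v ` {..<k}). (y - gram_schmidt v k y) \<bullet> u = 0)"
proof (induction k arbitrary: y)
  case (Suc k)
  let ?S = "span (v ` {..<k})" and ?S' = "span (v ` {..<Suc k})"
  define u where "u = v k - gram_schmidt v k (v k)"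
  define \<alpha> where "\<alpha> = (y \<bullet> u) / (u \<bullet> u)"
  have gs: "gram_schmidt v (Suc k) y = gram_schmidt v k y + \<alpha> *\<^sub>R u"
    by (simp add: Let_def u_def \<alpha>_def)
  have ins: "v ` {..<Suc k} = insert (v k) (v ` {..<k})" by (simp add: lessThan_Suc)
  have sub: "?S \<subseteq> ?S'" by (rule span_mono) auto
  have vk: "v k \<in> ?S'" by (rule span_base) simp
  have uS': "u \<in> ?S'" unfolding u_def using vk sub Suc.IH[of "v k"] by (auto intro: span_diff)
  have uorth: "u \<bullet> s = 0" if "s \<in> ?S" for s using Suc.IH[of "v k"] that by (simp add: u_def)
  have "gram_schmidt v (Suc k) y \<in> ?S'"
    unfolding gs using sub Suc.IH[of y] uS' by (auto intro: span_add span_scale)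
  moreover have "(y - gram_schmidt v (Suc k) y) \<bullet> w = 0" if w: "w \<in> ?S'" for w
  proof -
    obtain c where c: "w - c *\<^sub>R v k \<in> ?S" using w unfolding ins span_breakdown_eq by blast
    define s where "s = (w - c *\<^sub>R v k) + c *\<^sub>R gram_schmidt v k (v k)"
    have s: "s \<in> ?S" unfolding s_def using c Suc.IH[of "v k"] by (auto intro: span_add span_scale)
    have w_eq: "w = s + c *\<^sub>R u" by (simp add: s_def u_def algebra_simps)
    have 1: "(y - gram_schmidt v k y) \<bullet> s = 0" using Suc.IH[of y] s by blast
    have 2: "gram_schmidt v k y \<bullet> u = 0" using uorth[of "gram_schmidt v k y"] Suc.IH[of y] by (simp add: inner_commute)
    \<comment> \<open>If \<open>u = 0\<close>, that is, if \<open>v k\<close> already lies in the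
      earlier span, division by zero makes \<alpha> equal to 0 and both sides vanish.\<close>
    have 3: "\<alpha> * (u \<bullet> u) = y \<bullet> u" by (cases "u = 0") (auto simp: \<alpha>_def)
    have "(y - gram_schmidt v (Suc k) y) \<bullet> w
      = (y - gram_schmidt v k y) \<bullet> s - \<alpha> * (u \<bullet> s) + c * (y \<bullet> u - gram_schmidt v k y \<bullet> u - \<alpha> * (u \<bullet> u))"
      unfolding gs w_eq by (simp add: inner_diff_left inner_add_left inner_add_right algebra_simps)
    then show ?thesis using 1 2 3 uorth[OF s] by simp
  qed
  ultimately show ?case by blast
qed simp

text \<open>Every vector of the span is a combination of finitely many members, hence of the first
  \<open>k\<close> for some \<open>k\<close>. The result is a countable infimum of explicit
  expressions, from which \<open>is_bundle_span\<close> reads off measurability.\<close>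

lemma infdist_span_range:
  "infdist y (span (range v)) = (INF k::nat. norm (y - gram_schmidt v k y))"
proof -
  let ?S = "\<lambda>k. span (v ` {..<k})"
  have S: "infdist y (?S k) = norm (y - gram_schmidt v k y)" for k
    using infdist_subspace[of "?S k" y] orth_proj_eq[of "?S k" "gram_schmidt v k y" y]
      gram_schmidt_projection[of v k y] by simp
  have bdd: "bdd_below (range (\<lambda>k. infdist y (?S k)))"
    by (rule bdd_belowI[of _ 0]) (auto simp: infdist_nonneg)
  have "infdist y (span (range v)) = (INF k::nat. infdist y (?S k))"
  proof (rule antisym)
    show "infdist y (span (range v)) \<le> (INF k. infdist y (?S k))"
    proof (rule cINF_greatest)
      fix k
      have "?S k \<noteq> {}" using span_zero by blast
      then show "infdist y (span (range v)) \<le> infdist y (?S k)"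
        by (intro infdist_mono span_mono) auto
    qed simp
    have ne: "span (range v) \<noteq> {}" using span_zero by blast
    show "(INF k. infdist y (?S k)) \<le> infdist y (span (range v))"
      unfolding infdist_notempty[OF ne]
    proof (rule cINF_greatest[OF ne])
      fix a assume "a \<in> span (range v)"
      then obtain B where B: "finite B" "B \<subseteq> range v" "a \<in> span B"
        unfolding span_explicit by (auto intro: span_sum span_scale span_base)
      obtain I where I: "finite I" "B = v ` I" using finite_subset_image[OF B(1,2)] by blast
      obtain k where k: "I \<subseteq> {..<k}" using I(1) finite_nat_iff_bounded by blast
      have "a \<in> ?S k" using B(3) span_mono[of B "v ` {..<k}"] I(2) k by blast
      then have "infdist y (?S k) \<le> dist y a" by (rule infdist_le)
      moreover have "(INF k. infdist y (?S k)) \<le> infdist y (?S k)" by (rule cINF_lower[OF bdd]) simp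
      ultimately show "(INF k. infdist y (?S k)) \<le> dist y a" by linarith
    qed
  qed
  then show ?thesis by (simp only: S)
qed

lemma gram_schmidt_measurable:
  assumes v: "\<And>n. v n \<in> borel_measurable borel"
  shows "g \<in> borel_measurable borel \<Longrightarrow> (\<lambda>x. gram_schmidt (\<lambda>n. v n x) k (g x)) \<in> borel_measurable borel"
proof (induction k arbitrary: g)
  case (Suc k)
  have [measurable]: "v k \<in> borel_measurable borel" "g \<in> borel_measurable borel"
    "(\<lambda>x. gram_schmidt (\<lambda>n. v n x) k (v k x)) \<in> borel_measurable borel"
    "(\<lambda>x. gram_schmidt (\<lambda>n. v n x) k (g x)) \<in> borel_measurable borel"
    using v Suc by auto
  show ?case unfolding gram_schmidt.simps Let_def by measurable
qed simp

lemma is_bundle_span: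
  assumes v: "\<And>n::nat. v n \<in> borel_measurable borel"
  shows "is_bundle (\<lambda>x. span (range (\<lambda>n. v n x)))"
  unfolding is_bundle_def infdist_span_range
proof (intro conjI allI)
  have [measurable]: "(\<lambda>x. gram_schmidt (\<lambda>n. v n x) k y) \<in> borel_measurable borel" for k y
    by (rule gram_schmidt_measurable[OF v]) simp
  show "(\<lambda>x. INF k. norm (y - gram_schmidt (\<lambda>n. v n x) k y)) \<in> borel_measurable borel" for y
    by measurable
qed (rule subspace_span)

section \<open>Existence of the tangent bundle\<close>

context radon
begin

lemma D_infty_borel: "v \<in> D_infty \<mu> \<Longrightarrow> v \<in> borel_measurable borel"
  using borel_measurable_\<mu> by (auto simp: D_infty_def Linfty_def)

lemma zero_in_D_infty: "(\<lambda>x. 0) \<in> D_infty \<mu>"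
  unfolding D_infty_def has_div_mu_def Linfty_def
  by (auto intro!: exI[of _ "\<lambda>_. 0"] exI[of _ 0])

text \<open>Containment must hold for uncountably many fields, each with its own null set, so the
  span of all fields at a point is meaningless. A sequence that is extremal for \<open>d\<close>
  already captures each single field almost everywhere.\<close>

lemma ex_spanning_tangent_bundle:
  "\<exists>v. (\<forall>n::nat. v n \<in> D_infty \<mu>) \<and> is_tangent_bundle \<mu> (\<lambda>x. span (range (\<lambda>n. v n x)))"
proof -
  define S where "S = (\<lambda>(v :: nat \<Rightarrow> 'a \<Rightarrow> 'a) x. span (range (\<lambda>n. v n x)))"
  define d where "d = (\<lambda>v x. \<Sum>e\<in>Basis. infdist e (S v x))"
  let ?D = "{v. \<forall>n::nat. v n \<in> D_infty \<mu>}"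
  have isb: "is_bundle (S v)" if "v \<in> ?D" for v
    unfolding S_def using that by (intro is_bundle_span D_infty_borel) auto
  have subspace: "subspace (S v x)" for v x by (simp add: S_def)
  have infdist_antimono: "infdist e (S w x) \<le> infdist e (S v x)" if "S v x \<subseteq> S w x" for e v w x
    using that subspace_0[OF subspace[of v x]] by (intro infdist_mono) auto
  have "\<exists>g\<in>d ` ?D. \<forall>f\<in>d ` ?D. AE x in \<mu>. g x \<le> f x"
  proof (rule ae_least_element)
    show "d ` ?D \<noteq> {}" using zero_in_D_infty by auto
    show "f \<in> borel_measurable \<mu>" if "f \<in> d ` ?D" for f
    proof -
      obtain v where v: "v \<in> ?D" "f = d v" using \<open>f \<in> d ` ?D\<close> by blast
      show ?thesis
        unfolding v(2) d_def borel_measurable_\<mu>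
        using isb[OF v(1)] by (intro borel_measurable_sum) (simp add: is_bundle_def)
    qed
    fix f :: "nat \<Rightarrow> 'a \<Rightarrow> real" assume "\<And>n. f n \<in> d ` ?D"
    then have "\<forall>n. \<exists>v. v \<in> ?D \<and> f n = d v" by blast
    then obtain v where v: "\<And>n. v n \<in> ?D" "\<And>n. f n = d (v n)" by metis
    \<comment> \<open>Merging countably many sequences into one by a pairing function: the span of
      \<open>w\<close> contains all their spans, so \<open>d w\<close> is a common lower
      bound.\<close>
    define w where "w = (\<lambda>k. v (fst (prod_decode k)) (snd (prod_decode k)))"
    have w: "w \<in> ?D" using v(1) by (auto simp: w_def)
    have sub: "S (v n) x \<subseteq> S w x" for n x
      unfolding S_def
    proof (rule span_mono, rule subsetI)
      fix y assume "y \<in> range (\<lambda>m. v n m x)"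
      then obtain m where "y = v n m x" by blast
      then have "y = w (prod_encode (n, m)) x" by (simp add: w_def)
      then show "y \<in> range (\<lambda>n. w n x)" by blast
    qed
    have "d w x \<le> f n x" for n x
      unfolding v(2) d_def by (intro sum_mono infdist_antimono sub)
    then show "\<exists>g\<in>d ` ?D. \<forall>n. AE x in \<mu>. g x \<le> f n x"
      using w by (intro bexI[of _ "d w"]) auto
  qed
  then obtain v where v: "v \<in> ?D" and least: "\<And>w. w \<in> ?D \<Longrightarrow> AE x in \<mu>. d v x \<le> d w x" by blast
  have "contains_D_infty \<mu> (S v)"
    unfolding contains_D_infty_def
  proof
    fix u assume u: "u \<in> D_infty \<mu>"
    \<comment> \<open>Prepending \<open>u\<close> can only enlarge the span and lower the distances,
      while minimality of \<open>d v\<close> forbids a decrease. The two spans therefore agree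
      almost everywhere, and the larger one contains \<open>u x\<close>.\<close>
    define w where "w = case_nat u v"
    have w: "w \<in> ?D" using u v by (auto simp: w_def split: nat.split)
    have sub: "S v x \<subseteq> S w x" for x
      unfolding S_def
    proof (rule span_mono, rule subsetI)
      fix y assume "y \<in> range (\<lambda>m. v m x)"
      then obtain m where "y = v m x" by blast
      then have "y = w (Suc m) x" by (simp add: w_def)
      then show "y \<in> range (\<lambda>n. w n x)" by blast
    qed
    from least[OF w] show "AE x in \<mu>. u x \<in> S v x"
    proof eventually_elim
      case (elim x)
      have le: "infdist e (S v x) \<le> infdist e (S w x)" if e: "e \<in> Basis" for e
      proof -
        have "d w x \<le> d v x" unfolding d_def by (intro sum_mono infdist_antimono sub)
        with elim have "(\<Sum>e\<in>Basis. infdist e (S v x) - infdist e (S w x)) = 0"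
          by (simp add: d_def sum_subtractf)
        then have "infdist e (S v x) - infdist e (S w x) = 0"
          by (subst (asm) sum_nonneg_eq_0_iff) (use e infdist_antimono[OF sub] in auto)
        then show ?thesis by simp
      qed
      have "u x \<in> S w x" unfolding S_def by (rule span_base) (auto simp: w_def intro: range_eqI[of _ _ 0])
      then show ?case
        using subspace_subset_of_infdist_le[OF subspace subspace sub le] by blast
    qed
  qed
  moreover have "AE x in \<mu>. S v x \<subseteq> R x" if R: "is_bundle R" "contains_D_infty \<mu> R" for R
  proof -
    \<comment> \<open>Countability of the sequence pays off here: a single null set serves all
      \<open>n\<close>, and the subspace \<open>R x\<close> then contains the whole span.\<close>
    have "AE x in \<mu>. \<forall>n. v n x \<in> R x"
      unfolding AE_all_countable using R(2) v by (auto simp: contains_D_infty_def)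
    then show ?thesis
    proof eventually_elim
      case (elim x)
      then show ?case
        unfolding S_def using R(1) by (intro span_minimal) (auto simp: is_bundle_def)
    qed
  qed
  ultimately have "is_tangent_bundle \<mu> (S v)"
    unfolding is_tangent_bundle_def using isb[OF v] by blast
  then show ?thesis using v unfolding S_def by blast
qed

abbreviation T where "T \<equiv> tangent_bundle \<mu>"

lemma is_tangent_bundle: "is_tangent_bundle \<mu> T"
proof -
  have "\<exists>V. is_tangent_bundle \<mu> V" using ex_spanning_tangent_bundle by blast
  then show ?thesis unfolding tangent_bundle_def by (rule someI_ex)
qed

lemma is_bundle_T: "is_bundle T"
  using is_tangent_bundle by (simp add: is_tangent_bundle_def)

lemma subspace_T: "subspace (T x)"
  using is_bundle_T by (simp add: is_bundle_def)

lemma D_infty_in_T: "v \<in> D_infty \<mu> \<Longrightarrow> AE x in \<mu>. v x \<in> T x"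
  using is_tangent_bundle by (simp add: is_tangent_bundle_def contains_D_infty_def)

text \<open>\<open>tangent_bundle\<close> is chosen without reference to any sequence. Its
  minimality, with the spanning bundle as competitor, gives the inclusion.\<close>

lemma T_spanned:
  obtains v where "\<And>n::nat. v n \<in> D_infty \<mu>" "AE x in \<mu>. T x \<subseteq> span (range (\<lambda>n. v n x))"
proof -
  obtain v where v: "\<forall>n::nat. v n \<in> D_infty \<mu>"
    and t: "is_tangent_bundle \<mu> (\<lambda>x. span (range (\<lambda>n. v n x)))"
    using ex_spanning_tangent_bundle by blast
  have "AE x in \<mu>. T x \<subseteq> span (range (\<lambda>n. v n x))"
    using is_tangent_bundle t unfolding is_tangent_bundle_def by blast
  then show thesis using v that by blast
qed

lemma tgrad_smooth_in_T: "tgrad_smooth \<mu> F x \<in> T x"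
  unfolding tgrad_smooth_def by (rule orth_proj_in[OF subspace_T])

lemma tgrad_smooth_measurable: "F \<in> Cinf_c \<Longrightarrow> tgrad_smooth \<mu> F \<in> borel_measurable \<mu>"
  unfolding tgrad_smooth_def[abs_def] borel_measurable_\<mu>
  using grad_measurable borel_measurable_\<mu> by (blast intro: orth_proj_measurable[OF is_bundle_T])

lemma norm_tgrad_smooth_le: "norm (tgrad_smooth \<mu> F x) \<le> norm (grad F x)"
  unfolding tgrad_smooth_def by (rule norm_orth_proj_le[OF subspace_T])

text \<open>Tangent vectors do not see the projection. Since members of \<open>D_infty\<close> are
  tangent almost everywhere, their divergence identity can be read with \<open>tgrad_smooth\<close>
  in place of \<open>grad\<close>.\<close>

lemma inner_tgrad_smooth: "u \<in> T x \<Longrightarrow> u \<bullet> tgrad_smooth \<mu> F x = u \<bullet> grad F x"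
  unfolding tgrad_smooth_def by (rule inner_orth_proj[OF subspace_T])

lemma tgrad_smooth_add:
  assumes "F \<in> Cinf_c" "G \<in> Cinf_c"
  shows "tgrad_smooth \<mu> (\<lambda>x. F x + G x) x = tgrad_smooth \<mu> F x + tgrad_smooth \<mu> G x"
  by (simp add: tgrad_smooth_def grad_add[OF assms] linear_add[OF linear_orth_proj[OF subspace_T]])

lemma tgrad_smooth_cmult:
  assumes "F \<in> Cinf_c"
  shows "tgrad_smooth \<mu> (\<lambda>x. c * F x) x = c *\<^sub>R tgrad_smooth \<mu> F x"
  by (simp add: tgrad_smooth_def grad_cmult[OF assms] linear_scale[OF linear_orth_proj[OF subspace_T]])

lemma tgrad_smooth_mult:
  assumes "F \<in> Cinf_c" "G \<in> Cinf_c"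
  shows "tgrad_smooth \<mu> (\<lambda>x. F x * G x) x = F x *\<^sub>R tgrad_smooth \<mu> G x + G x *\<^sub>R tgrad_smooth \<mu> F x"
  by (simp add: tgrad_smooth_def grad_mult[OF assms] linear_scale[OF linear_orth_proj[OF subspace_T]]
      linear_add[OF linear_orth_proj[OF subspace_T]])

section \<open>Integration by parts and closability of the tangential gradient\<close>

lemma Linfty_inner_integrable:
  fixes u :: "'a \<Rightarrow> 'b::euclidean_space"
  assumes u: "u \<in> Linfty \<mu>" and f: "integrable \<mu> f"
  shows "integrable \<mu> (\<lambda>x. u x \<bullet> f x)"
proof -
  have [measurable]: "u \<in> borel_measurable \<mu>" "f \<in> borel_measurable \<mu>"
    using u f by (auto simp: Linfty_def)
  obtain C where C: "C > 0" "AE x in \<mu>. norm (u x) \<le> C" by (rule LinftyE[OF u]) blast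
  show ?thesis
  proof (rule Bochner_Integration.integrable_bound)
    show "integrable \<mu> (\<lambda>x. C * norm (f x))" using f by simp
    show "AE x in \<mu>. norm (u x \<bullet> f x) \<le> norm (C * norm (f x))"
      using C(2)
    proof eventually_elim
      case (elim x)
      have "\<bar>u x \<bullet> f x\<bar> \<le> norm (u x) * norm (f x)" by (rule Cauchy_Schwarz_ineq2)
      also have "\<dots> \<le> C * norm (f x)" using elim by (intro mult_right_mono) auto
      finally show ?case using C(1) by simp
    qed
  qed measurable
qed

lemma L1_tendsto_integral:
  fixes u :: "'a \<Rightarrow> 'b::euclidean_space"
  assumes u: "u \<in> Linfty \<mu>" and F: "L1_tendsto \<mu> F f"
  shows "(\<lambda>n. \<integral>x. u x \<bullet> F n x \<partial>\<mu>) \<longlonglongrightarrow> (\<integral>x. u x \<bullet> f x \<partial>\<mu>)"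
proof -
  obtain C where C: "C > 0" "AE x in \<mu>. norm (u x) \<le> C" by (rule LinftyE[OF u]) blast
  have Fn: "integrable \<mu> (F n)" and f: "integrable \<mu> f" for n using F by (auto simp: L1_tendsto_def)
  have lim: "(\<lambda>n. C * (\<integral>x. norm (F n x - f x) \<partial>\<mu>)) \<longlonglongrightarrow> C * 0"
    using F unfolding L1_tendsto_def by (intro tendsto_mult tendsto_const) auto
  have "norm ((\<integral>x. u x \<bullet> F n x \<partial>\<mu>) - (\<integral>x. u x \<bullet> f x \<partial>\<mu>)) \<le> C * (\<integral>x. norm (F n x - f x) \<partial>\<mu>)" for n
  proof -
    have d: "integrable \<mu> (\<lambda>x. F n x - f x)" using Fn f by simp
    have "(\<integral>x. u x \<bullet> F n x \<partial>\<mu>) - (\<integral>x. u x \<bullet> f x \<partial>\<mu>) = (\<integral>x. u x \<bullet> (F n x - f x) \<partial>\<mu>)"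
      using Linfty_inner_integrable[OF u Fn[of n]] Linfty_inner_integrable[OF u f]
      by (simp add: inner_diff_right)
    also have "norm \<dots> \<le> (\<integral>x. C * norm (F n x - f x) \<partial>\<mu>)"
    proof (rule order_trans[OF integral_norm_bound], rule integral_mono_AE)
      show "integrable \<mu> (\<lambda>x. norm (u x \<bullet> (F n x - f x)))"
        using Linfty_inner_integrable[OF u d] by (rule integrable_norm)
      show "integrable \<mu> (\<lambda>x. C * norm (F n x - f x))" using d by simp
      show "AE x in \<mu>. norm (u x \<bullet> (F n x - f x)) \<le> C * norm (F n x - f x)"
        using C(2)
      proof eventually_elim
        case (elim x)
        have "\<bar>u x \<bullet> (F n x - f x)\<bar> \<le> norm (u x) * norm (F n x - f x)" by (rule Cauchy_Schwarz_ineq2)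
        also have "\<dots> \<le> C * norm (F n x - f x)" using elim by (intro mult_right_mono) auto
        finally show ?case by simp
      qed
    qed
    finally show ?thesis by simp
  qed
  then have "(\<lambda>n. (\<integral>x. u x \<bullet> F n x \<partial>\<mu>) - (\<integral>x. u x \<bullet> f x \<partial>\<mu>)) \<longlonglongrightarrow> 0"
    by (intro tendsto_norm_zero_cancel[OF tendsto_sandwich[OF _ _ tendsto_const lim[unfolded mult_zero_right]]])
      auto
  then show ?thesis by (rule LIM_zero_cancel)
qed

lemma Linfty_scaleR:
  fixes v :: "'a \<Rightarrow> 'b::euclidean_space"
  assumes h: "h \<in> Linfty \<mu>" and v: "v \<in> Linfty \<mu>"
  shows "(\<lambda>x. h x *\<^sub>R v x) \<in> Linfty \<mu>"
proof -
  have [measurable]: "h \<in> borel_measurable \<mu>" "v \<in> borel_measurable \<mu>" using h v by (auto simp: Linfty_def)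
  obtain C where C: "C > 0" "AE x in \<mu>. norm (h x) \<le> C" by (rule LinftyE[OF h]) blast
  obtain D where D: "D > 0" "AE x in \<mu>. norm (v x) \<le> D" by (rule LinftyE[OF v]) blast
  have "AE x in \<mu>. norm (h x *\<^sub>R v x) \<le> C * D"
    using C(2) D(2)
  proof eventually_elim
    case (elim x)
    then show ?case unfolding norm_scaleR using C(1) by (intro mult_mono) auto
  qed
  then show ?thesis unfolding Linfty_def by auto
qed

lemma Linfty_inner:
  fixes v :: "'a \<Rightarrow> 'b::euclidean_space"
  assumes h: "h \<in> Linfty \<mu>" and v: "v \<in> Linfty \<mu>"
  shows "(\<lambda>x. h x \<bullet> v x) \<in> Linfty \<mu>"
proof -
  have [measurable]: "h \<in> borel_measurable \<mu>" "v \<in> borel_measurable \<mu>" using h v by (auto simp: Linfty_def)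
  obtain C where C: "C > 0" "AE x in \<mu>. norm (h x) \<le> C" by (rule LinftyE[OF h]) blast
  obtain D where D: "D > 0" "AE x in \<mu>. norm (v x) \<le> D" by (rule LinftyE[OF v]) blast
  have "AE x in \<mu>. norm (h x \<bullet> v x) \<le> C * D"
    using C(2) D(2)
  proof eventually_elim
    case (elim x)
    have "\<bar>h x \<bullet> v x\<bar> \<le> norm (h x) * norm (v x)" by (rule Cauchy_Schwarz_ineq2)
    also have "\<dots> \<le> C * D" using C(1) elim by (intro mult_mono) auto
    finally show ?case by simp
  qed
  then show ?thesis unfolding Linfty_def by auto
qed

lemma Linfty_add:
  fixes v w :: "'a \<Rightarrow> 'b::euclidean_space"
  assumes v: "v \<in> Linfty \<mu>" and w: "w \<in> Linfty \<mu>"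
  shows "(\<lambda>x. v x + w x) \<in> Linfty \<mu>"
proof -
  have [measurable]: "v \<in> borel_measurable \<mu>" "w \<in> borel_measurable \<mu>" using v w by (auto simp: Linfty_def)
  obtain C where C: "C > 0" "AE x in \<mu>. norm (v x) \<le> C" by (rule LinftyE[OF v]) blast
  obtain D where D: "D > 0" "AE x in \<mu>. norm (w x) \<le> D" by (rule LinftyE[OF w]) blast
  have "AE x in \<mu>. norm (v x + w x) \<le> C + D"
    using C(2) D(2) by eventually_elim (rule norm_triangle_mono)
  then show ?thesis unfolding Linfty_def by auto
qed

lemma Linfty_const: "(\<lambda>x. c) \<in> Linfty \<mu>"
  unfolding Linfty_def by auto

lemma LIPc_Linfty: "f \<in> LIPc \<Longrightarrow> f \<in> Linfty \<mu>"
  by (rule LIPcE, assumption) (auto simp: Linfty_def LIPc_measurable intro!: exI always_eventually)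

lemma grad_Linfty: "F \<in> Cinf_c \<Longrightarrow> grad F \<in> Linfty \<mu>"
  by (rule Cinf_cE, assumption) (auto simp: Linfty_def grad_measurable intro!: exI always_eventually)

lemma D_infty_Linfty: "v \<in> D_infty \<mu> \<Longrightarrow> v \<in> Linfty \<mu>"
  by (simp add: D_infty_def)

lemma integrable_grad: "F \<in> Cinf_c \<Longrightarrow> integrable \<mu> (grad F)"
  by (rule Cinf_cE, assumption)
    (rule integrable_bounded_support, auto simp: grad_measurable intro!: always_eventually)

text \<open>The divergence identity is applied to the product of \<phi> with an approximating test
  function \<open>F n\<close>; the Leibniz rule isolates the gradient of \<open>F n\<close>. Every
  remaining factor is bounded, so L1 convergence suffices to pass to the limit. The right-hand side
  does not involve \<open>w\<close>.\<close>

lemma has_tgrad_integration_by_parts: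
  assumes v: "v \<in> D_infty \<mu>" and g: "has_div_mu \<mu> v g" and w: "has_tgrad \<mu> f w"
    and \<phi>: "\<phi> \<in> Cinf_c"
  shows "(\<integral>x. \<phi> x * (v x \<bullet> w x) \<partial>\<mu>) = - (\<integral>x. f x * (\<phi> x * g x + v x \<bullet> grad \<phi> x) \<partial>\<mu>)"
proof -
  obtain F where F: "\<And>n. F n \<in> Cinf_c" "L1_tendsto \<mu> F f" "L1_tendsto \<mu> (\<lambda>n. tgrad_smooth \<mu> (F n)) w"
    using w by (auto simp: has_tgrad_def)
  have gL: "g \<in> Linfty \<mu>" using g by (simp add: has_div_mu_def)
  have vL: "v \<in> Linfty \<mu>" by (rule D_infty_Linfty[OF v])
  have 1: "(\<lambda>x. \<phi> x *\<^sub>R v x) \<in> Linfty \<mu>"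
    by (intro Linfty_scaleR LIPc_Linfty Cinf_c_LIPc \<phi> vL)
  have 2: "(\<lambda>x. \<phi> x * g x + v x \<bullet> grad \<phi> x) \<in> Linfty \<mu>"
    using Linfty_scaleR[OF LIPc_Linfty[OF Cinf_c_LIPc[OF \<phi>]] gL]
    by (intro Linfty_add Linfty_inner vL grad_Linfty \<phi>) simp
  have eq: "(\<integral>x. (\<phi> x *\<^sub>R v x) \<bullet> tgrad_smooth \<mu> (F n) x \<partial>\<mu>)
      = - (\<integral>x. (\<phi> x * g x + v x \<bullet> grad \<phi> x) \<bullet> F n x \<partial>\<mu>)" for n
  proof -
    have pF: "(\<lambda>x. \<phi> x * F n x) \<in> Cinf_c" by (rule Cinf_c_mult[OF \<phi> F(1)])
    have i1: "integrable \<mu> (\<lambda>x. grad (\<lambda>x. \<phi> x * F n x) x \<bullet> v x)"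
      using Linfty_inner_integrable[OF vL integrable_grad[OF pF]] by (simp add: inner_commute)
    have i2: "integrable \<mu> (\<lambda>x. F n x * (v x \<bullet> grad \<phi> x))"
      using Linfty_integrable_mult[OF Linfty_inner[OF vL grad_Linfty[OF \<phi>]] Cinf_c_LIPc[OF F(1)]] by simp
    have i3: "integrable \<mu> (\<lambda>x. \<phi> x * F n x * g x)"
      using Linfty_integrable_mult[OF gL Cinf_c_LIPc[OF pF]] by simp
    have "(\<integral>x. (\<phi> x *\<^sub>R v x) \<bullet> tgrad_smooth \<mu> (F n) x \<partial>\<mu>)
      = (\<integral>x. grad (\<lambda>x. \<phi> x * F n x) x \<bullet> v x - F n x * (v x \<bullet> grad \<phi> x) \<partial>\<mu>)"
    proof (rule integral_cong_AE)
      show "AE x in \<mu>. (\<phi> x *\<^sub>R v x) \<bullet> tgrad_smooth \<mu> (F n) x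
        = grad (\<lambda>x. \<phi> x * F n x) x \<bullet> v x - F n x * (v x \<bullet> grad \<phi> x)"
        using D_infty_in_T[OF v]
        by eventually_elim
          (simp add: inner_tgrad_smooth grad_mult[OF \<phi> F(1)] inner_commute[of _ "v _"] inner_add_right)
      show "(\<lambda>x. (\<phi> x *\<^sub>R v x) \<bullet> tgrad_smooth \<mu> (F n) x) \<in> borel_measurable \<mu>"
        using Linfty_measurable[OF 1] tgrad_smooth_measurable[OF F(1)] by (rule borel_measurable_inner)
      show "(\<lambda>x. grad (\<lambda>x. \<phi> x * F n x) x \<bullet> v x - F n x * (v x \<bullet> grad \<phi> x)) \<in> borel_measurable \<mu>"
        using i1 i2 by (intro borel_measurable_diff) auto
    qed
    also have "\<dots> = - (\<integral>x. \<phi> x * F n x * g x \<partial>\<mu>) - (\<integral>x. F n x * (v x \<bullet> grad \<phi> x) \<partial>\<mu>)"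
      using g pF i1 i2 by (simp add: has_div_mu_def)
    also have "\<dots> = - (\<integral>x. \<phi> x * F n x * g x + F n x * (v x \<bullet> grad \<phi> x) \<partial>\<mu>)"
      using i2 i3 by simp
    also have "\<dots> = - (\<integral>x. (\<phi> x * g x + v x \<bullet> grad \<phi> x) \<bullet> F n x \<partial>\<mu>)"
      by (simp add: algebra_simps)
    finally show ?thesis .
  qed
  have "(\<lambda>n. \<integral>x. (\<phi> x *\<^sub>R v x) \<bullet> tgrad_smooth \<mu> (F n) x \<partial>\<mu>) \<longlonglongrightarrow> (\<integral>x. (\<phi> x *\<^sub>R v x) \<bullet> w x \<partial>\<mu>)"
    by (rule L1_tendsto_integral[OF 1 F(3)])
  moreover have "(\<lambda>n. \<integral>x. (\<phi> x *\<^sub>R v x) \<bullet> tgrad_smooth \<mu> (F n) x \<partial>\<mu>)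
      \<longlonglongrightarrow> - (\<integral>x. (\<phi> x * g x + v x \<bullet> grad \<phi> x) \<bullet> f x \<partial>\<mu>)"
    unfolding eq by (intro tendsto_minus L1_tendsto_integral[OF 2 F(2)])
  ultimately have "(\<integral>x. (\<phi> x *\<^sub>R v x) \<bullet> w x \<partial>\<mu>) = - (\<integral>x. (\<phi> x * g x + v x \<bullet> grad \<phi> x) \<bullet> f x \<partial>\<mu>)"
    by (rule LIMSEQ_unique)
  then show ?thesis by (simp add: mult.commute)
qed

text \<open>Integration by parts shows that \<open>w\<close> and \<open>w'\<close> have the same
  inner product with each member of the spanning sequence. Their difference lies in that span, so it
  is orthogonal to itself.\<close>

lemma has_tgrad_unique:
  assumes w: "has_tgrad \<mu> f w" and w': "has_tgrad \<mu> f w'"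
  shows "AE x in \<mu>. w x = w' x"
proof -
  have wi: "integrable \<mu> w" "integrable \<mu> w'" and wT: "AE x in \<mu>. w x \<in> T x" "AE x in \<mu>. w' x \<in> T x"
    using w w' by (auto simp: has_tgrad_def Gamma1_def)
  obtain v where v: "\<And>n::nat. v n \<in> D_infty \<mu>" and span: "AE x in \<mu>. T x \<subseteq> span (range (\<lambda>n. v n x))"
    by (rule T_spanned) blast
  have "AE x in \<mu>. v n x \<bullet> w x - v n x \<bullet> w' x = 0" for n
  proof (rule test_functions_separate)
    have i: "integrable \<mu> (\<lambda>x. v n x \<bullet> w x)" "integrable \<mu> (\<lambda>x. v n x \<bullet> w' x)"
      using Linfty_inner_integrable[OF D_infty_Linfty[OF v] wi(1)]
        Linfty_inner_integrable[OF D_infty_Linfty[OF v] wi(2)] by auto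
    then show "integrable \<mu> (\<lambda>x. v n x \<bullet> w x - v n x \<bullet> w' x)" by simp
    fix \<phi> :: "'a \<Rightarrow> real" assume \<phi>: "\<phi> \<in> Cinf_c"
    obtain g where g: "has_div_mu \<mu> (v n) g" using v[of n] by (auto simp: D_infty_def)
    have j: "integrable \<mu> (\<lambda>x. \<phi> x * (v n x \<bullet> w x))" "integrable \<mu> (\<lambda>x. \<phi> x * (v n x \<bullet> w' x))"
      using Linfty_inner_integrable[OF LIPc_Linfty[OF Cinf_c_LIPc[OF \<phi>]] i(1)]
        Linfty_inner_integrable[OF LIPc_Linfty[OF Cinf_c_LIPc[OF \<phi>]] i(2)] by auto
    show "(\<integral>x. \<phi> x * (v n x \<bullet> w x - v n x \<bullet> w' x) \<partial>\<mu>) = 0"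
      using has_tgrad_integration_by_parts[OF v g w \<phi>] has_tgrad_integration_by_parts[OF v g w' \<phi>] j
      by (simp add: right_diff_distrib)
  qed
  then have "AE x in \<mu>. \<forall>n. v n x \<bullet> w x - v n x \<bullet> w' x = 0" unfolding AE_all_countable by blast
  with span wT show ?thesis
  proof eventually_elim
    case (elim x)
    have "w x - w' x \<in> span (range (\<lambda>n. v n x))"
      using elim(1-3) subspace_diff[OF subspace_T, of "w x" x "w' x"] by blast
    moreover have "orthogonal (w x - w' x) y" if "y \<in> range (\<lambda>n. v n x)" for y
      using that elim(4) by (auto simp: orthogonal_def inner_diff_left inner_diff_right inner_commute)
    ultimately have "orthogonal (w x - w' x) (w x - w' x)"
      by (rule orthogonal_to_span)
    then show ?case by (simp add: orthogonal_def)
  qed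
qed

lemma tgrad_eq:
  assumes "has_tgrad \<mu> f w"
  shows "AE x in \<mu>. tgrad \<mu> f x = w x" "has_tgrad \<mu> f (tgrad \<mu> f)"
proof -
  show "has_tgrad \<mu> f (tgrad \<mu> f)" unfolding tgrad_def using assms by (rule someI[where P = "has_tgrad \<mu> f"])
  then show "AE x in \<mu>. tgrad \<mu> f x = w x" using has_tgrad_unique assms by blast
qed

section \<open>Bounded pointwise approximation by test functions\<close>

lemma L1_tendsto_dominated:
  fixes h :: "nat \<Rightarrow> 'a \<Rightarrow> 'b::euclidean_space"
  assumes meas: "\<And>n. h n \<in> borel_measurable \<mu>" "h' \<in> borel_measurable \<mu>"
    and bound: "\<And>n x. norm (h n x) \<le> C" and supp: "\<And>n x. r < norm x \<Longrightarrow> h n x = 0"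
    and lim: "AE x in \<mu>. (\<lambda>n. h n x) \<longlonglongrightarrow> h' x"
  shows "L1_tendsto \<mu> h h'"
proof -
  note [measurable] = meas
  have dom: "integrable \<mu> (\<lambda>x. indicator (cball 0 r) x * C)"
    using emeasure_compact_finite[OF compact_cball, of 0 r]
    by (intro integrable_mult_left integrable_real_indicator) (auto simp: sets_\<mu>)
  have hb: "norm (h n x) \<le> indicator (cball 0 r) x * C" for n x
    using bound[of n x] supp[of x n] by (cases "norm x \<le> r") auto
  have hn: "integrable \<mu> (h n)" for n
    by (rule integrable_dominated_convergence2[OF meas(2,1) dom lim]) (simp add: hb)
  have h': "integrable \<mu> h'"
    by (rule integrable_dominated_convergence[OF meas(2,1) dom lim]) (simp add: hb)
  have "(\<lambda>n. \<integral>x. norm (h n x - h' x) \<partial>\<mu>) \<longlonglongrightarrow> (\<integral>x. 0 \<partial>\<mu>)"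
  proof (rule integral_dominated_convergence)
    show "integrable \<mu> (\<lambda>x. indicator (cball 0 r) x * C + norm (h' x))" using dom h' by simp
    show "AE x in \<mu>. (\<lambda>n. norm (h n x - h' x)) \<longlonglongrightarrow> 0"
      using lim
    proof eventually_elim
      case (elim x)
      then show ?case by (intro tendsto_norm_zero) (rule LIM_zero)
    qed
    show "AE x in \<mu>. norm (norm (h n x - h' x)) \<le> indicator (cball 0 r) x * C + norm (h' x)" for n
    proof (intro always_eventually allI)
      show "norm (norm (h n x - h' x)) \<le> indicator (cball 0 r) x * C + norm (h' x)" for x
        using norm_triangle_ineq4[of "h n x" "h' x"] hb[of n x] by simp
    qed
  qed measurable
  then show ?thesis using hn h' by (simp add: L1_tendsto_def)
qed

text \<open>A stronger mode of convergence than the one in \<open>has_tgrad\<close>: L1 convergence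
  alone does not pass to products, whereas pointwise limits under uniform bounds and a common
  support do, so that the Leibniz rule survives.\<close>

definition approximates :: "(nat \<Rightarrow> 'a \<Rightarrow> real) \<Rightarrow> ('a \<Rightarrow> real) \<Rightarrow> ('a \<Rightarrow> 'a) \<Rightarrow> bool" where
  "approximates F f w \<longleftrightarrow>
     (\<forall>n. F n \<in> Cinf_c) \<and> (\<exists>C. \<forall>n x. \<bar>F n x\<bar> \<le> C \<and> norm (grad (F n) x) \<le> C) \<and>
     (\<exists>r. \<forall>n x. r < norm x \<longrightarrow> F n x = 0) \<and> (\<forall>x. (\<lambda>n. F n x) \<longlonglongrightarrow> f x) \<and>
     w \<in> borel_measurable \<mu> \<and> (AE x in \<mu>. (\<lambda>n. tgrad_smooth \<mu> (F n) x) \<longlonglongrightarrow> w x)"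

text \<open>The uniform bounds on a common ball of finite measure permit dominated convergence. The
  limit stays tangent because subspaces of a Euclidean space are closed.\<close>

lemma approximates_has_tgrad:
  assumes "approximates F f w"
  shows "has_tgrad \<mu> f w"
proof -
  obtain C r where F: "\<And>n. F n \<in> Cinf_c" and C: "\<And>n x. \<bar>F n x\<bar> \<le> C" "\<And>n x. norm (grad (F n) x) \<le> C"
    and r: "\<And>n x. r < norm x \<Longrightarrow> F n x = 0" and lim: "\<And>x. (\<lambda>n. F n x) \<longlonglongrightarrow> f x"
    and [measurable]: "w \<in> borel_measurable \<mu>"
    and tlim: "AE x in \<mu>. (\<lambda>n. tgrad_smooth \<mu> (F n) x) \<longlonglongrightarrow> w x"
    using assms unfolding approximates_def by blast
  have [measurable]: "F n \<in> borel_measurable \<mu>" "tgrad_smooth \<mu> (F n) \<in> borel_measurable \<mu>" for n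
    using F by (auto intro: Cinf_c_measurable tgrad_smooth_measurable)
  have f: "f \<in> borel_measurable \<mu>"
    by (rule borel_measurable_LIMSEQ_real[OF lim]) measurable
  have 1: "L1_tendsto \<mu> F f"
    by (rule L1_tendsto_dominated[where C = C and r = r]) (use C r lim f in auto)
  have 2: "L1_tendsto \<mu> (\<lambda>n. tgrad_smooth \<mu> (F n)) w"
  proof (rule L1_tendsto_dominated[where C = C and r = r])
    show "norm (tgrad_smooth \<mu> (F n) x) \<le> C" for n x
      by (rule order_trans[OF norm_tgrad_smooth_le C(2)])
    show "tgrad_smooth \<mu> (F n) x = 0" if "r < norm x" for n x
      using norm_tgrad_smooth_le[of "F n" x] grad_eq_0_outside[OF r that] by simp
  qed (use tlim in auto)
  have "AE x in \<mu>. w x \<in> T x"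
    using tlim
  proof eventually_elim
    case (elim x)
    show ?case
      by (rule closed_sequentially[OF closed_subspace[OF subspace_T] tgrad_smooth_in_T elim])
  qed
  then show ?thesis
    unfolding has_tgrad_def Gamma1_def using 1 2 F by (auto simp: L1_tendsto_def)
qed

lemma approximates_tgrad: "approximates F f w \<Longrightarrow> AE x in \<mu>. tgrad \<mu> f x = w x"
  by (rule tgrad_eq[OF approximates_has_tgrad])

lemma approximates_smooth:
  assumes F: "F \<in> Cinf_c"
  shows "approximates (\<lambda>_. F) F (tgrad_smooth \<mu> F)"
proof -
  obtain C r where "\<And>x. norm (F x) \<le> C" "\<And>x. norm (grad F x) \<le> C" "\<And>x. r < norm x \<Longrightarrow> F x = 0"
    by (rule Cinf_cE[OF F]) blast
  then have "\<exists>C. \<forall>n::nat. \<forall>x. \<bar>F x\<bar> \<le> C \<and> norm (grad F x) \<le> C"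
    "\<exists>r. \<forall>n::nat. \<forall>x. r < norm x \<longrightarrow> F x = 0"
    unfolding real_norm_def by blast+
  then show ?thesis
    unfolding approximates_def using F tgrad_smooth_measurable[OF F] by simp
qed

lemma approximates_add:
  assumes F: "approximates F f w" and G: "approximates G g z"
  shows "approximates (\<lambda>n x. F n x + G n x) (\<lambda>x. f x + g x) (\<lambda>x. w x + z x)"
proof -
  obtain C r where F1: "\<And>n. F n \<in> Cinf_c" "\<And>n x. \<bar>F n x\<bar> \<le> C" "\<And>n x. norm (grad (F n) x) \<le> C"
      "\<And>n x. r < norm x \<Longrightarrow> F n x = 0"
    and F2: "\<And>x. (\<lambda>n. F n x) \<longlonglongrightarrow> f x" and [measurable]: "w \<in> borel_measurable \<mu>"
    and F3: "AE x in \<mu>. (\<lambda>n. tgrad_smooth \<mu> (F n) x) \<longlonglongrightarrow> w x"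
    using F unfolding approximates_def by blast
  obtain D s where G1: "\<And>n. G n \<in> Cinf_c" "\<And>n x. \<bar>G n x\<bar> \<le> D" "\<And>n x. norm (grad (G n) x) \<le> D"
      "\<And>n x. s < norm x \<Longrightarrow> G n x = 0"
    and G2: "\<And>x. (\<lambda>n. G n x) \<longlonglongrightarrow> g x" and [measurable]: "z \<in> borel_measurable \<mu>"
    and G3: "AE x in \<mu>. (\<lambda>n. tgrad_smooth \<mu> (G n) x) \<longlonglongrightarrow> z x"
    using G unfolding approximates_def by blast
  show ?thesis
    unfolding approximates_def
  proof (intro conjI allI)
    show "(\<lambda>x. F n x + G n x) \<in> Cinf_c" for n by (rule Cinf_c_add[OF F1(1) G1(1)])
    have "\<bar>F n x + G n x\<bar> \<le> C + D" for n x
      using F1(2)[of n x] G1(2)[of n x] by linarith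
    moreover have "norm (grad (\<lambda>x. F n x + G n x) x) \<le> C + D" for n x
      unfolding grad_add[OF F1(1) G1(1)] by (rule norm_triangle_mono[OF F1(3) G1(3)])
    ultimately show "\<exists>C. \<forall>n x. \<bar>F n x + G n x\<bar> \<le> C \<and> norm (grad (\<lambda>x. F n x + G n x) x) \<le> C" by blast
    show "\<exists>r. \<forall>n x. r < norm x \<longrightarrow> F n x + G n x = 0"
      by (rule exI[of _ "max r s"]) (simp add: F1(4) G1(4))
    show "(\<lambda>n. F n x + G n x) \<longlonglongrightarrow> f x + g x" for x by (intro tendsto_add F2 G2)
    show "AE x in \<mu>. (\<lambda>n. tgrad_smooth \<mu> (\<lambda>x. F n x + G n x) x) \<longlonglongrightarrow> w x + z x"
      using F3 G3
    proof eventually_elim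
      case (elim x)
      then show ?case unfolding tgrad_smooth_add[OF F1(1) G1(1)] by (rule tendsto_add)
    qed
  qed measurable
qed

lemma approximates_mult:
  assumes F: "approximates F f w" and G: "approximates G g z"
  shows "approximates (\<lambda>n x. F n x * G n x) (\<lambda>x. f x * g x) (\<lambda>x. f x *\<^sub>R z x + g x *\<^sub>R w x)"
proof -
  obtain C r where F1: "\<And>n. F n \<in> Cinf_c" "\<And>n x. \<bar>F n x\<bar> \<le> C" "\<And>n x. norm (grad (F n) x) \<le> C"
      "\<And>n x. r < norm x \<Longrightarrow> F n x = 0"
    and F2: "\<And>x. (\<lambda>n. F n x) \<longlonglongrightarrow> f x" and [measurable]: "w \<in> borel_measurable \<mu>"
    and F3: "AE x in \<mu>. (\<lambda>n. tgrad_smooth \<mu> (F n) x) \<longlonglongrightarrow> w x"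
    using F unfolding approximates_def by blast
  obtain D s where G1: "\<And>n. G n \<in> Cinf_c" "\<And>n x. \<bar>G n x\<bar> \<le> D" "\<And>n x. norm (grad (G n) x) \<le> D"
      "\<And>n x. s < norm x \<Longrightarrow> G n x = 0"
    and G2: "\<And>x. (\<lambda>n. G n x) \<longlonglongrightarrow> g x" and [measurable]: "z \<in> borel_measurable \<mu>"
    and G3: "AE x in \<mu>. (\<lambda>n. tgrad_smooth \<mu> (G n) x) \<longlonglongrightarrow> z x"
    using G unfolding approximates_def by blast
  have C0: "0 \<le> C" using order_trans[OF abs_ge_zero F1(2)] .
  have D0: "0 \<le> D" using order_trans[OF abs_ge_zero G1(2)] .
  have [measurable]: "F n \<in> borel_measurable \<mu>" "G n \<in> borel_measurable \<mu>" for n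
    by (rule Cinf_c_measurable[OF F1(1)], rule Cinf_c_measurable[OF G1(1)])
  have [measurable]: "f \<in> borel_measurable \<mu>" "g \<in> borel_measurable \<mu>"
    by (rule borel_measurable_LIMSEQ_real[OF F2], measurable,
        rule borel_measurable_LIMSEQ_real[OF G2], measurable)
  show ?thesis
    unfolding approximates_def
  proof (intro conjI allI)
    show "(\<lambda>x. F n x * G n x) \<in> Cinf_c" for n by (rule Cinf_c_mult[OF F1(1) G1(1)])
    have "\<bar>F n x * G n x\<bar> \<le> C * D + D * C" for n x
    proof -
      have "\<bar>F n x * G n x\<bar> \<le> C * D"
        unfolding abs_mult by (intro mult_mono F1(2) G1(2) C0) simp
      then show ?thesis using mult_nonneg_nonneg[OF D0 C0] by linarith
    qed
    moreover have "norm (grad (\<lambda>x. F n x * G n x) x) \<le> C * D + D * C" for n x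
      unfolding grad_mult[OF F1(1) G1(1)]
    proof (rule norm_triangle_mono)
      show "norm (F n x *\<^sub>R grad (G n) x) \<le> C * D"
        unfolding norm_scaleR by (intro mult_mono F1(2) G1(3) C0) simp
      show "norm (G n x *\<^sub>R grad (F n) x) \<le> D * C"
        unfolding norm_scaleR by (intro mult_mono F1(3) G1(2) D0) simp
    qed
    ultimately show "\<exists>C. \<forall>n x. \<bar>F n x * G n x\<bar> \<le> C \<and> norm (grad (\<lambda>x. F n x * G n x) x) \<le> C" by blast
    show "\<exists>r. \<forall>n x. r < norm x \<longrightarrow> F n x * G n x = 0"
      by (rule exI[of _ r]) (simp add: F1(4))
    show "(\<lambda>n. F n x * G n x) \<longlonglongrightarrow> f x * g x" for x by (intro tendsto_mult F2 G2)
    show "AE x in \<mu>. (\<lambda>n. tgrad_smooth \<mu> (\<lambda>x. F n x * G n x) x) \<longlonglongrightarrow> f x *\<^sub>R z x + g x *\<^sub>R w x"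
      using F3 G3
    proof eventually_elim
      case (elim x)
      then show ?case
        unfolding tgrad_smooth_mult[OF F1(1) G1(1)] by (intro tendsto_add tendsto_scaleR F2 G2)
    qed
  qed measurable
qed

lemma approximates_cmult:
  assumes F: "approximates F f w"
  shows "approximates (\<lambda>n x. c * F n x) (\<lambda>x. c * f x) (\<lambda>x. c *\<^sub>R w x)"
proof -
  obtain C r where F1: "\<And>n. F n \<in> Cinf_c" "\<And>n x. \<bar>F n x\<bar> \<le> C" "\<And>n x. norm (grad (F n) x) \<le> C"
      "\<And>n x. r < norm x \<Longrightarrow> F n x = 0"
    and F2: "\<And>x. (\<lambda>n. F n x) \<longlonglongrightarrow> f x" and [measurable]: "w \<in> borel_measurable \<mu>"
    and F3: "AE x in \<mu>. (\<lambda>n. tgrad_smooth \<mu> (F n) x) \<longlonglongrightarrow> w x"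
    using F unfolding approximates_def by blast
  show ?thesis
    unfolding approximates_def
  proof (intro conjI allI)
    show "(\<lambda>x. c * F n x) \<in> Cinf_c" for n by (rule Cinf_c_cmult[OF F1(1)])
    have "\<bar>c * F n x\<bar> \<le> \<bar>c\<bar> * C \<and> norm (grad (\<lambda>x. c * F n x) x) \<le> \<bar>c\<bar> * C" for n x
      unfolding grad_cmult[OF F1(1)] abs_mult norm_scaleR by (intro conjI mult_left_mono F1(2,3)) auto
    then show "\<exists>C. \<forall>n x. \<bar>c * F n x\<bar> \<le> C \<and> norm (grad (\<lambda>x. c * F n x) x) \<le> C" by blast
    show "\<exists>r. \<forall>n x. r < norm x \<longrightarrow> c * F n x = 0"
      by (rule exI[of _ r]) (simp add: F1(4))
    show "(\<lambda>n. c * F n x) \<longlonglongrightarrow> c * f x" for x by (intro tendsto_mult tendsto_const F2)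
    show "AE x in \<mu>. (\<lambda>n. tgrad_smooth \<mu> (\<lambda>x. c * F n x) x) \<longlonglongrightarrow> c *\<^sub>R w x"
      using F3
    proof eventually_elim
      case (elim x)
      then show ?case
        unfolding tgrad_smooth_cmult[OF F1(1)] by (intro tendsto_scaleR tendsto_const)
    qed
  qed measurable
qed

section \<open>Existence of the tangential gradient of a Lipschitz function\<close>

text \<open>The Hilbert space argument for projection onto convex sets, stripped of the space:
  \<open>E\<close> is a squared norm, \<open>Q\<close> a squared distance, and \<open>H\<close>
  plays the midpoint. The infima of \<open>E\<close> over the shrinking sets increase and are
  bounded by \<open>B\<close>, hence converge, and this makes near-minimisers Cauchy.\<close>

lemma parallelogram_minimising:
  fixes A :: "nat \<Rightarrow> 'c set" and E :: "'c \<Rightarrow> real" and Q :: "'c \<Rightarrow> 'c \<Rightarrow> real"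
  assumes ne: "\<And>n. A n \<noteq> {}" and dec: "\<And>m n. m \<le> n \<Longrightarrow> A n \<subseteq> A m"
    and bd: "\<And>n F. F \<in> A n \<Longrightarrow> 0 \<le> E F \<and> E F \<le> B"
    and par: "\<And>n F G. F \<in> A n \<Longrightarrow> G \<in> A n \<Longrightarrow> \<exists>H\<in>A n. Q F G = 2 * E F + 2 * E G - 4 * E H"
  obtains F where "\<And>n. F n \<in> A n"
    "\<And>e. 0 < e \<Longrightarrow> \<exists>N. \<forall>n\<ge>N. \<forall>m\<ge>n. Q (F n) (F m) < e"
proof -
  define I where "I = (\<lambda>n. INF F\<in>A n. E F)"
  have bdd: "bdd_below (E ` A n)" for n by (rule bdd_belowI[of _ 0]) (use bd in auto)
  have I_le: "I n \<le> E F" if "F \<in> A n" for n F unfolding I_def by (rule cINF_lower[OF bdd that])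
  have I_mono: "I m \<le> I n" if "m \<le> n" for m n
    unfolding I_def using dec[OF that] by (intro cINF_superset_mono ne bdd) auto
  have "I n \<le> B" for n
  proof -
    obtain F where "F \<in> A n" using ne by blast
    then show ?thesis using I_le bd by fastforce
  qed
  then have "bdd_above (range I)" by (intro bdd_aboveI[of _ B]) auto
  then have conv: "convergent I"
    using I_mono by (intro convergentI[OF LIMSEQ_incseq_SUP]) (auto simp: incseq_def)
  have "\<exists>F. F \<in> A n \<and> E F < I n + inverse (real (Suc n))" for n
    using cINF_less_iff[OF ne bdd, of n "I n + inverse (real (Suc n))"] by (auto simp: I_def)
  then obtain F where F: "\<And>n. F n \<in> A n" "\<And>n. E (F n) < I n + inverse (real (Suc n))" by metis
  \<comment> \<open>Since \<open>A\<close> decreases, \<open>F m\<close> also lies in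
    \<open>A n\<close>, so the midpoint has energy at least \<open>I n\<close>. The errors 1/(n+1)
    and 1/(m+1), each counted twice, are absorbed in 4/(n+1).\<close>
  have Q: "Q (F n) (F m) < 2 * \<bar>I m - I n\<bar> + 4 * inverse (real (Suc n))" if "n \<le> m" for n m
  proof -
    have "F m \<in> A n" using F(1)[of m] dec[OF that] by auto
    then obtain H where H: "H \<in> A n" "Q (F n) (F m) = 2 * E (F n) + 2 * E (F m) - 4 * E H"
      using par[OF F(1)] by blast
    have "inverse (real (Suc m)) \<le> inverse (real (Suc n))" using that by simp
    moreover have "q < 2 * \<bar>x - y\<bar> + 4 * c"
      if "d \<le> c" "q = 2 * a + 2 * b - 4 * h" "y \<le> h" "a < y + c" "b < x + d" for q a b h x y c d :: real
    proof -
      have "q < 2 * (x - y) + 4 * c" using that by simp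
      then show ?thesis using abs_ge_self[of "x - y"] by simp
    qed
    ultimately show ?thesis using H(2) I_le[OF H(1)] F(2)[of n] F(2)[of m] by blast
  qed
  show thesis
  proof (rule that[OF F(1)])
    fix e :: real assume "e > 0"
    \<comment> \<open>The shares fit the estimate for \<open>Q\<close>: twice e/4 for the infima
      plus four times e/8 for the errors is \<open>e\<close>.\<close>
    then have e4: "e / 4 > 0" "e / 8 > 0" by auto
    have "Cauchy I" using conv by (rule convergent_Cauchy)
    then obtain N where N: "\<And>m n. m \<ge> N \<Longrightarrow> n \<ge> N \<Longrightarrow> dist (I m) (I n) < e / 4"
      using e4(1) unfolding Cauchy_def by blast
    obtain M where M: "inverse (real (Suc M)) < e / 8" using reals_Archimedean[OF e4(2)] by blast
    show "\<exists>N. \<forall>n\<ge>N. \<forall>m\<ge>n. Q (F n) (F m) < e"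
    proof (intro exI allI impI)
      fix n m assume n: "max M N \<le> n" and m: "n \<le> m"
      have "inverse (real (Suc n)) \<le> inverse (real (Suc M))" using n by simp
      moreover have "\<bar>I m - I n\<bar> < e / 4" using N[of m n] n m by (simp add: dist_real_def)
      moreover have "q < e" if "q < 2 * a + 4 * t" "a < e / 4" "t \<le> u" "u < e / 8" for q a t u
        using that by argo
      ultimately show "Q (F n) (F m) < e" using Q[OF m] M by blast
    qed
  qed
qed

lemma integrable_tgrad_smooth_norm_sq:
  assumes F: "F \<in> Cinf_c" and G: "G \<in> Cinf_c"
  shows "integrable \<mu> (\<lambda>x. tgrad_smooth \<mu> F x \<bullet> tgrad_smooth \<mu> G x)"
proof -
  obtain C r where C: "\<And>x. norm (grad F x) \<le> C" "\<And>x. r < norm x \<Longrightarrow> grad F x = 0"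
    by (rule Cinf_cE[OF F]) blast
  obtain D where D: "\<And>x. norm (grad G x) \<le> D" by (rule Cinf_cE[OF G]) blast
  have [measurable]: "tgrad_smooth \<mu> F \<in> borel_measurable \<mu>" "tgrad_smooth \<mu> G \<in> borel_measurable \<mu>"
    using F G by (auto intro: tgrad_smooth_measurable)
  have "norm (tgrad_smooth \<mu> F x \<bullet> tgrad_smooth \<mu> G x) \<le> C * D" for x
  proof -
    have "norm (tgrad_smooth \<mu> F x \<bullet> tgrad_smooth \<mu> G x) \<le> norm (tgrad_smooth \<mu> F x) * norm (tgrad_smooth \<mu> G x)"
      using Cauchy_Schwarz_ineq2 by simp
    also have "\<dots> \<le> C * D"
      using order_trans[OF norm_tgrad_smooth_le C(1)] order_trans[OF norm_tgrad_smooth_le D]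
        order_trans[OF norm_ge_zero C(1)]
      by (intro mult_mono) auto
    finally show ?thesis .
  qed
  moreover have "tgrad_smooth \<mu> F x \<bullet> tgrad_smooth \<mu> G x = 0" if "r < norm x" for x
    using norm_tgrad_smooth_le[of F x] C(2)[OF that] by simp
  ultimately show ?thesis
    by (intro integrable_bounded_support[where C = "C * D" and r = r]) auto
qed

text \<open>The bound by \<open>lip_a\<close> comes from the pointwise constraint on the gradients,
  which every competitor satisfies. The energy only selects a sequence whose tangential gradients
  converge.\<close>

lemma LIPc_approximates:
  assumes f: "f \<in> LIPc"
  obtains F w where "approximates F f w" "AE x in \<mu>. norm (w x) \<le> lip_a f x"
proof -
  obtain L C r where L: "L-lipschitz_on UNIV f" and C: "C > 0" "\<And>x. norm (f x) \<le> C"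
    and r: "r > 0" "\<And>x. r < norm x \<Longrightarrow> f x = 0"
    by (rule LIPcE[OF f]) blast
  have L0: "0 \<le> L" using L by (rule lipschitz_on_nonneg)
  define e where "e = (\<lambda>n. inverse (real (Suc n)))"
  have e: "0 < e n" "e n \<le> 1" for n by (auto simp: e_def inverse_le_1_iff)
  have e_mono: "e n \<le> e m" if "m \<le> n" for m n using that by (simp add: e_def)
  have e_lim: "e \<longlonglongrightarrow> 0" unfolding e_def by (rule LIMSEQ_inverse_real_of_nat)
  \<comment> \<open>Each constraint is what mollification at scale \<open>e n\<close> achieves: the
    values move by at most \<open>L * e n\<close>, the support grows by at most \<open>e n\<close>,
    which is at most 1, and radius \<open>2 * e n\<close> is \<open>LIPc_mollification\<close> with
    its free radius equal to \<open>e n\<close>. All constraints are convex in \<open>F\<close> and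
    tighten with \<open>n\<close>.\<close>
  define A where "A = (\<lambda>n. {F \<in> Cinf_c. (\<forall>x. \<bar>F x - f x\<bar> \<le> L * e n) \<and> (\<forall>x. r + 1 < norm x \<longrightarrow> F x = 0) \<and>
    (\<forall>x. norm (grad F x) \<le> Lip f (ball x (2 * e n)))})"
  define E where "E = (\<lambda>F. \<integral>x. tgrad_smooth \<mu> F x \<bullet> tgrad_smooth \<mu> F x \<partial>\<mu>)"
  define Q where "Q = (\<lambda>F G. \<integral>x. (norm (tgrad_smooth \<mu> F x - tgrad_smooth \<mu> G x))\<^sup>2 \<partial>\<mu>)"
  define B where "B = (\<integral>x. indicator (cball 0 (r + 1)) x * L\<^sup>2 \<partial>\<mu>)"
  have Lip_L: "Lip f S \<le> L" for S by (rule Lip_le[OF lipschitz_on_subset[OF L]]) simp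
  have grad_L: "norm (grad F x) \<le> L" if "F \<in> A n" for F n x
    using that Lip_L[of "ball x (2 * e n)"] order_trans by (fastforce simp: A_def)
  have K: "integrable \<mu> (\<lambda>x. indicator (cball 0 (r + 1)) x * c)" for c :: real
    using emeasure_compact_finite[OF compact_cball, of 0 "r + 1"]
    by (intro integrable_mult_left integrable_real_indicator) (auto simp: sets_\<mu>)
  have t_bound: "norm (tgrad_smooth \<mu> F x) \<le> L" if "F \<in> A n" for F n x
    by (rule order_trans[OF norm_tgrad_smooth_le grad_L[OF that]])
  have t_supp: "tgrad_smooth \<mu> F x = 0" if "F \<in> A n" "r + 1 < norm x" for F n x
  proof -
    have "grad F x = 0" by (rule grad_eq_0_outside[of "r + 1"]) (use that in \<open>auto simp: A_def\<close>)
    then show ?thesis using norm_tgrad_smooth_le[of F x] by simp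
  qed
  have ne: "A n \<noteq> {}" for n
  proof -
    obtain F where F: "F \<in> Cinf_c"
      "\<And>x a b. (\<And>y. dist x y < e n \<Longrightarrow> a \<le> f y \<and> f y \<le> b) \<Longrightarrow> a \<le> F x \<and> F x \<le> b"
      "\<And>x r M. 0 < r \<Longrightarrow> M-lipschitz_on (ball x (r + e n)) f \<Longrightarrow> norm (grad F x) \<le> M"
      by (rule LIPc_mollification[OF f e(1)[of n]]) blast
    have "\<bar>F x - f x\<bar> \<le> L * e n" for x
    proof -
      have "f x - L * e n \<le> F x \<and> F x \<le> f x + L * e n"
      proof (rule F(2))
        fix y assume y: "dist x y < e n"
        have "\<bar>f x - f y\<bar> \<le> L * dist x y" using lipschitz_onD[OF L, of x y] by (simp add: dist_real_def)
        also have "\<dots> \<le> L * e n" using y L0 by (intro mult_left_mono) auto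
        finally show "f x - L * e n \<le> f y \<and> f y \<le> f x + L * e n" by linarith
      qed
      then show ?thesis by linarith
    qed
    moreover have "F x = 0" if x: "r + 1 < norm x" for x
    proof -
      have "0 \<le> F x \<and> F x \<le> 0"
      proof (rule F(2))
        fix y assume y: "dist x y < e n"
        have "norm x \<le> norm y + dist x y" using norm_triangle_sub[of x y] by (simp add: dist_norm)
        then have "r < norm y" using x y e(2)[of n] by linarith
        then show "0 \<le> f y \<and> f y \<le> 0" using r(2) by simp
      qed
      then show ?thesis by simp
    qed
    moreover have "norm (grad F x) \<le> Lip f (ball x (2 * e n))" for x
    proof (rule F(3)[OF e(1)[of n]])
      have "(Lip f (ball x (2 * e n)))-lipschitz_on (ball x (2 * e n)) f"
        by (rule lipschitz_on_Lip[OF lipschitz_on_subset[OF L subset_UNIV]])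
      then show "(Lip f (ball x (2 * e n)))-lipschitz_on (ball x (e n + e n)) f" by simp
    qed
    ultimately have "F \<in> A n" using F(1) by (simp add: A_def)
    then show ?thesis by blast
  qed
  have dec: "A n \<subseteq> A m" if "m \<le> n" for m n
  proof
    fix F assume F: "F \<in> A n"
    have "L * e n \<le> L * e m" using e_mono[OF that] L0 by (rule mult_left_mono)
    moreover have "Lip f (ball x (2 * e n)) \<le> Lip f (ball x (2 * e m))" for x
      using e_mono[OF that] by (intro Lip_mono[OF lipschitz_on_subset[OF L subset_UNIV]] subset_ball) simp
    ultimately show "F \<in> A m" using F unfolding A_def by (auto intro: order_trans)
  qed
  have bd: "0 \<le> E F \<and> E F \<le> B" if F: "F \<in> A n" for n F
  proof
    show "0 \<le> E F" unfolding E_def by (intro Bochner_Integration.integral_nonneg) simp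
    show "E F \<le> B"
      unfolding E_def B_def
    proof (rule integral_mono[OF _ K])
      show "integrable \<mu> (\<lambda>x. tgrad_smooth \<mu> F x \<bullet> tgrad_smooth \<mu> F x)"
        using F by (intro integrable_tgrad_smooth_norm_sq) (auto simp: A_def)
      show "tgrad_smooth \<mu> F x \<bullet> tgrad_smooth \<mu> F x \<le> indicator (cball 0 (r + 1)) x * L\<^sup>2" for x
      proof (cases "norm x \<le> r + 1")
        case True
        then show ?thesis using power_mono[OF t_bound[OF F, of x], of 2] by (simp add: dot_square_norm)
      qed (use t_supp[OF F] in auto)
    qed
  qed
  have par: "\<exists>H\<in>A n. Q F G = 2 * E F + 2 * E G - 4 * E H" if F: "F \<in> A n" and G: "G \<in> A n" for n F G
  proof -
    have Fc: "F \<in> Cinf_c" and Gc: "G \<in> Cinf_c" using F G by (auto simp: A_def)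
    define H where "H = (\<lambda>x. (1 / 2) * F x + (1 / 2) * G x)"
    have Hc: "H \<in> Cinf_c" unfolding H_def by (intro Cinf_c_add Cinf_c_cmult Fc Gc)
    have "\<bar>H x - f x\<bar> \<le> L * e n" for x
    proof -
      have "\<bar>F x - f x\<bar> \<le> L * e n" "\<bar>G x - f x\<bar> \<le> L * e n" using F G by (auto simp: A_def)
      then show ?thesis unfolding H_def by linarith
    qed
    moreover have "H x = 0" if "r + 1 < norm x" for x using F G that by (auto simp: A_def H_def)
    moreover have "norm (grad H x) \<le> Lip f (ball x (2 * e n))" for x
    proof -
      have "grad H x = (1 / 2) *\<^sub>R grad F x + (1 / 2) *\<^sub>R grad G x"
        unfolding H_def grad_add[OF Cinf_c_cmult[OF Fc] Cinf_c_cmult[OF Gc]]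
          grad_cmult[OF Fc] grad_cmult[OF Gc] ..
      then have "norm (grad H x) \<le> (1 / 2) * norm (grad F x) + (1 / 2) * norm (grad G x)"
        using norm_triangle_ineq[of "(1 / 2) *\<^sub>R grad F x" "(1 / 2) *\<^sub>R grad G x"] by simp
      moreover have "norm (grad F x) \<le> Lip f (ball x (2 * e n))" "norm (grad G x) \<le> Lip f (ball x (2 * e n))"
        using F G by (auto simp: A_def)
      ultimately show ?thesis by linarith
    qed
    ultimately have "H \<in> A n" using Hc by (simp add: A_def)
    moreover have "Q F G = 2 * E F + 2 * E G - 4 * E H"
    proof -
      have tH: "tgrad_smooth \<mu> H x = (1 / 2) *\<^sub>R tgrad_smooth \<mu> F x + (1 / 2) *\<^sub>R tgrad_smooth \<mu> G x" for x
        unfolding H_def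
          tgrad_smooth_add[OF Cinf_c_cmult[OF Fc] Cinf_c_cmult[OF Gc]]
          tgrad_smooth_cmult[OF Fc] tgrad_smooth_cmult[OF Gc] ..
      \<comment> \<open>The parallelogram law, written with the midpoint so that the last term is
        the energy of \<open>H\<close>.\<close>
      have pl: "(norm (a - b))\<^sup>2 = (2 * (a \<bullet> a) + 2 * (b \<bullet> b))
          - 4 * (((1 / 2) *\<^sub>R a + (1 / 2) *\<^sub>R b) \<bullet> ((1 / 2) *\<^sub>R a + (1 / 2) *\<^sub>R b))" for a b :: 'a
        unfolding power2_norm_eq_inner
        by (simp add: inner_diff_left inner_diff_right inner_add_left inner_add_right inner_commute[of b a] add_divide_distrib)
      have "Q F G = (\<integral>x. (2 * (tgrad_smooth \<mu> F x \<bullet> tgrad_smooth \<mu> F x) + 2 * (tgrad_smooth \<mu> G x \<bullet> tgrad_smooth \<mu> G x))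
          - 4 * (tgrad_smooth \<mu> H x \<bullet> tgrad_smooth \<mu> H x) \<partial>\<mu>)"
        unfolding Q_def tH pl ..
      then show ?thesis
        unfolding E_def using integrable_tgrad_smooth_norm_sq[OF Fc Fc]
          integrable_tgrad_smooth_norm_sq[OF Gc Gc] integrable_tgrad_smooth_norm_sq[OF Hc Hc]
        by simp
    qed
    ultimately show ?thesis by blast
  qed
  obtain F where FA: "\<And>n. F n \<in> A n"
    and FQ: "\<And>e. 0 < e \<Longrightarrow> \<exists>N. \<forall>n\<ge>N. \<forall>m\<ge>n. Q (F n) (F m) < e"
    by (rule parallelogram_minimising[of A E B Q, OF ne dec bd par]) blast+
  have Fc: "F n \<in> Cinf_c" for n using FA[of n] by (simp add: A_def)
  have [measurable]: "tgrad_smooth \<mu> (F n) \<in> borel_measurable \<mu>" for n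
    by (rule tgrad_smooth_measurable[OF Fc])
  have tint: "integrable \<mu> (tgrad_smooth \<mu> (F n))" for n
    by (rule integrable_bounded_support[where C = L and r = "r + 1"])
      (use t_bound[OF FA] t_supp[OF FA] in auto)
  have Q_sym: "Q G H = Q H G" for G H unfolding Q_def by (simp add: norm_minus_commute)
  \<comment> \<open>From quadratic to linear control without Hoelder:
    \<open>t \<le> \<delta> + t\<^sup>2 / \<delta>\<close> for nonnegative \<open>t\<close>, used on
    the ball that carries both gradients.\<close>
  have L1: "(\<integral>x. norm (tgrad_smooth \<mu> (F n) x - tgrad_smooth \<mu> (F m) x) \<partial>\<mu>)
      \<le> \<delta> * (\<integral>x. indicator (cball 0 (r + 1)) x \<partial>\<mu>) + Q (F n) (F m) / \<delta>" if \<delta>: "\<delta> > 0" for n m \<delta>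
  proof -
    let ?u = "\<lambda>x. tgrad_smooth \<mu> (F n) x - tgrad_smooth \<mu> (F m) x"
    have i: "integrable \<mu> (\<lambda>x. (norm (?u x))\<^sup>2)"
    proof (rule integrable_bounded_support[where C = "(2 * L)\<^sup>2" and r = "r + 1"])
      have u: "norm (?u x) \<le> 2 * L" for x
        using norm_triangle_ineq4[of "tgrad_smooth \<mu> (F n) x" "tgrad_smooth \<mu> (F m) x"]
          t_bound[OF FA, of n x] t_bound[OF FA, of m x] by linarith
      show "AE x in \<mu>. norm ((norm (?u x))\<^sup>2) \<le> (2 * L)\<^sup>2"
      proof (intro always_eventually allI)
        fix x
        have "(norm (?u x))\<^sup>2 \<le> (2 * L)\<^sup>2" by (rule power_mono[OF u]) simp
        then show "norm ((norm (?u x))\<^sup>2) \<le> (2 * L)\<^sup>2" by (simp del: power_mult_distrib)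
      qed
    qed (use t_supp[OF FA] in auto)
    have "(\<integral>x. norm (?u x) \<partial>\<mu>) \<le> (\<integral>x. indicator (cball 0 (r + 1)) x * \<delta> + (norm (?u x))\<^sup>2 / \<delta> \<partial>\<mu>)"
    proof (rule integral_mono)
      show "integrable \<mu> (\<lambda>x. norm (?u x))" using tint by simp
      show "integrable \<mu> (\<lambda>x. indicator (cball 0 (r + 1)) x * \<delta> + (norm (?u x))\<^sup>2 / \<delta>)"
        using K[of \<delta>] i by simp
      show "norm (?u x) \<le> indicator (cball 0 (r + 1)) x * \<delta> + (norm (?u x))\<^sup>2 / \<delta>" for x
      proof (cases "norm x \<le> r + 1")
        case True
        have "t \<le> \<delta> + t\<^sup>2 / \<delta>" if "0 \<le> t" for t :: real
        proof (cases "t \<le> \<delta>")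
          case True
          then show ?thesis using \<delta> by (simp add: add_increasing2)
        next
          case False
          then have "t * \<delta> \<le> t * t" using that by (intro mult_left_mono) auto
          then have "t \<le> t\<^sup>2 / \<delta>" using \<delta> by (simp add: pos_le_divide_eq power2_eq_square)
          then show ?thesis using \<delta> by simp
        qed
        from this[of "norm (?u x)"] show ?thesis using True by simp
      qed (use t_supp[OF FA] in auto)
    qed
    also have "\<dots> = \<delta> * (\<integral>x. indicator (cball 0 (r + 1)) x \<partial>\<mu>) + Q (F n) (F m) / \<delta>"
      unfolding Q_def using K[of \<delta>] i by simp
    finally show ?thesis .
  qed
  have cauchy: "\<exists>N. \<forall>i\<ge>N. \<forall>j\<ge>N. (\<integral>x. norm (tgrad_smooth \<mu> (F i) x - tgrad_smooth \<mu> (F j) x) \<partial>\<mu>) < \<epsilon>"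
    if \<epsilon>: "\<epsilon> > 0" for \<epsilon>
  proof -
    \<comment> \<open>Adding 1 keeps \<open>k\<close> positive even if the ball is a null set, so
      that the division defining \<delta> is harmless.\<close>
    define k where "k = (\<integral>x. indicator (cball 0 (r + 1)) x \<partial>\<mu>) + (1::real)"
    have k: "k \<ge> 1" unfolding k_def by simp
    define \<delta> where "\<delta> = \<epsilon> / (2 * k)"
    have \<delta>: "\<delta> > 0" using \<epsilon> k by (simp add: \<delta>_def)
    have dk: "\<delta> * k = \<epsilon> / 2" using k by (simp add: \<delta>_def)
    obtain N where N: "\<And>n m. N \<le> n \<Longrightarrow> n \<le> m \<Longrightarrow> Q (F n) (F m) < \<delta> * (\<epsilon> / 2)"
      using FQ[of "\<delta> * (\<epsilon> / 2)"] \<delta> \<epsilon> by auto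
    show ?thesis
    proof (intro exI allI impI)
      fix i j assume ij: "N \<le> i" "N \<le> j"
      have "Q (F i) (F j) < \<delta> * (\<epsilon> / 2)"
        using N[of i j] N[of j i] Q_sym[of "F i" "F j"] ij by (cases "i \<le> j") auto
      then have "Q (F i) (F j) / \<delta> < \<epsilon> / 2" using \<delta> by (simp add: pos_divide_less_eq mult.commute)
      moreover have "\<delta> * (\<integral>x. indicator (cball 0 (r + 1)) x \<partial>\<mu>) \<le> \<delta> * k"
        unfolding k_def using \<delta> by (intro mult_left_mono) auto
      ultimately show "(\<integral>x. norm (tgrad_smooth \<mu> (F i) x - tgrad_smooth \<mu> (F j) x) \<partial>\<mu>) < \<epsilon>"
        using L1[OF \<delta>, of i j] dk by linarith
    qed
  qed
  obtain s where s: "strict_mono s" and sC: "AE x in \<mu>. Cauchy (\<lambda>i. tgrad_smooth \<mu> (F (s i)) x)"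
    by (rule cauchy_L1_AE_cauchy_subseq[of \<mu> "\<lambda>n. tgrad_smooth \<mu> (F n)", OF tint cauchy]) blast+
  \<comment> \<open>\<open>lim\<close> is a total function, so \<open>w\<close> is measurable
    everywhere although the sequence converges only almost everywhere.\<close>
  define w where "w = (\<lambda>x. lim (\<lambda>i. tgrad_smooth \<mu> (F (s i)) x))"
  have lim: "AE x in \<mu>. (\<lambda>i. tgrad_smooth \<mu> (F (s i)) x) \<longlonglongrightarrow> w x"
    using sC by eventually_elim (simp add: w_def Cauchy_convergent convergent_LIMSEQ_iff[symmetric])
  have fc: "(\<lambda>n. F (s n) x) \<longlonglongrightarrow> f x" for x
  proof -
    have "(\<lambda>n. L * e (s n)) \<longlonglongrightarrow> L * 0"
      using LIMSEQ_subseq_LIMSEQ[OF e_lim s] by (intro tendsto_mult tendsto_const) (simp add: o_def)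
    then have z: "(\<lambda>n. L * e (s n)) \<longlonglongrightarrow> 0" by simp
    have "norm (F (s n) x - f x) \<le> L * e (s n)" for n using FA[of "s n"] by (simp add: A_def)
    then have "(\<lambda>n. F (s n) x - f x) \<longlonglongrightarrow> 0"
      by (intro Lim_null_comparison[OF _ z] always_eventually allI)
    then show ?thesis by (rule LIM_zero_cancel)
  qed
  have "approximates (\<lambda>n. F (s n)) f w"
    unfolding approximates_def
  proof (intro conjI allI lim fc)
    show "F (s n) \<in> Cinf_c" for n by (rule Fc)
    have "\<bar>F (s n) x\<bar> \<le> C + L \<and> norm (grad (F (s n)) x) \<le> C + L" for n x
    proof
      have "\<bar>F (s n) x - f x\<bar> \<le> L * e (s n)" using FA[of "s n"] by (simp add: A_def)
      also have "\<dots> \<le> L" using e[of "s n"] L0 by (simp add: mult_left_le)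
      finally show "\<bar>F (s n) x\<bar> \<le> C + L" using C(2)[of x] by simp
      show "norm (grad (F (s n)) x) \<le> C + L" using grad_L[OF FA, of "s n" x] C(1) by linarith
    qed
    then show "\<exists>C. \<forall>n x. \<bar>F (s n) x\<bar> \<le> C \<and> norm (grad (F (s n)) x) \<le> C" by blast
    show "\<exists>r. \<forall>n x. r < norm x \<longrightarrow> F (s n) x = 0"
      using FA by (intro exI[of _ "r + 1"]) (auto simp: A_def)
    show "w \<in> borel_measurable \<mu>" unfolding w_def by (rule borel_measurable_lim_metric) measurable
  qed
  moreover have "AE x in \<mu>. norm (w x) \<le> lip_a f x"
    using lim
  proof eventually_elim
    case (elim x)
    show ?case
    \<comment> \<open>For fixed \<open>t\<close> the balls of radius \<open>2 * e (s n)\<close>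
      eventually lie in the ball of radius \<open>t\<close>, so the limit inherits the bound by the
      Lipschitz constant there; then \<open>t\<close> is arbitrary.\<close>
    proof (rule lip_a_ge[OF f])
      fix t :: real assume t: "t > 0"
      have "(\<lambda>n. 2 * e (s n)) \<longlonglongrightarrow> 2 * 0"
        using LIMSEQ_subseq_LIMSEQ[OF e_lim s] by (intro tendsto_mult tendsto_const) (simp add: o_def)
      then have "\<forall>\<^sub>F n in sequentially. 2 * e (s n) < t" by (rule order_tendstoD(2)) (simp add: t)
      then have "\<forall>\<^sub>F n in sequentially. norm (tgrad_smooth \<mu> (F (s n)) x) \<le> Lip f (ball x t)"
      proof eventually_elim
        case (elim n)
        have "norm (tgrad_smooth \<mu> (F (s n)) x) \<le> norm (grad (F (s n)) x)" by (rule norm_tgrad_smooth_le)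
        also have "\<dots> \<le> Lip f (ball x (2 * e (s n)))" using FA[of "s n"] by (simp add: A_def)
        also have "\<dots> \<le> Lip f (ball x t)"
          using elim by (intro Lip_mono[OF lipschitz_on_subset[OF L subset_UNIV]] subset_ball) simp
        finally show ?case .
      qed
      then show "norm (w x) \<le> Lip f (ball x t)"
        by (rule tendsto_upperbound[OF tendsto_norm[OF elim]]) simp
    qed
  qed
  ultimately show thesis by (rule that)
qed

end

text \<open>Transfers an estimate from countably many directions, where one null set suffices, to a
  direction that depends on the point.\<close>

lemma dense_closed_UNIV:
  fixes D C :: "'a::topological_space set"
  assumes "\<And>X. open X \<Longrightarrow> X \<noteq> {} \<Longrightarrow> \<exists>d\<in>D. d \<in> X" "closed C" "D \<subseteq> C"
  shows "x \<in> C"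
  using assms(1)[of "- C"] assms(2,3) by (auto simp: open_Compl)

lemma lip_a_bounded:
  assumes "f \<in> LIPc"
  obtains L where "0 \<le> L" "\<And>x. lip_a f x \<le> L"
proof -
  obtain L where L: "L-lipschitz_on UNIV f" using assms by (auto simp: LIPc_def)
  have "lip_a f x \<le> L" for x
    by (rule lip_a_le[OF assms zero_less_one lipschitz_on_subset[OF L subset_UNIV]])
  then show thesis by (rule that[OF lipschitz_on_nonneg[OF L]])
qed

section \<open>The operator takes values in the derivations with bounded divergence\<close>

context radon
begin

text \<open>\<open>tgrad\<close> is a Hilbert choice and has no a priori relation to the limit built
  above. Closability makes both agree almost everywhere, so the choice inherits the approximation
  and the bound.\<close>

lemma LIPc_tgrad:
  assumes f: "f \<in> LIPc"
  shows LIPc_approximates_tgrad: "\<exists>F. approximates F f (tgrad \<mu> f)"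
    and norm_tgrad_le: "AE x in \<mu>. norm (tgrad \<mu> f x) \<le> lip_a f x"
    and LIPc_has_tgrad: "has_tgrad \<mu> f (tgrad \<mu> f)"
proof -
  obtain F w where F: "approximates F f w" and w: "AE x in \<mu>. norm (w x) \<le> lip_a f x"
    by (rule LIPc_approximates[OF f]) blast
  show t: "has_tgrad \<mu> f (tgrad \<mu> f)" by (rule tgrad_eq[OF approximates_has_tgrad[OF F]])
  have eq: "AE x in \<mu>. tgrad \<mu> f x = w x" by (rule approximates_tgrad[OF F])
  with w show "AE x in \<mu>. norm (tgrad \<mu> f x) \<le> lip_a f x" by eventually_elim simp
  have m: "tgrad \<mu> f \<in> borel_measurable \<mu>" using t by (auto simp: has_tgrad_def Gamma1_def)
  have "AE x in \<mu>. (\<lambda>n. tgrad_smooth \<mu> (F n) x) \<longlonglongrightarrow> w x" using F by (simp add: approximates_def)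
  with eq have "AE x in \<mu>. (\<lambda>n. tgrad_smooth \<mu> (F n) x) \<longlonglongrightarrow> tgrad \<mu> f x"
    by eventually_elim simp
  then show "\<exists>F. approximates F f (tgrad \<mu> f)"
    using F m by (intro exI[of _ F]) (simp add: approximates_def)
qed

lemma tgrad_Linfty:
  assumes f: "f \<in> LIPc"
  shows "tgrad \<mu> f \<in> Linfty \<mu>"
proof -
  obtain L where L: "\<And>x. lip_a f x \<le> L" by (rule lip_a_bounded[OF f]) blast
  have "AE x in \<mu>. norm (tgrad \<mu> f x) \<le> L"
    using norm_tgrad_le[OF f] by eventually_elim (rule order_trans[OF _ L])
  moreover have "tgrad \<mu> f \<in> borel_measurable \<mu>"
    using LIPc_has_tgrad[OF f] by (auto simp: has_tgrad_def Gamma1_def)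
  ultimately show ?thesis unfolding Linfty_def by blast
qed

text \<open>This rule and the two that follow hold for the approximating sequences; uniqueness of
  the tangential gradient carries them to the chosen representative.\<close>

lemma tgrad_add:
  assumes "f \<in> LIPc" "g \<in> LIPc"
  shows "AE x in \<mu>. tgrad \<mu> (\<lambda>x. f x + g x) x = tgrad \<mu> f x + tgrad \<mu> g x"
  using LIPc_approximates_tgrad[OF assms(1)] LIPc_approximates_tgrad[OF assms(2)]
  by (auto intro: approximates_tgrad approximates_add)

lemma tgrad_cmult:
  assumes "f \<in> LIPc"
  shows "AE x in \<mu>. tgrad \<mu> (\<lambda>x. c * f x) x = c *\<^sub>R tgrad \<mu> f x"
  using LIPc_approximates_tgrad[OF assms]
  by (auto intro: approximates_tgrad approximates_cmult)

lemma tgrad_mult: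
  assumes "f \<in> LIPc" "g \<in> LIPc"
  shows "AE x in \<mu>. tgrad \<mu> (\<lambda>x. f x * g x) x = f x *\<^sub>R tgrad \<mu> g x + g x *\<^sub>R tgrad \<mu> f x"
  using LIPc_approximates_tgrad[OF assms(1)] LIPc_approximates_tgrad[OF assms(2)]
  by (auto intro: approximates_tgrad approximates_mult)

text \<open>The constant sequence approximates a test function, and the tangency of \<open>v\<close>
  removes the projection.\<close>

lemma Phi_smooth:
  assumes v: "v \<in> D_infty \<mu>" and F: "F \<in> Cinf_c"
  shows "AE x in \<mu>. Phi \<mu> v F x = v x \<bullet> grad F x"
  using D_infty_in_T[OF v] approximates_tgrad[OF approximates_smooth[OF F]]
  by eventually_elim (simp add: Phi_def inner_tgrad_smooth)

lemma Phi_Linfty: "v \<in> D_infty \<mu> \<Longrightarrow> f \<in> LIPc \<Longrightarrow> Phi \<mu> v f \<in> Linfty \<mu>"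
  unfolding Phi_def by (intro Linfty_inner D_infty_Linfty tgrad_Linfty)

lemma der_bound_Phi:
  assumes v: "v \<in> D_infty \<mu>"
  shows "der_bound \<mu> (Phi \<mu> v) (\<lambda>x. norm (v x))"
  unfolding der_bound_def
proof (intro conjI ballI)
  have [measurable]: "v \<in> borel_measurable \<mu>" using D_infty_Linfty[OF v] by (rule Linfty_measurable)
  show "(\<lambda>x. norm (v x)) \<in> borel_measurable \<mu>" by measurable
  show "AE x in \<mu>. 0 \<le> norm (v x)" by simp
  fix f :: "'a \<Rightarrow> real" assume f: "f \<in> LIPc"
  show "AE x in \<mu>. \<bar>Phi \<mu> v f x\<bar> \<le> norm (v x) * lip_a f x"
    using norm_tgrad_le[OF f]
  proof eventually_elim
    case (elim x)
    have "\<bar>Phi \<mu> v f x\<bar> \<le> norm (v x) * norm (tgrad \<mu> f x)"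
      unfolding Phi_def by (rule Cauchy_Schwarz_ineq2)
    also have "\<dots> \<le> norm (v x) * lip_a f x" using elim by (intro mult_left_mono) auto
    finally show ?case .
  qed
qed

lemma is_derivation_Phi:
  assumes v: "v \<in> D_infty \<mu>"
  shows "is_derivation \<mu> (Phi \<mu> v)"
  unfolding is_derivation_def
proof (intro conjI ballI allI)
  fix f :: "'a \<Rightarrow> real" assume f: "f \<in> LIPc"
  show "Phi \<mu> v f \<in> borel_measurable \<mu>" by (rule Linfty_measurable[OF Phi_Linfty[OF v f]])
  show "AE x in \<mu>. Phi \<mu> v (\<lambda>y. c * f y) x = c * Phi \<mu> v f x" for c
    using tgrad_cmult[OF f, of c] by eventually_elim (simp add: Phi_def)
  fix g :: "'a \<Rightarrow> real" assume g: "g \<in> LIPc"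
  show "AE x in \<mu>. Phi \<mu> v (\<lambda>y. f y + g y) x = Phi \<mu> v f x + Phi \<mu> v g x"
    using tgrad_add[OF f g] by eventually_elim (simp add: Phi_def inner_add_right)
  show "AE x in \<mu>. Phi \<mu> v (\<lambda>y. f y * g y) x = Phi \<mu> v f x * g x + f x * Phi \<mu> v g x"
    using tgrad_mult[OF f g] by eventually_elim (simp add: Phi_def inner_add_right)
qed (use der_bound_Phi[OF v] in blast)

text \<open>The identity is required on Lipschitz functions but given on test functions only. Both
  of its sides are continuous for the convergence in \<open>has_tgrad\<close>, because
  \<open>v\<close> and \<open>g\<close> are bounded.\<close>

lemma has_der_div_Phi:
  assumes v: "v \<in> D_infty \<mu>" and g: "has_div_mu \<mu> v g"
  shows "has_der_div \<mu> (Phi \<mu> v) g"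
  unfolding has_der_div_def
proof (intro conjI ballI)
  show gL: "g \<in> Linfty \<mu>" using g by (simp add: has_div_mu_def)
  fix f :: "'a \<Rightarrow> real" assume f: "f \<in> LIPc"
  obtain F where F: "\<And>n. F n \<in> Cinf_c" "L1_tendsto \<mu> F f"
    "L1_tendsto \<mu> (\<lambda>n. tgrad_smooth \<mu> (F n)) (tgrad \<mu> f)"
    using LIPc_has_tgrad[OF f] by (auto simp: has_tgrad_def)
  have vL: "v \<in> Linfty \<mu>" by (rule D_infty_Linfty[OF v])
  have eq: "(\<integral>x. v x \<bullet> tgrad_smooth \<mu> (F n) x \<partial>\<mu>) = - (\<integral>x. g x \<bullet> F n x \<partial>\<mu>)" for n
  proof -
    have "(\<integral>x. v x \<bullet> tgrad_smooth \<mu> (F n) x \<partial>\<mu>) = (\<integral>x. grad (F n) x \<bullet> v x \<partial>\<mu>)"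
    proof (rule integral_cong_AE)
      have [measurable]: "v \<in> borel_measurable \<mu>" "grad (F n) \<in> borel_measurable \<mu>"
        "tgrad_smooth \<mu> (F n) \<in> borel_measurable \<mu>"
        using Linfty_measurable[OF vL] grad_measurable[OF F(1)] tgrad_smooth_measurable[OF F(1)] by auto
      show "(\<lambda>x. v x \<bullet> tgrad_smooth \<mu> (F n) x) \<in> borel_measurable \<mu>" by measurable
      show "(\<lambda>x. grad (F n) x \<bullet> v x) \<in> borel_measurable \<mu>" by measurable
      show "AE x in \<mu>. v x \<bullet> tgrad_smooth \<mu> (F n) x = grad (F n) x \<bullet> v x"
        using D_infty_in_T[OF v] by eventually_elim (simp add: inner_tgrad_smooth inner_commute)
    qed
    also have "\<dots> = - (\<integral>x. F n x * g x \<partial>\<mu>)" using g F(1) by (simp add: has_div_mu_def)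
    finally show ?thesis by (simp add: mult.commute)
  qed
  have "(\<lambda>n. \<integral>x. v x \<bullet> tgrad_smooth \<mu> (F n) x \<partial>\<mu>) \<longlonglongrightarrow> (\<integral>x. v x \<bullet> tgrad \<mu> f x \<partial>\<mu>)"
    by (rule L1_tendsto_integral[OF vL F(3)])
  moreover have "(\<lambda>n. \<integral>x. v x \<bullet> tgrad_smooth \<mu> (F n) x \<partial>\<mu>) \<longlonglongrightarrow> - (\<integral>x. g x \<bullet> f x \<partial>\<mu>)"
    unfolding eq by (intro tendsto_minus L1_tendsto_integral[OF gL F(2)])
  ultimately have "(\<integral>x. v x \<bullet> tgrad \<mu> f x \<partial>\<mu>) = - (\<integral>x. g x \<bullet> f x \<partial>\<mu>)" by (rule LIMSEQ_unique)
  then show "(\<integral>x. Phi \<mu> v f x \<partial>\<mu>) = - (\<integral>x. f x * g x \<partial>\<mu>)" by (simp add: Phi_def mult.commute)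
qed

section \<open>The pointwise norm and the divergence of \<open>Phi \<mu> v\<close>;
  injectivity\<close>

text \<open>The bounds of a derivation are stable under countable infima, which is what
  \<open>ae_least_element\<close> asks of a family.\<close>

lemma ex_is_der_norm:
  assumes "\<exists>G. der_bound \<mu> b G"
  shows "\<exists>G. is_der_norm \<mu> b G"
proof -
  have "\<exists>G\<in>{G. der_bound \<mu> b G}. \<forall>H\<in>{G. der_bound \<mu> b G}. AE x in \<mu>. G x \<le> H x"
  proof (rule ae_least_element)
    show "{G. der_bound \<mu> b G} \<noteq> {}" using assms by blast
    show "f \<in> borel_measurable \<mu>" if "f \<in> {G. der_bound \<mu> b G}" for f
      using that by (simp add: der_bound_def)
    fix G :: "nat \<Rightarrow> 'a \<Rightarrow> real" assume "\<And>n. G n \<in> {G. der_bound \<mu> b G}"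
    then have G: "\<And>n. der_bound \<mu> b (G n)" by simp
    then have [measurable]: "G n \<in> borel_measurable \<mu>" for n by (simp add: der_bound_def)
    have nn: "AE x in \<mu>. \<forall>n. 0 \<le> G n x"
      unfolding AE_all_countable using G by (simp add: der_bound_def)
    define I where "I = (\<lambda>x. INF n. G n x)"
    have bdd: "bdd_below (range (\<lambda>n. G n x))" if "\<forall>n. 0 \<le> G n x" for x
      by (rule bdd_belowI[of _ 0]) (use that in auto)
    have "der_bound \<mu> b I"
      unfolding der_bound_def
    proof (intro conjI ballI)
      show "I \<in> borel_measurable \<mu>" unfolding I_def by measurable
      show "AE x in \<mu>. 0 \<le> I x"
        using nn unfolding I_def by eventually_elim (rule cINF_greatest, auto)
      fix f :: "'a \<Rightarrow> real" assume f: "f \<in> LIPc"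
      have "AE x in \<mu>. \<forall>n. \<bar>b f x\<bar> \<le> G n x * lip_a f x"
        unfolding AE_all_countable using G f by (simp add: der_bound_def)
      with nn show "AE x in \<mu>. \<bar>b f x\<bar> \<le> I x * lip_a f x"
      proof eventually_elim
        case (elim x)
        show ?case
        \<comment> \<open>Taking the infimum over \<open>n\<close> requires dividing by
          \<open>lip_a f x\<close>. Where it vanishes, any single bound already gives
          \<open>b f x = 0\<close>.\<close>
        proof (cases "lip_a f x = 0")
          case True
          then show ?thesis using elim(2) by simp
        next
          case False
          then have pos: "0 < lip_a f x" using lip_a_nonneg[OF f, of x] by simp
          have "\<bar>b f x\<bar> / lip_a f x \<le> I x"
            unfolding I_def
            by (rule cINF_greatest) (use elim(2) pos in \<open>auto simp: pos_divide_le_eq\<close>)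
          then show ?thesis using pos by (simp add: pos_divide_le_eq)
        qed
      qed
    qed
    moreover have "AE x in \<mu>. I x \<le> G n x" for n
      using nn unfolding I_def by eventually_elim (rule cINF_lower[OF bdd], auto)
    ultimately show "\<exists>g\<in>{G. der_bound \<mu> b G}. \<forall>n. AE x in \<mu>. g x \<le> G n x" by blast
  qed
  then show ?thesis by (auto simp: is_der_norm_def)
qed

lemma is_der_norm_der_norm:
  assumes "\<exists>G. der_bound \<mu> b G"
  shows "is_der_norm \<mu> b (der_norm \<mu> b)"
  unfolding der_norm_def using ex_is_der_norm[OF assms] by (rule someI_ex)

lemma der_norm_eq:
  assumes G: "is_der_norm \<mu> b G"
  shows "AE x in \<mu>. der_norm \<mu> b x = G x"
proof -
  have "is_der_norm \<mu> b (der_norm \<mu> b)"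
    using G by (intro is_der_norm_der_norm) (auto simp: is_der_norm_def)
  then have "AE x in \<mu>. der_norm \<mu> b x \<le> G x" "AE x in \<mu>. G x \<le> der_norm \<mu> b x"
    using G by (auto simp: is_der_norm_def)
  then show ?thesis by eventually_elim simp
qed

definition cutoff :: "nat \<Rightarrow> 'a \<Rightarrow> real" where
  "cutoff n = (SOME h. h \<in> Cinf_c \<and> (\<forall>x\<in>cball 0 (real n). h x = 1))"

lemma cutoff: "cutoff n \<in> Cinf_c \<and> (\<forall>x\<in>cball 0 (real n). cutoff n x = 1)"
proof -
  have "\<exists>h :: 'a \<Rightarrow> real. h \<in> Cinf_c \<and> (\<forall>x\<in>cball 0 (real n). h x = 1)"
    by (rule cutoff_ball[of "real n"]) blast
  then show ?thesis unfolding cutoff_def by (rule someI_ex)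
qed

text \<open>A linear function is not compactly supported and so cannot be fed to a derivation. The
  integer \<open>n\<close> keeps the family of truncations countable, and around any point a large
  enough \<open>n\<close> leaves the function linear.\<close>

definition truncated_inner :: "nat \<Rightarrow> 'a \<Rightarrow> 'a \<Rightarrow> real" where
  "truncated_inner n \<xi> x = cutoff n x * (x \<bullet> \<xi>)"

lemma truncated_inner_Cinf_c: "truncated_inner n \<xi> \<in> Cinf_c"
  unfolding truncated_inner_def[abs_def] by (rule Cinf_c_mult_Ck[OF conjunct1[OF cutoff] Ck_inner])

lemma grad_truncated_inner:
  assumes "norm x < real n"
  shows "grad (truncated_inner n \<xi>) x = \<xi>"
proof (rule has_derivative_grad_eq)
  have "((\<lambda>x. x \<bullet> \<xi>) has_derivative (\<lambda>h. h \<bullet> \<xi>)) (at x)"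
    by (auto intro!: derivative_eq_intros)
  then show "(truncated_inner n \<xi> has_derivative (\<lambda>h. h \<bullet> \<xi>)) (at x)"
    by (rule has_derivative_transform_within_open[OF _ open_ball[of 0 "real n"]])
      (use assms cutoff in \<open>auto simp: truncated_inner_def\<close>)
qed

text \<open>The supremum that recovers the norm of \<open>v x\<close> is reached in the direction of
  \<open>v x\<close>, which changes with \<open>x\<close>. The bound \<open>H\<close> is therefore
  tested on countably many directions first.\<close>

lemma is_der_norm_Phi:
  assumes v: "v \<in> D_infty \<mu>"
  shows "is_der_norm \<mu> (Phi \<mu> v) (\<lambda>x. norm (v x))"
  unfolding is_der_norm_def
proof (intro conjI allI impI der_bound_Phi[OF v])
  fix H assume H: "der_bound \<mu> (Phi \<mu> v) H"
  obtain D :: "'a set" where D: "countable D" "\<And>X. open X \<Longrightarrow> X \<noteq> {} \<Longrightarrow> \<exists>d\<in>D. d \<in> X"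
    using countable_dense_exists by metis
  have "AE x in \<mu>. \<forall>n. \<forall>\<xi>\<in>D. \<bar>v x \<bullet> grad (truncated_inner n \<xi>) x\<bar> \<le> H x * lip_a (truncated_inner n \<xi>) x"
    unfolding AE_all_countable AE_ball_countable[OF D(1)]
  proof (intro allI ballI)
    fix n \<xi>
    have "AE x in \<mu>. \<bar>Phi \<mu> v (truncated_inner n \<xi>) x\<bar> \<le> H x * lip_a (truncated_inner n \<xi>) x"
      using H Cinf_c_LIPc[OF truncated_inner_Cinf_c] by (simp add: der_bound_def)
    with Phi_smooth[OF v truncated_inner_Cinf_c[of n \<xi>]]
    show "AE x in \<mu>. \<bar>v x \<bullet> grad (truncated_inner n \<xi>) x\<bar> \<le> H x * lip_a (truncated_inner n \<xi>) x"
      by eventually_elim simp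
  qed
  moreover have "AE x in \<mu>. 0 \<le> H x" using H by (simp add: der_bound_def)
  ultimately show "AE x in \<mu>. norm (v x) \<le> H x"
  proof eventually_elim
    case (elim x)
    obtain n where n: "norm x < real n" using reals_Archimedean2 by blast
    have "D \<subseteq> {\<xi>. \<bar>v x \<bullet> \<xi>\<bar> \<le> H x * norm \<xi>}"
    proof
      fix \<xi> assume "\<xi> \<in> D"
      then have "\<bar>v x \<bullet> \<xi>\<bar> \<le> H x * lip_a (truncated_inner n \<xi>) x"
        using elim(1) grad_truncated_inner[OF n, of \<xi>] by metis
      also have "\<dots> \<le> H x * norm \<xi>"
        using lip_a_le_norm_grad[OF truncated_inner_Cinf_c, of n \<xi> x] grad_truncated_inner[OF n, of \<xi>] elim(2)
        by (intro mult_left_mono) auto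
      finally show "\<xi> \<in> {\<xi>. \<bar>v x \<bullet> \<xi>\<bar> \<le> H x * norm \<xi>}" by simp
    qed
    moreover have "closed {\<xi>. \<bar>v x \<bullet> \<xi>\<bar> \<le> H x * norm \<xi>}"
      by (intro closed_Collect_le continuous_intros)
    \<comment> \<open>Both sides are continuous in \<xi>, so the estimate extends from the dense set
      to the direction \<open>v x\<close>, where it reads as the square of the norm against
      \<open>H x\<close> times the norm.\<close>
    ultimately have "v x \<in> {\<xi>. \<bar>v x \<bullet> \<xi>\<bar> \<le> H x * norm \<xi>}"
      by (intro dense_closed_UNIV[OF D(2)])
    then have "norm (v x) * norm (v x) \<le> H x * norm (v x)"
      by (simp add: dot_square_norm power2_eq_square)
    then show ?case using elim(2) by (cases "v x = 0") auto
  qed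
qed

lemma Phi_in_Der_b:
  assumes v: "v \<in> D_infty \<mu>"
  shows "Phi \<mu> v \<in> Der_b \<mu>"
proof -
  have "is_der_norm \<mu> (Phi \<mu> v) (der_norm \<mu> (Phi \<mu> v))"
    using der_bound_Phi[OF v] by (intro is_der_norm_der_norm) blast
  then have m: "der_norm \<mu> (Phi \<mu> v) \<in> borel_measurable \<mu>" by (simp add: is_der_norm_def der_bound_def)
  obtain C where "AE x in \<mu>. norm (v x) \<le> C" using D_infty_Linfty[OF v] by (auto simp: Linfty_def)
  with der_norm_eq[OF is_der_norm_Phi[OF v]]
  have "AE x in \<mu>. norm (der_norm \<mu> (Phi \<mu> v) x) \<le> C" by eventually_elim simp
  with m have "der_norm \<mu> (Phi \<mu> v) \<in> Linfty \<mu>" by (auto simp: Linfty_def)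
  moreover obtain g where "has_div_mu \<mu> v g" using v by (auto simp: D_infty_def)
  ultimately show ?thesis
    using is_derivation_Phi[OF v] has_der_div_Phi[OF v] by (auto simp: Der_b_def)
qed

lemma has_div_mu_div_mu: "v \<in> D_infty \<mu> \<Longrightarrow> has_div_mu \<mu> v (div_mu \<mu> v)"
  unfolding div_mu_def D_infty_def by (auto intro: someI[where P = "has_div_mu \<mu> v"])

lemma der_div_Phi:
  assumes v: "v \<in> D_infty \<mu>"
  shows "AE x in \<mu>. der_div \<mu> (Phi \<mu> v) x = div_mu \<mu> v x"
proof -
  have 1: "has_der_div \<mu> (Phi \<mu> v) (div_mu \<mu> v)"
    by (rule has_der_div_Phi[OF v has_div_mu_div_mu[OF v]])
  then have 2: "has_der_div \<mu> (Phi \<mu> v) (der_div \<mu> (Phi \<mu> v))"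
    unfolding der_div_def by (rule someI[where P = "has_der_div \<mu> (Phi \<mu> v)"])
  show ?thesis
  proof (rule Linfty_test_unique)
    show "(\<integral>x. F x * der_div \<mu> (Phi \<mu> v) x \<partial>\<mu>) = (\<integral>x. F x * div_mu \<mu> v x \<partial>\<mu>)" if "F \<in> Cinf_c" for F
    proof -
      have F: "F \<in> LIPc" by (rule Cinf_c_LIPc[OF that])
      have "(\<integral>x. Phi \<mu> v F x \<partial>\<mu>) = - (\<integral>x. F x * der_div \<mu> (Phi \<mu> v) x \<partial>\<mu>)"
        "(\<integral>x. Phi \<mu> v F x \<partial>\<mu>) = - (\<integral>x. F x * div_mu \<mu> v x \<partial>\<mu>)"
        using 1 2 F by (auto simp: has_der_div_def)
      then show ?thesis by linarith
    qed
  qed (use 1 2 in \<open>auto simp: has_der_div_def\<close>)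
qed

text \<open>Truncated coordinate functions suffice: at a point of norm below \<open>n\<close> their
  gradients are the basis vectors, so the components of \<open>v x\<close> and \<open>w x\<close>
  are values of the two derivations.\<close>

lemma Phi_inject:
  assumes v: "v \<in> D_infty \<mu>" and w: "w \<in> D_infty \<mu>"
    and eq: "\<And>f. f \<in> LIPc \<Longrightarrow> AE x in \<mu>. Phi \<mu> v f x = Phi \<mu> w f x"
  shows "AE x in \<mu>. v x = w x"
proof -
  have "AE x in \<mu>. \<forall>n. \<forall>e\<in>Basis. v x \<bullet> grad (truncated_inner n e) x = w x \<bullet> grad (truncated_inner n e) x"
    unfolding AE_all_countable AE_ball_countable[OF countable_finite[OF finite_Basis]]
  proof (intro allI ballI)
    fix n and e :: 'a
    show "AE x in \<mu>. v x \<bullet> grad (truncated_inner n e) x = w x \<bullet> grad (truncated_inner n e) x"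
      using eq[OF Cinf_c_LIPc[OF truncated_inner_Cinf_c[of n e]]]
        Phi_smooth[OF v truncated_inner_Cinf_c[of n e]] Phi_smooth[OF w truncated_inner_Cinf_c[of n e]]
      by eventually_elim simp
  qed
  then show ?thesis
  proof eventually_elim
    case (elim x)
    obtain n where n: "norm x < real n" using reals_Archimedean2 by blast
    show ?case
    proof (rule euclidean_eqI)
      fix e :: 'a assume "e \<in> Basis"
      then show "v x \<bullet> e = w x \<bullet> e"
        using elim grad_truncated_inner[OF n, of e] by metis
    qed
  qed
qed

section \<open>Integration by parts for derivations and the module structure on fields\<close>

text \<open>The divergence identity for the product of \<open>h\<close> and \<open>f\<close> moves
  \<open>b\<close> from \<open>f\<close> onto \<open>h\<close>. With a test function as
  \<open>h\<close>, the action on a Lipschitz function is determined by the divergence and the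
  action on test functions.\<close>

lemma derivation_integration_by_parts:
  assumes b: "is_derivation \<mu> b" and bL: "\<And>f. f \<in> LIPc \<Longrightarrow> b f \<in> Linfty \<mu>"
    and g: "has_der_div \<mu> b g" and f: "f \<in> LIPc" and h: "h \<in> LIPc"
  shows "(\<integral>x. h x * b f x \<partial>\<mu>) = - (\<integral>x. h x * f x * g x \<partial>\<mu>) - (\<integral>x. f x * b h x \<partial>\<mu>)"
proof -
  have i: "integrable \<mu> (\<lambda>x. h x * b f x)" "integrable \<mu> (\<lambda>x. f x * b h x)"
    using Linfty_integrable_mult[OF bL[OF f] h] Linfty_integrable_mult[OF bL[OF h] f] by auto
  have hf: "(\<lambda>x. h x * f x) \<in> LIPc" by (rule LIPc_mult[OF h f])
  have "AE x in \<mu>. b (\<lambda>y. h y * f y) x = b h x * f x + h x * b f x"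
    using b h f by (simp add: is_derivation_def)
  then have "(\<integral>x. b (\<lambda>y. h y * f y) x \<partial>\<mu>) = (\<integral>x. f x * b h x + h x * b f x \<partial>\<mu>)"
    using i Linfty_measurable[OF bL[OF hf]]
    by (intro integral_cong_AE) (auto simp: mult.commute intro: borel_measurable_add)
  also have "\<dots> = (\<integral>x. f x * b h x \<partial>\<mu>) + (\<integral>x. h x * b f x \<partial>\<mu>)" using i by simp
  finally have "(\<integral>x. b (\<lambda>y. h y * f y) x \<partial>\<mu>) = (\<integral>x. f x * b h x \<partial>\<mu>) + (\<integral>x. h x * b f x \<partial>\<mu>)" .
  moreover have "(\<integral>x. b (\<lambda>y. h y * f y) x \<partial>\<mu>) = - (\<integral>x. h x * f x * g x \<partial>\<mu>)"
    using g hf by (simp add: has_der_div_def)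
  ultimately show ?thesis by linarith
qed

lemma D_infty_add:
  assumes v: "v \<in> D_infty \<mu>" and w: "w \<in> D_infty \<mu>"
  shows "(\<lambda>x. v x + w x) \<in> D_infty \<mu>"
proof -
  obtain g k where g: "has_div_mu \<mu> v g" and k: "has_div_mu \<mu> w k"
    using v w by (auto simp: D_infty_def)
  have gL: "g \<in> Linfty \<mu>" "k \<in> Linfty \<mu>" using g k by (auto simp: has_div_mu_def)
  have "has_div_mu \<mu> (\<lambda>x. v x + w x) (\<lambda>x. g x + k x)"
    unfolding has_div_mu_def
  proof (intro conjI ballI)
    show "(\<lambda>x. g x + k x) \<in> Linfty \<mu>" by (rule Linfty_add[OF gL])
    fix F :: "'a \<Rightarrow> real" assume F: "F \<in> Cinf_c"
    have "integrable \<mu> (\<lambda>x. grad F x \<bullet> v x)" "integrable \<mu> (\<lambda>x. grad F x \<bullet> w x)"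
      using Linfty_inner_integrable[OF D_infty_Linfty[OF v] integrable_grad[OF F]]
        Linfty_inner_integrable[OF D_infty_Linfty[OF w] integrable_grad[OF F]]
      by (simp_all add: inner_commute)
    moreover have "integrable \<mu> (\<lambda>x. F x * g x)" "integrable \<mu> (\<lambda>x. F x * k x)"
      using Linfty_integrable_mult[OF gL(1) Cinf_c_LIPc[OF F]]
        Linfty_integrable_mult[OF gL(2) Cinf_c_LIPc[OF F]] by simp_all
    ultimately show "(\<integral>x. grad F x \<bullet> (v x + w x) \<partial>\<mu>) = - (\<integral>x. F x * (g x + k x) \<partial>\<mu>)"
      using g k F by (simp add: has_div_mu_def inner_add_right distrib_left)
  qed
  moreover have "(\<lambda>x. v x + w x) \<in> Linfty \<mu>" by (intro Linfty_add D_infty_Linfty v w)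
  ultimately show ?thesis by (auto simp: D_infty_def)
qed

lemma D_infty_scaleR:
  assumes v: "v \<in> D_infty \<mu>"
  shows "(\<lambda>x. c *\<^sub>R v x) \<in> D_infty \<mu>"
proof -
  obtain g where g: "has_div_mu \<mu> v g" using v by (auto simp: D_infty_def)
  have L: "(\<lambda>x. c *\<^sub>R v x) \<in> Linfty \<mu>" "(\<lambda>x. c *\<^sub>R g x) \<in> Linfty \<mu>"
    using g v by (auto intro!: Linfty_scaleR[OF Linfty_const[of c]] simp del: real_scaleR_def simp: has_div_mu_def D_infty_def)
  have "has_div_mu \<mu> (\<lambda>x. c *\<^sub>R v x) (\<lambda>x. c *\<^sub>R g x)"
    using g L(2) by (simp add: has_div_mu_def mult.left_commute)
  then show ?thesis using L(1) by (auto simp: D_infty_def)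
qed

text \<open>The product of \<open>h\<close> with a test function is only Lipschitz, so the
  divergence of \<open>v\<close> cannot be tested on it directly. The divergence of
  \<open>Phi \<mu> v\<close> can, as it is tested on all of \<open>LIPc\<close>; this yields the
  product rule with \<open>Phi \<mu> v h\<close> as the derivative of \<open>h\<close> along
  \<open>v\<close>.\<close>

lemma D_infty_LIPc_scaleR:
  assumes v: "v \<in> D_infty \<mu>" and h: "h \<in> LIPc"
  shows "(\<lambda>x. h x *\<^sub>R v x) \<in> D_infty \<mu>"
proof -
  obtain g where g: "has_div_mu \<mu> v g" using v by (auto simp: D_infty_def)
  have gL: "g \<in> Linfty \<mu>" using g by (simp add: has_div_mu_def)
  have vL: "v \<in> Linfty \<mu>" by (rule D_infty_Linfty[OF v])
  have hL: "h \<in> Linfty \<mu>" by (rule LIPc_Linfty[OF h])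
  have "has_div_mu \<mu> (\<lambda>x. h x *\<^sub>R v x) (\<lambda>x. h x * g x + Phi \<mu> v h x)"
    unfolding has_div_mu_def
  proof (intro conjI ballI)
    show "(\<lambda>x. h x * g x + Phi \<mu> v h x) \<in> Linfty \<mu>"
      using Linfty_add[OF Linfty_scaleR[OF hL gL] Phi_Linfty[OF v h]] by simp
    fix F :: "'a \<Rightarrow> real" assume F: "F \<in> Cinf_c"
    have FL: "F \<in> LIPc" by (rule Cinf_c_LIPc[OF F])
    have [measurable]: "v \<in> borel_measurable \<mu>" "h \<in> borel_measurable \<mu>" "grad F \<in> borel_measurable \<mu>"
      "Phi \<mu> v F \<in> borel_measurable \<mu>"
      by (rule Linfty_measurable[OF vL], rule Linfty_measurable[OF hL], rule grad_measurable[OF F],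
          rule Linfty_measurable[OF Phi_Linfty[OF v FL]])
    have "(\<integral>x. grad F x \<bullet> (h x *\<^sub>R v x) \<partial>\<mu>) = (\<integral>x. h x * Phi \<mu> v F x \<partial>\<mu>)"
    proof (rule integral_cong_AE)
      show "AE x in \<mu>. grad F x \<bullet> (h x *\<^sub>R v x) = h x * Phi \<mu> v F x"
        using Phi_smooth[OF v F] by eventually_elim (simp add: inner_commute)
    qed measurable
    also have "\<dots> = - (\<integral>x. h x * F x * g x \<partial>\<mu>) - (\<integral>x. F x * Phi \<mu> v h x \<partial>\<mu>)"
      by (rule derivation_integration_by_parts[OF is_derivation_Phi[OF v] Phi_Linfty[OF v]
            has_der_div_Phi[OF v g] FL h])
    also have "\<dots> = - (\<integral>x. F x * (h x * g x + Phi \<mu> v h x) \<partial>\<mu>)"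
    proof -
      have "integrable \<mu> (\<lambda>x. F x * (h x * g x))"
        using Linfty_integrable_mult[OF Linfty_scaleR[OF hL gL] FL] by simp
      moreover have "integrable \<mu> (\<lambda>x. F x * Phi \<mu> v h x)"
        using Linfty_integrable_mult[OF Phi_Linfty[OF v h] FL] by simp
      ultimately show ?thesis by (simp add: distrib_left mult.left_commute mult.assoc)
    qed
    finally show "(\<integral>x. grad F x \<bullet> (h x *\<^sub>R v x) \<partial>\<mu>) = - (\<integral>x. F x * (h x * g x + Phi \<mu> v h x) \<partial>\<mu>)" .
  qed
  moreover have "(\<lambda>x. h x *\<^sub>R v x) \<in> Linfty \<mu>" by (rule Linfty_scaleR[OF hL vL])
  ultimately show ?thesis by (auto simp: D_infty_def)
qed

section \<open>Surjectivity: recovering the field from a derivation\<close>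

lemma LIPc_zero: "(\<lambda>x::'a. 0) \<in> LIPc"
  using LIPc_cmult[OF Cinf_c_LIPc[OF truncated_inner_Cinf_c], of 0] by simp

lemma LIPc_sum: "finite S \<Longrightarrow> (\<And>e. e \<in> S \<Longrightarrow> f e \<in> LIPc) \<Longrightarrow> (\<lambda>x::'a. \<Sum>e\<in>S. c e * f e x) \<in> LIPc"
proof (induction S rule: finite_induct)
  case (insert e S)
  have "(\<lambda>x. c e * f e x + (\<Sum>e\<in>S. c e * f e x)) \<in> LIPc"
    using insert by (intro LIPc_add LIPc_cmult) auto
  then show ?case using insert(1,2) by simp
qed (simp add: LIPc_zero)

lemma derivation_add:
  "is_derivation \<mu> b \<Longrightarrow> f \<in> LIPc \<Longrightarrow> g \<in> LIPc \<Longrightarrow> AE x in \<mu>. b (\<lambda>y. f y + g y) x = b f x + b g x"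
  unfolding is_derivation_def by blast

lemma derivation_cmult:
  "is_derivation \<mu> b \<Longrightarrow> f \<in> LIPc \<Longrightarrow> AE x in \<mu>. b (\<lambda>y. c * f y) x = c * b f x"
  unfolding is_derivation_def by blast

text \<open>Serves to expand a truncated linear function into truncated coordinates;
  \<open>is_derivation\<close> provides linearity for two summands and almost everywhere
  only.\<close>

lemma derivation_sum:
  assumes b: "is_derivation \<mu> b"
  shows "finite S \<Longrightarrow> (\<And>e. e \<in> S \<Longrightarrow> f e \<in> LIPc) \<Longrightarrow>
    AE x in \<mu>. b (\<lambda>x. \<Sum>e\<in>S. c e * f e x) x = (\<Sum>e\<in>S. c e * b (f e) x)"
proof (induction S rule: finite_induct)
  case empty
  show ?case using derivation_cmult[OF b LIPc_zero, of 0] by simp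
next
  case (insert e S)
  have S: "(\<lambda>x. \<Sum>e\<in>S. c e * f e x) \<in> LIPc" using insert by (intro LIPc_sum) auto
  have e: "f e \<in> LIPc" "(\<lambda>x. c e * f e x) \<in> LIPc" using insert by (auto intro: LIPc_cmult)
  have "AE x in \<mu>. b (\<lambda>x. c e * f e x + (\<Sum>e\<in>S. c e * f e x)) x
      = b (\<lambda>x. c e * f e x) x + b (\<lambda>x. \<Sum>e\<in>S. c e * f e x) x"
    by (rule derivation_add[OF b e(2) S])
  moreover have "AE x in \<mu>. b (\<lambda>x. c e * f e x) x = c e * b (f e) x"
    by (rule derivation_cmult[OF b e(1)])
  moreover have "AE x in \<mu>. b (\<lambda>x. \<Sum>e\<in>S. c e * f e x) x = (\<Sum>e\<in>S. c e * b (f e) x)"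
    using insert by auto
  ultimately have "AE x in \<mu>. b (\<lambda>x. c e * f e x + (\<Sum>e\<in>S. c e * f e x)) x
      = c e * b (f e) x + (\<Sum>e\<in>S. c e * b (f e) x)"
    by eventually_elim simp
  then show ?case using insert(1,2) by simp
qed

lemma Phi_surj:
  assumes b: "b \<in> Der_b \<mu>"
  shows "\<exists>v\<in>D_infty \<mu>. \<forall>f\<in>LIPc. AE x in \<mu>. Phi \<mu> v f x = b f x"
proof -
  have der: "is_derivation \<mu> b" using b by (simp add: Der_b_def)
  obtain g where g: "has_der_div \<mu> b g" using b by (auto simp: Der_b_def)
  define G where "G = der_norm \<mu> b"
  have "is_der_norm \<mu> b G"
    unfolding G_def using der by (intro is_der_norm_der_norm) (simp add: is_derivation_def)
  then have G: "der_bound \<mu> b G" by (simp add: is_der_norm_def)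
  have G0: "AE x in \<mu>. 0 \<le> G x" using G by (simp add: der_bound_def)
  have bG: "AE x in \<mu>. \<bar>b f x\<bar> \<le> G x * lip_a f x" if "f \<in> LIPc" for f
    using G that by (simp add: der_bound_def)
  have "G \<in> Linfty \<mu>" using b by (simp add: Der_b_def G_def)
  then obtain C where C: "C > 0" "AE x in \<mu>. norm (G x) \<le> C" by (rule LinftyE)
  have bm: "b f \<in> borel_measurable \<mu>" if "f \<in> LIPc" for f
    using der that by (simp add: is_derivation_def)
  have bL: "b f \<in> Linfty \<mu>" if f: "f \<in> LIPc" for f
  proof -
    obtain L where L: "0 \<le> L" "\<And>x. lip_a f x \<le> L" by (rule lip_a_bounded[OF f]) blast
    have "AE x in \<mu>. norm (b f x) \<le> C * L"
      using bG[OF f] C(2) G0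
    proof eventually_elim
      case (elim x)
      have "G x * lip_a f x \<le> C * L"
        using elim C(1) L(2)[of x] lip_a_nonneg[OF f] by (intro mult_mono) auto
      then show ?case using elim(1) by simp
    qed
    then show ?thesis using bm[OF f] by (auto simp: Linfty_def)
  qed
  let ?t = truncated_inner
  note tL = Cinf_c_LIPc[OF truncated_inner_Cinf_c]
  \<comment> \<open>An integer radius exceeding the norm of \<open>x\<close>, chosen measurably: at
    \<open>x\<close> the truncation of index \<open>N x\<close> has the gradient of the linear
    function.\<close>
  define N where "N = (\<lambda>x::'a. nat \<lceil>norm x\<rceil> + 1)"
  have N: "norm x < real (N x)" for x
    using real_nat_ceiling_ge[of "norm x"] unfolding N_def of_nat_add of_nat_1 by linarith
  define v where "v = (\<lambda>x. \<Sum>e\<in>Basis. b (?t (N x) e) x *\<^sub>R e)"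
  have v_inner: "v x \<bullet> \<xi> = (\<Sum>e\<in>Basis. (\<xi> \<bullet> e) * b (?t (N x) e) x)" for x \<xi>
    unfolding v_def inner_sum_left by (intro sum.cong) (auto simp: inner_commute)
  have lip_t: "lip_a (?t (N x) e) x \<le> norm e" for x e
    using lip_a_le_norm_grad[OF truncated_inner_Cinf_c, of "N x" e x] grad_truncated_inner[OF N, of x e] by simp
  have vL: "v \<in> Linfty \<mu>"
  proof -
    \<comment> \<open>The index \<open>N x\<close> varies with the point, so the bounds for all
      \<open>n\<close> must hold outside one common null set before \<open>n\<close> is set to
      \<open>N x\<close>.\<close>
    have "AE x in \<mu>. \<forall>n. \<forall>e\<in>Basis. \<bar>b (?t n e) x\<bar> \<le> G x * lip_a (?t n e) x"
      unfolding AE_all_countable AE_ball_countable[OF countable_finite[OF finite_Basis]]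
      using bG[OF tL] by blast
    with C(2) G0 have "AE x in \<mu>. norm (v x) \<le> real DIM('a) * C"
    proof eventually_elim
      case (elim x)
      have "norm (b (?t (N x) e) x *\<^sub>R e) \<le> C" if e: "e \<in> Basis" for e
      proof -
        have "\<bar>b (?t (N x) e) x\<bar> \<le> G x * lip_a (?t (N x) e) x" using elim(3) e by blast
        also have "\<dots> \<le> G x * 1" using lip_t[of x e] e elim(2) by (intro mult_left_mono) auto
        finally show ?thesis using e elim(1) by simp
      qed
      then have "norm (v x) \<le> (\<Sum>e\<in>(Basis::'a set). C)"
        unfolding v_def by (rule sum_norm_le)
      then show ?case by simp
    qed
    moreover have "v \<in> borel_measurable \<mu>"
    proof -
      have [measurable]: "N \<in> measurable \<mu> (count_space UNIV)"
        unfolding N_def by measurable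
      have "(\<lambda>x. b (?t (N x) e) x) \<in> borel_measurable \<mu>" for e
        \<comment> \<open>The index takes countably many values, so gluing the measurable functions
          for the separate indices along \<open>N\<close> stays measurable.\<close>
        by (rule measurable_compose_countable[where f = "\<lambda>n x. b (?t n e) x"]) (use bm[OF tL] in measurable)
      then show ?thesis unfolding v_def by (intro borel_measurable_sum borel_measurable_scaleR) auto
    qed
    ultimately show ?thesis by (auto simp: Linfty_def)
  qed
  obtain D :: "'a set" where D: "countable D" "\<And>X. open X \<Longrightarrow> X \<noteq> {} \<Longrightarrow> \<exists>d\<in>D. d \<in> X"
    using countable_dense_exists by metis
  have smooth: "AE x in \<mu>. b F x = v x \<bullet> grad F x" if F: "F \<in> Cinf_c" for F
  proof -
    have "AE x in \<mu>. \<forall>n. \<forall>\<xi>\<in>D. \<bar>b F x - (\<Sum>e\<in>Basis. (\<xi> \<bullet> e) * b (?t n e) x)\<bar>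
        \<le> G x * norm (grad F x - grad (?t n \<xi>) x)"
      unfolding AE_all_countable AE_ball_countable[OF D(1)]
    proof (intro allI ballI)
      fix n \<xi>
      have FL: "F \<in> LIPc" by (rule Cinf_c_LIPc[OF F])
      have dC: "(\<lambda>x. F x - ?t n \<xi> x) \<in> Cinf_c" by (rule Cinf_c_diff[OF F truncated_inner_Cinf_c])
      have t_sum: "?t n \<xi> = (\<lambda>x. \<Sum>e\<in>Basis. (\<xi> \<bullet> e) * ?t n e x)"
      proof
        fix x
        have "x \<bullet> \<xi> = (\<Sum>e\<in>Basis. (x \<bullet> e) * (\<xi> \<bullet> e))" by (rule euclidean_inner)
        then show "?t n \<xi> x = (\<Sum>e\<in>Basis. (\<xi> \<bullet> e) * ?t n e x)"
          by (simp add: truncated_inner_def sum_distrib_left mult_ac)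
      qed
      have "AE x in \<mu>. b (?t n \<xi>) x = (\<Sum>e\<in>Basis. (\<xi> \<bullet> e) * b (?t n e) x)"
        unfolding t_sum[of] by (rule derivation_sum[OF der finite_Basis tL])
      moreover have "AE x in \<mu>. b (\<lambda>y. F y + (-1) * ?t n \<xi> y) x = b F x + b (\<lambda>y. (-1) * ?t n \<xi> y) x"
        by (rule derivation_add[OF der FL LIPc_cmult[OF tL]])
      moreover have "AE x in \<mu>. b (\<lambda>y. (-1) * ?t n \<xi> y) x = (-1) * b (?t n \<xi>) x"
        by (rule derivation_cmult[OF der tL])
      ultimately have "AE x in \<mu>. b (\<lambda>y. F y - ?t n \<xi> y) x = b F x - (\<Sum>e\<in>Basis. (\<xi> \<bullet> e) * b (?t n e) x)"
        by eventually_elim simp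
      with bG[OF Cinf_c_LIPc[OF dC]] G0
      show "AE x in \<mu>. \<bar>b F x - (\<Sum>e\<in>Basis. (\<xi> \<bullet> e) * b (?t n e) x)\<bar> \<le> G x * norm (grad F x - grad (?t n \<xi>) x)"
      proof eventually_elim
        case (elim x)
        have "G x * lip_a (\<lambda>y. F y - ?t n \<xi> y) x \<le> G x * norm (grad F x - grad (?t n \<xi>) x)"
          using lip_a_le_norm_grad[OF dC, of x] elim(2)
          unfolding grad_diff[OF F truncated_inner_Cinf_c] by (rule mult_left_mono)
        then show ?case using elim(1,3) by simp
      qed
    qed
    then show ?thesis
    proof eventually_elim
      case (elim x)
      have "D \<subseteq> {\<xi>. \<bar>b F x - v x \<bullet> \<xi>\<bar> \<le> G x * norm (grad F x - \<xi>)}"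
      proof
        fix \<xi> assume "\<xi> \<in> D"
        with elim have "\<bar>b F x - (\<Sum>e\<in>Basis. (\<xi> \<bullet> e) * b (?t (N x) e) x)\<bar>
            \<le> G x * norm (grad F x - grad (?t (N x) \<xi>) x)" by blast
        then show "\<xi> \<in> {\<xi>. \<bar>b F x - v x \<bullet> \<xi>\<bar> \<le> G x * norm (grad F x - \<xi>)}"
          by (simp add: grad_truncated_inner[OF N] v_inner)
      qed
      moreover have "closed {\<xi>. \<bar>b F x - v x \<bullet> \<xi>\<bar> \<le> G x * norm (grad F x - \<xi>)}"
        by (intro closed_Collect_le continuous_intros)
      \<comment> \<open>At \<open>\<xi> = grad F x\<close> the right-hand side vanishes and the
        inequality becomes the desired identity.\<close>
      ultimately have "grad F x \<in> {\<xi>. \<bar>b F x - v x \<bullet> \<xi>\<bar> \<le> G x * norm (grad F x - \<xi>)}"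
        by (intro dense_closed_UNIV[OF D(2)])
      then show ?case by simp
    qed
  qed
  have gL: "g \<in> Linfty \<mu>" using g by (simp add: has_der_div_def)
  have "has_div_mu \<mu> v g"
    unfolding has_div_mu_def
  proof (intro conjI ballI gL)
    fix F :: "'a \<Rightarrow> real" assume F: "F \<in> Cinf_c"
    have "(\<integral>x. grad F x \<bullet> v x \<partial>\<mu>) = (\<integral>x. b F x \<partial>\<mu>)"
    proof (rule integral_cong_AE)
      show "(\<lambda>x. grad F x \<bullet> v x) \<in> borel_measurable \<mu>"
        using grad_measurable[OF F] Linfty_measurable[OF vL] by (rule borel_measurable_inner)
      show "b F \<in> borel_measurable \<mu>" by (rule bm[OF Cinf_c_LIPc[OF F]])
      show "AE x in \<mu>. grad F x \<bullet> v x = b F x"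
        using smooth[OF F] by eventually_elim (simp add: inner_commute)
    qed
    also have "\<dots> = - (\<integral>x. F x * g x \<partial>\<mu>)" using g Cinf_c_LIPc[OF F] by (simp add: has_der_div_def)
    finally show "(\<integral>x. grad F x \<bullet> v x \<partial>\<mu>) = - (\<integral>x. F x * g x \<partial>\<mu>)" .
  qed
  note vg = this
  have v: "v \<in> D_infty \<mu>" using vL vg by (auto simp: D_infty_def)
  have "AE x in \<mu>. Phi \<mu> v f x = b f x" if f: "f \<in> LIPc" for f
  proof (rule Linfty_test_unique[OF Phi_Linfty[OF v f] bL[OF f]])
    fix F :: "'a \<Rightarrow> real" assume F: "F \<in> Cinf_c"
    have FL: "F \<in> LIPc" by (rule Cinf_c_LIPc[OF F])
    have "(\<integral>x. f x * Phi \<mu> v F x \<partial>\<mu>) = (\<integral>x. f x * b F x \<partial>\<mu>)"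
    proof (rule integral_cong_AE)
      show "AE x in \<mu>. f x * Phi \<mu> v F x = f x * b F x"
        using smooth[OF F] Phi_smooth[OF v F] by eventually_elim simp
    qed (intro borel_measurable_times LIPc_measurable[OF f] bm[OF FL] Linfty_measurable[OF Phi_Linfty[OF v FL]])+
    \<comment> \<open>Both derivations have divergence \<open>g\<close> and agree on the test
      function \<open>F\<close>, so integration by parts gives them the same pairing of
      \<open>F\<close> with the value at \<open>f\<close>.\<close>
    then show "(\<integral>x. F x * Phi \<mu> v f x \<partial>\<mu>) = (\<integral>x. F x * b f x \<partial>\<mu>)"
      using derivation_integration_by_parts[OF der bL g f FL]
        derivation_integration_by_parts[OF is_derivation_Phi[OF v] Phi_Linfty[OF v] has_der_div_Phi[OF v vg] f FL]
      by simp
  qed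
  then show ?thesis using v by blast
qed

section \<open>Passage to classes modulo almost everywhere equality\<close>

lemma Phi_respects: "(\<lambda>v. der_eq \<mu> `` {Phi \<mu> v}) respects vf_eq \<mu>"
proof (rule congruentI)
  fix v w assume vw: "(v, w) \<in> vf_eq \<mu>"
  then have v: "v \<in> D_infty \<mu>" "w \<in> D_infty \<mu>" and eq: "AE x in \<mu>. v x = w x" by (auto simp: vf_eq_def)
  have "AE x in \<mu>. Phi \<mu> v f x = Phi \<mu> w f x" for f
    using eq by eventually_elim (simp add: Phi_def)
  then have "(Phi \<mu> v, Phi \<mu> w) \<in> der_eq \<mu>" using v Phi_in_Der_b by (simp add: der_eq_def)
  then show "der_eq \<mu> `` {Phi \<mu> v} = der_eq \<mu> `` {Phi \<mu> w}"
    by (rule equiv_class_eq[OF equiv_der_eq])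
qed

lemma on_classes_Phi:
  "v \<in> D_infty \<mu> \<Longrightarrow> on_classes \<mu> (Phi \<mu>) (vf_eq \<mu> `` {v}) = der_eq \<mu> `` {Phi \<mu> v}"
  unfolding on_classes_def by (rule UN_equiv_class[OF equiv_vf_eq Phi_respects])

lemma bij_betw_on_classes_Phi:
  "bij_betw (on_classes \<mu> (Phi \<mu>)) (D_infty \<mu> // vf_eq \<mu>) (Der_b \<mu> // der_eq \<mu>)"
  unfolding bij_betw_def
proof
  show "inj_on (on_classes \<mu> (Phi \<mu>)) (D_infty \<mu> // vf_eq \<mu>)"
  proof (rule inj_onI)
    fix V W assume "V \<in> D_infty \<mu> // vf_eq \<mu>" "W \<in> D_infty \<mu> // vf_eq \<mu>"
      and eq: "on_classes \<mu> (Phi \<mu>) V = on_classes \<mu> (Phi \<mu>) W"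
    then obtain v w where v: "v \<in> D_infty \<mu>" "V = vf_eq \<mu> `` {v}" and w: "w \<in> D_infty \<mu>" "W = vf_eq \<mu> `` {w}"
      by (auto elim!: quotientE)
    have "der_eq \<mu> `` {Phi \<mu> v} = der_eq \<mu> `` {Phi \<mu> w}"
      using eq by (simp add: v(2) w(2) on_classes_Phi v(1) w(1))
    then have "(Phi \<mu> v, Phi \<mu> w) \<in> der_eq \<mu>"
      by (rule eq_equiv_class[OF _ equiv_der_eq Phi_in_Der_b[OF w(1)]])
    then have "AE x in \<mu>. v x = w x"
      by (intro Phi_inject v(1) w(1)) (auto simp: der_eq_def)
    then have "(v, w) \<in> vf_eq \<mu>" using v w by (simp add: vf_eq_def)
    then show "V = W" unfolding v(2) w(2) by (rule equiv_class_eq[OF equiv_vf_eq])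
  qed
  show "on_classes \<mu> (Phi \<mu>) ` (D_infty \<mu> // vf_eq \<mu>) = Der_b \<mu> // der_eq \<mu>"
  proof (intro equalityI subsetI)
    fix B assume "B \<in> on_classes \<mu> (Phi \<mu>) ` (D_infty \<mu> // vf_eq \<mu>)"
    then obtain v where "v \<in> D_infty \<mu>" "B = on_classes \<mu> (Phi \<mu>) (vf_eq \<mu> `` {v})"
      by (auto elim!: quotientE)
    then show "B \<in> Der_b \<mu> // der_eq \<mu>" by (simp add: on_classes_Phi quotientI Phi_in_Der_b)
  next
    fix B assume "B \<in> Der_b \<mu> // der_eq \<mu>"
    then obtain b where b: "b \<in> Der_b \<mu>" "B = der_eq \<mu> `` {b}" by (auto elim!: quotientE)
    obtain v where v: "v \<in> D_infty \<mu>" "\<forall>f\<in>LIPc. AE x in \<mu>. Phi \<mu> v f x = b f x"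
      using Phi_surj[OF b(1)] by blast
    then have "(Phi \<mu> v, b) \<in> der_eq \<mu>" using b(1) Phi_in_Der_b by (simp add: der_eq_def)
    then have "der_eq \<mu> `` {Phi \<mu> v} = B" unfolding b(2) by (rule equiv_class_eq[OF equiv_der_eq])
    then have "B = on_classes \<mu> (Phi \<mu>) (vf_eq \<mu> `` {v})" by (simp add: on_classes_Phi v(1))
    then show "B \<in> on_classes \<mu> (Phi \<mu>) ` (D_infty \<mu> // vf_eq \<mu>)"
      by (rule image_eqI[OF _ quotientI[OF v(1)]])
  qed
qed

text \<open>For a fixed choice of \<open>tgrad\<close> the formula is linear in \<open>v x\<close>
  at every point, so the identities hold exactly on representatives. The content lies in the closure
  of \<open>D_infty\<close> under the operations.\<close>

lemma LIPc_linear_Phi: "LIPc_linear \<mu> (Phi \<mu>)"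
proof -
  have refl: "(Phi \<mu> v, Phi \<mu> v) \<in> der_eq \<mu>" if "v \<in> D_infty \<mu>" for v
    using Phi_in_Der_b[OF that] by (simp add: der_eq_def)
  have add: "(\<lambda>f x. Phi \<mu> v f x + Phi \<mu> w f x) = Phi \<mu> (\<lambda>x. v x + w x)" for v w :: "'a \<Rightarrow> 'a"
    by (intro ext) (simp add: Phi_def inner_add_left)
  have scale: "(\<lambda>f x. h x * Phi \<mu> v f x) = Phi \<mu> (\<lambda>x. h x *\<^sub>R v x)" for h :: "'a \<Rightarrow> real" and v :: "'a \<Rightarrow> 'a"
    by (intro ext) (simp add: Phi_def)
  show ?thesis
    unfolding LIPc_linear_def add scale
    using refl D_infty_add D_infty_scaleR D_infty_LIPc_scaleR by blast
qed

end

theorem theorem5p6: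
  fixes \<mu> :: "(real ^ 'n) measure"
  assumes "radon_measure \<mu>"
  shows "(\<forall>v\<in>D_infty \<mu>. Phi \<mu> v \<in> Der_b \<mu> \<and> (\<forall>f\<in>LIPc. Phi \<mu> v f \<in> Linfty \<mu>)) \<and>
         (\<lambda>v. der_eq \<mu> `` {Phi \<mu> v}) respects vf_eq \<mu> \<and>
         bij_betw (on_classes \<mu> (Phi \<mu>)) (D_infty \<mu> // vf_eq \<mu>) (Der_b \<mu> // der_eq \<mu>) \<and>
         LIPc_linear \<mu> (Phi \<mu>) \<and>
         (\<forall>v\<in>D_infty \<mu>.
            (AE x in \<mu>. der_norm \<mu> (Phi \<mu> v) x = norm (v x)) \<and>
            (AE x in \<mu>. der_div \<mu> (Phi \<mu> v) x = div_mu \<mu> v x))"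
proof -
  interpret radon \<mu> using assms by unfold_locales
  show ?thesis
    using Phi_in_Der_b Phi_Linfty Phi_respects bij_betw_on_classes_Phi LIPc_linear_Phi
      der_norm_eq[OF is_der_norm_Phi] der_div_Phi by blast
qed

end
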